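(* Let $p\ge 1$ and let $\gamma_p$ denote the lowest eigenvalue of the self-adjoint operator $H_p u=-u''+|t|^p u$ on $L^2(\mathbb{R})$. Let $L_p(\gamma_p)$ be the closure in $L^2(\mathbb{R}^2)$ of the operator $$\psi\mapsto-\Delta\psi+\bigl(|xy|^p-\gamma_p(x^2+y^2)^{p/(p+2)}\bigr)\psi$$ defined on $C_0^\infty(\mathbb{R}^2)$. Then the essential spectrum of $L_p(\gamma_p)$ contains the interval $[0,\infty)$.
   Context: $(x,y)$ are Cartesian coordinates in $\mathbb{R}^2$. The operator on $C_0^\infty(\mathbb{R}^2)$ is essentially self-adjoint, so $L_p(\gamma_p)$ is self-adjoint. *)

theory Defs
  imports "HOL-Analysis.Analysis"
begin

definition sq_int :: "('a::euclidean_space \<Rightarrow> complex) \<Rightarrow> bool" where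
  "sq_int f \<longleftrightarrow> f \<in> borel_measurable lborel \<and> integrable lborel (\<lambda>x. (cmod (f x))\<^sup>2)"

definition l2norm :: "('a::euclidean_space \<Rightarrow> complex) \<Rightarrow> real" where
  "l2norm f = sqrt (\<integral>x. (cmod (f x))\<^sup>2 \<partial>lborel)"

definition l2dist :: "('a::euclidean_space \<Rightarrow> complex) \<Rightarrow> ('a \<Rightarrow> complex) \<Rightarrow> real" where
  "l2dist f g = l2norm (\<lambda>x. f x - g x)"

definition closure_graph ::
  "('a::euclidean_space \<Rightarrow> complex) set \<Rightarrow> (('a \<Rightarrow> complex) \<Rightarrow> ('a \<Rightarrow> complex))
     \<Rightarrow> (('a \<Rightarrow> complex) \<times> ('a \<Rightarrow> complex)) set" where
  "closure_graph A Op = {(u, v). sq_int u \<and> sq_int v \<and>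
     (\<exists>\<phi>. (\<forall>n. \<phi> n \<in> A) \<and> (\<lambda>n. l2dist (\<phi> n) u) \<longlonglongrightarrow> 0
          \<and> (\<lambda>n. l2dist (Op (\<phi> n)) v) \<longlonglongrightarrow> 0)}"

text \<open>Essential spectrum of a (closed) operator given by its graph G, defined via Weyl singular
  sequences: normalized u_n in the domain, u_n converging weakly to 0, with (T - lambda) u_n to 0.\<close>
definition ess_spec :: "(('a::euclidean_space \<Rightarrow> complex) \<times> ('a \<Rightarrow> complex)) set \<Rightarrow> complex set" where
  "ess_spec G = {l. \<exists>u v. (\<forall>n. (u n, v n) \<in> G) \<and> (\<forall>n. l2norm (u n) = 1)
      \<and> (\<forall>g. sq_int g \<longrightarrow> (\<lambda>n. \<integral>x. u n x * cnj (g x) \<partial>lborel) \<longlonglongrightarrow> 0)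
      \<and> (\<lambda>n. l2dist (v n) (\<lambda>x. l * u n x)) \<longlonglongrightarrow> 0}"

definition tsupport :: "('a::real_normed_vector \<Rightarrow> complex) \<Rightarrow> 'a set" where
  "tsupport f = closure {x. f x \<noteq> 0}"

definition vd :: "(real \<Rightarrow> complex) \<Rightarrow> real \<Rightarrow> complex" where
  "vd f = (\<lambda>t. vector_derivative f (at t))"

definition smooth1 :: "(real \<Rightarrow> complex) \<Rightarrow> bool" where
  "smooth1 f \<longleftrightarrow> (\<forall>k. continuous_on UNIV ((vd ^^ k) f) \<and> (\<forall>t. (vd ^^ k) f differentiable (at t)))"

definition C0inf1 :: "(real \<Rightarrow> complex) set" where
  "C0inf1 = {f. smooth1 f \<and> compact (tsupport f)}"

definition dx :: "(real \<times> real \<Rightarrow> complex) \<Rightarrow> real \<times> real \<Rightarrow> complex" where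
  "dx f = (\<lambda>(x, y). vector_derivative (\<lambda>s. f (s, y)) (at x))"

definition dy :: "(real \<times> real \<Rightarrow> complex) \<Rightarrow> real \<times> real \<Rightarrow> complex" where
  "dy f = (\<lambda>(x, y). vector_derivative (\<lambda>s. f (x, s)) (at y))"

fun pder :: "bool list \<Rightarrow> (real \<times> real \<Rightarrow> complex) \<Rightarrow> real \<times> real \<Rightarrow> complex" where
  "pder [] f = f"
| "pder (b # bs) f = (if b then dx else dy) (pder bs f)"

definition smooth2 :: "(real \<times> real \<Rightarrow> complex) \<Rightarrow> bool" where
  "smooth2 f \<longleftrightarrow> (\<forall>bs. continuous_on UNIV (pder bs f)
     \<and> (\<forall>x y. (\<lambda>s. pder bs f (s, y)) differentiable (at x)
             \<and> (\<lambda>s. pder bs f (x, s)) differentiable (at y)))"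

definition C0inf2 :: "(real \<times> real \<Rightarrow> complex) set" where
  "C0inf2 = {f. smooth2 f \<and> compact (tsupport f)}"

definition Hop :: "real \<Rightarrow> (real \<Rightarrow> complex) \<Rightarrow> real \<Rightarrow> complex" where
  "Hop p u = (\<lambda>t. - vd (vd u) t + complex_of_real (\<bar>t\<bar> powr p) * u t)"

definition Hp_graph :: "real \<Rightarrow> ((real \<Rightarrow> complex) \<times> (real \<Rightarrow> complex)) set" where
  "Hp_graph p = closure_graph C0inf1 (Hop p)"

definition gamma :: "real \<Rightarrow> real" where
  "gamma p = Inf {l::real. \<exists>u v. (u, v) \<in> Hp_graph p \<and> l2norm u \<noteq> 0
                      \<and> l2dist v (\<lambda>t. complex_of_real l * u t) = 0}"

definition Lop :: "real \<Rightarrow> real \<Rightarrow> (real \<times> real \<Rightarrow> complex) \<Rightarrow> real \<times> real \<Rightarrow> complex" where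
  "Lop p g \<psi> = (\<lambda>(x, y). - (dx (dx \<psi>) (x, y) + dy (dy \<psi>) (x, y))
      + complex_of_real (\<bar>x * y\<bar> powr p - g * (x\<^sup>2 + y\<^sup>2) powr (p / (p + 2))) * \<psi> (x, y))"

definition Lp_graph :: "real \<Rightarrow> real \<Rightarrow> ((real \<times> real \<Rightarrow> complex) \<times> (real \<times> real \<Rightarrow> complex)) set" where
  "Lp_graph p g = closure_graph C0inf2 (Lop p g)"

end

(* Write a = p/(p+2).  Freezing x and putting t = |x|^a y turns -d^2/dy^2 + |xy|^p into
   |x|^(2a) H_p.  If u is the ground state of H_p, the leading potential therefore cancels in
   the x-axis channel on products E(x) u(|x|^a y), where E is a plane wave exp(ikx) cut off to
   N <= x <= 3N, and letting N tend to infinity gives a singular sequence for k^2.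

   The ground state comes from shooting: u'' = (|t|^p - l) u, u(0) = 1, u'(0) = 0 is solved by
   Picard iteration, and l is the infimum of the parameters for which the solution has a zero.
   At the infimum the solution is positive and cannot turn upwards, so it decays exponentially.
   Jacobi's factorisation H_p - l = (d/dt - u'/u)^* (d/dt - u'/u) shows that no eigenvalue lies
   below l, hence gamma_p = l.

   Unless p is an even integer the ground state is not smooth, so it is replaced by smooth compactly
   supported functions h with (H_p - l) h as small as desired and with decay bounds that do not
   depend on this precision; then h may be chosen after N. *)

theory Submission
  imports Defs "HOL-Probability.Sinc_Integral"
begin

section \<open>Smooth functions\<close>

text \<open>The exponent is forced by |x y|^p = |x|^(2a) |t|^p with t = |x|^a y, that is a (p + 2) =
  p. Since a < 1 the method has room: on the strip, replacing |x y|^p and (x^2 + y^2)^a by multiples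
  of the squared scaling is wrong by O(N^(2a-2)) up to powers of t, and each x-derivative that falls
  on the scaled profile costs a factor 1/x. These errors have to be small relative to the norm of
  the product; its square and the area carrying the error both have size N / N^a, so this factor
  cancels. The obstacle is the remaining term |x|^(2a) (H_p - l) h, in which the defect of h is
  multiplied by a growing factor. Its smallness has to be bought by the precision of h without
  spoiling the constants in the other errors. The members of the singular sequence are themselves
  test functions, so they lie in the graph of the closure at once. Closures demand work only for
  gamma_p, which is defined through eigenfunctions in a closed graph. Weak convergence to 0 comes
  from supports escaping to infinity.\<close>

lemma smooth1_coinduct:
  assumes "P f" and step: "\<And>g. P g \<Longrightarrow> (\<forall>t. g differentiable (at t)) \<and> P (vd g)"
  shows "smooth1 f"
proof -
  have P: "P ((vd ^^ k) f)" for k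
    by (induction k) (use assms in auto)
  then show ?thesis
    unfolding smooth1_def using step
    by (metis continuous_at_imp_continuous_on differentiable_imp_continuous_within)
qed

lemma smooth1_differentiable: "smooth1 f \<Longrightarrow> f differentiable (at t)"
  unfolding smooth1_def by (metis funpow_0)

lemma smooth1_vd: "smooth1 f \<Longrightarrow> smooth1 (vd f)"
  unfolding smooth1_def by (metis comp_apply funpow_Suc_right)

lemma smooth1_has_vd: "smooth1 f \<Longrightarrow> (f has_vector_derivative vd f t) (at t)"
  unfolding vd_def using smooth1_differentiable vector_derivative_works by blast

lemma smooth1_continuous: "smooth1 f \<Longrightarrow> continuous_on A f"
  by (meson continuous_at_imp_continuous_on differentiable_imp_continuous_within smooth1_differentiable)

lemma vd_eqI: "(\<And>t. (f has_vector_derivative g t) (at t)) \<Longrightarrow> vd f = g"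
  unfolding vd_def using vector_derivative_at by blast

lemma smooth1_const: "smooth1 (\<lambda>_. c)"
proof (rule smooth1_coinduct[where P = "\<lambda>f. \<exists>c. f = (\<lambda>_. c)"])
  fix g :: "real \<Rightarrow> complex"
  assume "\<exists>c. g = (\<lambda>_. c)"
  then obtain c where g: "g = (\<lambda>_. c)" by blast
  have "vd g = (\<lambda>_. 0)" by (rule vd_eqI) (simp add: g)
  then show "(\<forall>t. g differentiable (at t)) \<and> (\<exists>c. vd g = (\<lambda>_. c))"
    by (auto simp: g)
qed blast

lemma smooth1_I:
  assumes "\<And>t. (f has_vector_derivative g t) (at t)" "smooth1 g"
  shows "smooth1 f"
proof (rule smooth1_coinduct[where P = "\<lambda>h. h = f \<or> smooth1 h"])
  fix h assume "h = f \<or> smooth1 h"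
  then show "(\<forall>t. h differentiable (at t)) \<and> (vd h = f \<or> smooth1 (vd h))"
    using assms vd_eqI[OF assms(1)] differentiableI_vector smooth1_vd smooth1_differentiable by metis
qed simp

lemma smooth1_of_real: "smooth1 complex_of_real"
  by (rule smooth1_I[OF _ smooth1_const[of 1]])
    (auto intro!: derivative_eq_intros simp: has_vector_derivative_def scaleR_conv_of_real)


lemma smooth1_add:
  assumes "smooth1 f" "smooth1 g"
  shows "smooth1 (\<lambda>t. f t + g t)"
proof (rule smooth1_coinduct[where P = "\<lambda>h. \<exists>f g. smooth1 f \<and> smooth1 g \<and> h = (\<lambda>t. f t + g t)"])
  fix h :: "real \<Rightarrow> complex"
  assume "\<exists>f g. smooth1 f \<and> smooth1 g \<and> h = (\<lambda>t. f t + g t)"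
  then obtain f g where fg: "smooth1 f" "smooth1 g" "h = (\<lambda>t. f t + g t)" by blast
  have "(h has_vector_derivative (vd f t + vd g t)) (at t)" for t
    unfolding fg(3) by (intro has_vector_derivative_add smooth1_has_vd fg)
  then have "\<forall>t. h differentiable (at t)" "vd h = (\<lambda>t. vd f t + vd g t)"
    by (auto intro: differentiableI_vector vd_eqI)
  then show "(\<forall>t. h differentiable (at t)) \<and> (\<exists>f g. smooth1 f \<and> smooth1 g \<and> vd h = (\<lambda>t. f t + g t))"
    using smooth1_vd fg by blast
qed (use assms in blast)

text \<open>The invariant for \<open>smooth1_coinduct\<close>. A derivative of a product is no
  longer a product but a sum of products, so the class has to be a module over the smooth functions.
  It is closed under \<open>vd\<close> as soon as the derivatives of its generators lie in
  it.\<close>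

inductive smooth_module :: "(real \<Rightarrow> complex) set \<Rightarrow> (real \<Rightarrow> complex) \<Rightarrow> bool" for B where
  smooth_module_gen: "smooth1 g \<Longrightarrow> b \<in> B \<Longrightarrow> smooth_module B (\<lambda>t. g t * b t)"
| smooth_module_add: "smooth_module B f \<Longrightarrow> smooth_module B g \<Longrightarrow> smooth_module B (\<lambda>t. f t + g t)"

lemma smooth_module_imp_smooth1:
  assumes gen: "\<And>g b. smooth1 g \<Longrightarrow> b \<in> B \<Longrightarrow>
      \<exists>h. smooth_module B h \<and> (\<forall>t. ((\<lambda>t. g t * b t) has_vector_derivative h t) (at t))"
    and "smooth_module B f"
  shows "smooth1 f"
proof -
  have der: "\<exists>h. smooth_module B h \<and> (\<forall>t. (f has_vector_derivative h t) (at t))" if "smooth_module B f" for f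
    using that
  proof induction
    case (smooth_module_add f g)
    then obtain h k where "smooth_module B h" "\<forall>t. (f has_vector_derivative h t) (at t)"
      "smooth_module B k" "\<forall>t. (g has_vector_derivative k t) (at t)" by blast
    then show ?case
      by (intro exI[of _ "\<lambda>t. h t + k t"] conjI allI has_vector_derivative_add smooth_module.smooth_module_add) auto
  qed (rule gen)
  show ?thesis
  proof (rule smooth1_coinduct[where P = "smooth_module B"])
    show "(\<forall>t. g differentiable (at t)) \<and> smooth_module B (vd g)" if "smooth_module B g" for g
      using der[OF that] vd_eqI differentiableI_vector by metis
  qed (fact assms(2))
qed

lemma smooth1_mult:
  assumes "smooth1 f" "smooth1 g"
  shows "smooth1 (\<lambda>t. f t * g t)"
proof (rule smooth_module_imp_smooth1[where B = "Collect smooth1"])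
  fix g b assume gb: "smooth1 g" "b \<in> Collect smooth1"
  have "((\<lambda>t. g t * b t) has_vector_derivative (g t * vd b t + vd g t * b t)) (at t)" for t
    using gb by (intro has_vector_derivative_mult smooth1_has_vd) auto
  moreover have "smooth_module (Collect smooth1) (\<lambda>t. g t * vd b t + vd g t * b t)"
    using gb smooth1_vd by (intro smooth_module_add smooth_module_gen) auto
  ultimately show "\<exists>h. smooth_module (Collect smooth1) h \<and> (\<forall>t. ((\<lambda>t. g t * b t) has_vector_derivative h t) (at t))"
    by blast
qed (use assms in \<open>auto intro: smooth_module_gen\<close>)

text \<open>The instances below are $(1+x^2)^c$ (all real $c$), $t^{-m} e^{-1/t}$ (all $m$) and $e^{ikx}$.\<close>

lemma smooth1_family:
  assumes B: "\<And>b. b \<in> B \<Longrightarrow> \<exists>c1 b1 c2 b2. smooth1 c1 \<and> smooth1 c2 \<and> b1 \<in> B \<and> b2 \<in> B \<and>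
      (\<forall>t. (b has_vector_derivative (c1 t * b1 t + c2 t * b2 t)) (at t))"
    and "b \<in> B"
  shows "smooth1 b"
proof (rule smooth_module_imp_smooth1[where B = B])
  fix g b assume gb: "smooth1 g" "b \<in> B"
  obtain c1 b1 c2 b2 where c: "smooth1 c1" "smooth1 c2" "b1 \<in> B" "b2 \<in> B"
      "\<And>t. (b has_vector_derivative (c1 t * b1 t + c2 t * b2 t)) (at t)"
    using B[OF gb(2)] by blast
  have "((\<lambda>t. g t * b t) has_vector_derivative (g t * (c1 t * b1 t + c2 t * b2 t) + vd g t * b t)) (at t)" for t
    using gb by (intro has_vector_derivative_mult smooth1_has_vd c) auto
  then have "((\<lambda>t. g t * b t) has_vector_derivative ((g t * c1 t) * b1 t + (g t * c2 t) * b2 t + vd g t * b t)) (at t)" for t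
    by (simp add: algebra_simps)
  moreover have "smooth_module B (\<lambda>t. (g t * c1 t) * b1 t + (g t * c2 t) * b2 t + vd g t * b t)"
    using gb c by (intro smooth_module_add smooth_module_gen smooth1_mult smooth1_vd) auto
  ultimately show "\<exists>h. smooth_module B h \<and> (\<forall>t. ((\<lambda>t. g t * b t) has_vector_derivative h t) (at t))"
    by blast
next
  show "smooth_module B b"
    using smooth_module_gen[OF smooth1_const[of 1] \<open>b \<in> B\<close>] by simp
qed

lemma vd_add: "smooth1 f \<Longrightarrow> smooth1 g \<Longrightarrow> vd (\<lambda>t. f t + g t) = (\<lambda>t. vd f t + vd g t)"
  by (intro vd_eqI has_vector_derivative_add smooth1_has_vd)

lemma vd_mult: "smooth1 f \<Longrightarrow> smooth1 g \<Longrightarrow> vd (\<lambda>t. f t * g t) = (\<lambda>t. f t * vd g t + vd f t * g t)"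
  by (intro vd_eqI has_vector_derivative_mult smooth1_has_vd)

lemma vd_const [simp]: "vd (\<lambda>_. c) = (\<lambda>_. 0)"
  by (rule vd_eqI) simp

lemma has_vector_derivative_affine:
  assumes "smooth1 f"
  shows "((\<lambda>t. f (a * t + b)) has_vector_derivative (complex_of_real a * vd f (a * t + b))) (at t)"
proof -
  have "((\<lambda>t. a * t + b) has_vector_derivative a) (at t)"
    by (auto intro!: derivative_eq_intros simp: has_real_derivative_iff_has_vector_derivative[symmetric])
  from vector_diff_chain_at[OF this smooth1_has_vd[OF assms]] show ?thesis
    by (simp add: o_def scaleR_conv_of_real)
qed

lemma vd_affine:
  "smooth1 f \<Longrightarrow> vd (\<lambda>t. f (a * t + b)) = (\<lambda>t. complex_of_real a * vd f (a * t + b))"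
  by (intro vd_eqI has_vector_derivative_affine)

lemma smooth1_affine:
  assumes "smooth1 f"
  shows "smooth1 (\<lambda>t. f (a * t + b))"
proof (rule smooth1_family[where B = "{h. \<exists>g. smooth1 g \<and> h = (\<lambda>t. g (a * t + b))}"])
  fix h assume "h \<in> {h. \<exists>g. smooth1 g \<and> h = (\<lambda>t. g (a * t + b))}"
  then obtain g where g: "smooth1 g" "h = (\<lambda>t. g (a * t + b))" by blast
  \<comment> \<open>The zero summand fills the second slot demanded by
    \<open>smooth1_family\<close>; a genuine second term occurs only for
    \<open>flat_exp\<close>.\<close>
  have "(h has_vector_derivative complex_of_real a * vd g (a * t + b) + 0 * vd g (a * t + b)) (at t)" for t
    using has_vector_derivative_affine[OF g(1)] g(2) by simp
  moreover have "(\<lambda>t. vd g (a * t + b)) \<in> {h. \<exists>g. smooth1 g \<and> h = (\<lambda>t. g (a * t + b))}"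
    using smooth1_vd[OF g(1)] by blast
  ultimately show "\<exists>c1 b1 c2 b2. smooth1 c1 \<and> smooth1 c2 \<and> b1 \<in> {h. \<exists>g. smooth1 g \<and> h = (\<lambda>t. g (a * t + b))} \<and>
      b2 \<in> {h. \<exists>g. smooth1 g \<and> h = (\<lambda>t. g (a * t + b))} \<and>
      (\<forall>t. (h has_vector_derivative (c1 t * b1 t + c2 t * b2 t)) (at t))"
    using smooth1_const by (intro exI[of _ "\<lambda>_. complex_of_real a"] exI[of _ "\<lambda>_. 0"] exI[of _ "\<lambda>t. vd g (a * t + b)"]) auto
qed (use assms in blast)

lemma smooth1_cis: "smooth1 (\<lambda>t. cis (k * t))"
  and vd_cis: "vd (\<lambda>t. cis (k * t)) = (\<lambda>t. \<i> * complex_of_real k * cis (k * t))"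
proof -
  have d: "((\<lambda>t. cis (k * t)) has_vector_derivative \<i> * complex_of_real k * cis (k * t)) (at t)" for t
  proof -
    have "((\<lambda>z. exp (\<i> * (complex_of_real k * z))) has_field_derivative
        \<i> * complex_of_real k * exp (\<i> * (complex_of_real k * complex_of_real t))) (at (complex_of_real t))"
      by (auto intro!: derivative_eq_intros)
    from has_vector_derivative_real_field[OF this] show ?thesis
      by (simp add: cis_conv_exp)
  qed
  show "vd (\<lambda>t. cis (k * t)) = (\<lambda>t. \<i> * complex_of_real k * cis (k * t))"
    by (rule vd_eqI[OF d])
  show "smooth1 (\<lambda>t. cis (k * t))"
  proof (rule smooth1_family[where B = "{\<lambda>t. cis (k * t)}"])
    show "\<exists>c1 b1 c2 b2. smooth1 c1 \<and> smooth1 c2 \<and> b1 \<in> {\<lambda>t. cis (k * t)} \<and> b2 \<in> {\<lambda>t. cis (k * t)} \<and>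
      (\<forall>t. (b has_vector_derivative (c1 t * b1 t + c2 t * b2 t)) (at t))" if "b \<in> {\<lambda>t. cis (k * t)}" for b
      using that d smooth1_const
      by (intro exI[of _ "\<lambda>_. \<i> * complex_of_real k"] exI[of _ "\<lambda>_. 0"] exI[of _ "\<lambda>t. cis (k * t)"]) auto
  qed simp
qed

lemma of_real_has_vector_derivative:
  "(f has_real_derivative f') (at t) \<Longrightarrow>
    ((\<lambda>t. complex_of_real (f t)) has_vector_derivative complex_of_real f') (at t)"
  by (rule has_vector_derivative_of_real)

lemma smooth1_powr: "smooth1 (\<lambda>x. complex_of_real ((1 + x\<^sup>2) powr c))"
proof (rule smooth1_family[where B = "range (\<lambda>c x. complex_of_real ((1 + x\<^sup>2) powr c))"])
  fix b assume "b \<in> range (\<lambda>c x. complex_of_real ((1 + x\<^sup>2) powr c))"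
  then obtain c where b: "b = (\<lambda>x. complex_of_real ((1 + x\<^sup>2) powr c))" by blast
  have "((\<lambda>x. (1 + x\<^sup>2) powr c) has_real_derivative 2 * c * x * (1 + x\<^sup>2) powr (c - 1)) (at x)" for x :: real
  proof -
    have "1 + x\<^sup>2 > 0" by (simp add: add_pos_nonneg)
    then show ?thesis
      by (auto intro!: derivative_eq_intros simp: powr_diff field_simps)
  qed
  from of_real_has_vector_derivative[OF this]
  have "(b has_vector_derivative (complex_of_real (2 * c) * complex_of_real x) * complex_of_real ((1 + x\<^sup>2) powr (c - 1)) + 0 * complex_of_real ((1 + x\<^sup>2) powr (c - 1))) (at x)" for x
    by (simp add: b)
  then show "\<exists>c1 b1 c2 b2. smooth1 c1 \<and> smooth1 c2 \<and> b1 \<in> range (\<lambda>c x. complex_of_real ((1 + x\<^sup>2) powr c)) \<and>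
      b2 \<in> range (\<lambda>c x. complex_of_real ((1 + x\<^sup>2) powr c)) \<and>
      (\<forall>t. (b has_vector_derivative (c1 t * b1 t + c2 t * b2 t)) (at t))"
    by (intro exI[of _ "\<lambda>x. complex_of_real (2 * c) * complex_of_real x"] exI[of _ "\<lambda>_. 0"]
          exI[of _ "\<lambda>x. complex_of_real ((1 + x\<^sup>2) powr (c - 1))"] conjI)
      (auto intro!: smooth1_mult smooth1_const smooth1_of_real)
qed blast

section \<open>Flat functions and a smooth cutoff\<close>

lemma power_le_fact_exp:
  fixes x :: real
  assumes "x \<ge> 0"
  shows "x ^ N \<le> fact N * exp x"
proof -
  have "(\<Sum>n\<in>{N}. inverse (fact n) * x ^ n) \<le> (\<Sum>n. inverse (fact n) * x ^ n)"
    using assms by (intro sum_le_suminf summable_exp) auto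
  then show ?thesis by (simp add: exp_def field_simps)
qed

text \<open>The case m = 0 is the classical flat function exp(-1/t). The index m is there because
  differentiation produces higher powers of 1/t, so that only the whole family is closed under
  it.\<close>

definition flat_exp :: "nat \<Rightarrow> real \<Rightarrow> real" where
  "flat_exp m t = (if t > 0 then exp (- (1 / t)) / t ^ m else 0)"

text \<open>From 1/t^N \<le> N! exp(1/t) with N = m + 2. Quadratic vanishing is what makes the
  difference quotient at 0 tend to 0, the only delicate point of
  \<open>DERIV_flat_exp\<close>.\<close>

lemma flat_exp_bound: "\<bar>flat_exp m t\<bar> \<le> fact (m + 2) * t\<^sup>2"
proof (cases "t > 0")
  case True
  have "exp (- (1 / t)) \<le> fact N * t ^ N" for N
    using power_le_fact_exp[of "1 / t" N] True
    by (simp add: power_divide exp_minus field_simps)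
  then have "exp (- (1 / t)) / t ^ m \<le> fact (m + 2) * t ^ (m + 2) / t ^ m"
    using True by (intro divide_right_mono) (auto simp del: fact_Suc power_Suc add_2_eq_Suc')
  also have "\<dots> = fact (m + 2) * t\<^sup>2"
    using True by (simp add: power_add power2_eq_square)
  finally show ?thesis using True by (simp add: flat_exp_def)
qed (simp add: flat_exp_def)

lemma DERIV_flat_exp: "(flat_exp m has_real_derivative (- real m * flat_exp (m + 1) t + flat_exp (m + 2) t)) (at t)"
proof -
  consider "t > 0" | "t < 0" | "t = 0" by linarith
  then show ?thesis
  proof cases
    case 1
    have "((\<lambda>t. inverse (t ^ m)) has_real_derivative - (real m / t ^ (m + 1))) (at t)"
    proof (cases m)
      case (Suc n)
      have "((\<lambda>t. inverse (t ^ m)) has_real_derivative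
          - (real m * t ^ (m - Suc 0) * inverse ((t ^ m) ^ Suc (Suc 0)))) (at t)"
        by (rule DERIV_inverse_fun[OF DERIV_pow]) (use 1 in simp)
      moreover have "real m * t ^ (m - Suc 0) * inverse ((t ^ m) ^ Suc (Suc 0)) = real m / t ^ (m + 1)"
        using 1 Suc by (simp add: field_simps)
      ultimately show ?thesis by simp
    qed simp
    moreover have "((\<lambda>t. exp (- (1 / t))) has_real_derivative exp (- (1 / t)) / t\<^sup>2) (at t)"
      using 1 by (auto intro!: derivative_eq_intros simp: field_simps power2_eq_square)
    ultimately have "((\<lambda>t. exp (- (1 / t)) * inverse (t ^ m)) has_real_derivative
        (exp (- (1 / t)) / t\<^sup>2 * inverse (t ^ m) + - (real m / t ^ (m + 1)) * exp (- (1 / t)))) (at t)"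
      by (intro DERIV_mult)
    then have "((\<lambda>t. exp (- (1 / t)) / t ^ m) has_real_derivative (- real m * flat_exp (m + 1) t + flat_exp (m + 2) t)) (at t)"
      using 1 by (simp add: flat_exp_def divide_inverse power2_eq_square mult_ac add.commute)
    then show ?thesis
      by (rule DERIV_cong_ev[THEN iffD1, rotated -1])
        (use 1 eventually_nhds_in_open[of "{0<..}" t] in \<open>auto simp: flat_exp_def elim!: eventually_mono\<close>)
  next
    case 2
    have "((\<lambda>t. 0) has_real_derivative (- real m * flat_exp (m + 1) t + flat_exp (m + 2) t)) (at t)"
      using 2 by (simp add: flat_exp_def)
    then show ?thesis
      by (rule DERIV_cong_ev[THEN iffD1, rotated -1])
        (use 2 eventually_nhds_in_open[of "{..<0}" t] in \<open>auto simp: flat_exp_def elim!: eventually_mono\<close>)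
  next
    case 3
    have "((\<lambda>h. flat_exp m h / h) \<longlongrightarrow> 0) (at 0)"
    proof (rule Lim_null_comparison)
      have "\<bar>flat_exp m h / h\<bar> \<le> fact (m + 2) * \<bar>h\<bar>" for h
      proof (cases "h = 0")
        case False
        have "\<bar>flat_exp m h\<bar> / \<bar>h\<bar> \<le> fact (m + 2) * h\<^sup>2 / \<bar>h\<bar>"
          by (intro divide_right_mono flat_exp_bound) auto
        also have "\<dots> = fact (m + 2) * \<bar>h\<bar>"
          using False by (simp add: power2_eq_square abs_if)
        finally show ?thesis by (simp only: abs_divide)
      qed simp
      then show "\<forall>\<^sub>F h in at 0. norm (flat_exp m h / h) \<le> fact (m + 2) * \<bar>h\<bar>" by simp
      show "((\<lambda>h. fact (m + 2) * \<bar>h\<bar>) \<longlongrightarrow> (0::real)) (at 0)"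
        by (auto intro!: tendsto_eq_intros)
    qed
    then show ?thesis using 3 by (simp add: DERIV_def flat_exp_def)
  qed
qed

lemma smooth1_flat_exp: "smooth1 (\<lambda>t. complex_of_real (flat_exp m t))"
proof (rule smooth1_family[where B = "range (\<lambda>m t. complex_of_real (flat_exp m t))"])
  fix b assume "b \<in> range (\<lambda>m t. complex_of_real (flat_exp m t))"
  then obtain m where b: "b = (\<lambda>t. complex_of_real (flat_exp m t))" by blast
  have "(b has_vector_derivative complex_of_real (- real m) * complex_of_real (flat_exp (m + 1) t) + 1 * complex_of_real (flat_exp (m + 2) t)) (at t)" for t
    using of_real_has_vector_derivative[OF DERIV_flat_exp[of m t]] by (simp add: b)
  then show "\<exists>c1 b1 c2 b2. smooth1 c1 \<and> smooth1 c2 \<and> b1 \<in> range (\<lambda>m t. complex_of_real (flat_exp m t)) \<and>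
      b2 \<in> range (\<lambda>m t. complex_of_real (flat_exp m t)) \<and>
      (\<forall>t. (b has_vector_derivative (c1 t * b1 t + c2 t * b2 t)) (at t))"
    by (intro exI[of _ "\<lambda>_. complex_of_real (- real m)"] exI[of _ "\<lambda>_. 1"]
          exI[of _ "\<lambda>t. complex_of_real (flat_exp (m + 1) t)"] exI[of _ "\<lambda>t. complex_of_real (flat_exp (m + 2) t)"] conjI)
      (auto intro!: smooth1_const)
qed blast

lemma vd_zero_outside:
  assumes "\<And>t. a < \<bar>t - c\<bar> \<Longrightarrow> f t = 0" "a < \<bar>t - c\<bar>"
  shows "vd f t = 0"
proof -
  have "open {t. a < \<bar>t - c\<bar>}" by (intro open_Collect_less continuous_intros)
  then have "(f has_vector_derivative 0) (at t)"
    by (rule has_vector_derivative_transform_within_open[rotated]) (use assms in auto)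
  then show ?thesis unfolding vd_def by (rule vector_derivative_at)
qed

lemma cutoff_exists:
  obtains \<theta> :: "real \<Rightarrow> complex" and D :: real where "smooth1 \<theta>" "\<theta> 0 = 1" "D \<ge> 1"
    "\<And>t. 1 < \<bar>t\<bar> \<Longrightarrow> \<theta> t = 0"
    "\<And>t. norm (\<theta> t) \<le> D" "\<And>t. norm (vd \<theta> t) \<le> D" "\<And>t. norm (vd (vd \<theta>) t) \<le> D"
proof -
  \<comment> \<open>On |t| < 1 this is the bump exp(2 - 2 / (1 - t^2)); the factor exp 2 normalises
    the value at 0 to 1.\<close>
  define \<theta> where "\<theta> t = complex_of_real (exp 2) * (complex_of_real (flat_exp 0 (- 1 * t + 1)) * complex_of_real (flat_exp 0 (1 * t + 1)))" for t
  have s: "smooth1 \<theta>"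
    unfolding \<theta>_def
    by (intro smooth1_mult smooth1_const smooth1_affine[of "\<lambda>t. complex_of_real (flat_exp 0 t)"] smooth1_flat_exp)
  have z: "\<theta> t = 0" if "1 < \<bar>t\<bar>" for t
    using that by (auto simp: \<theta>_def flat_exp_def)
  have one: "\<theta> 0 = 1"
    by (simp add: \<theta>_def flat_exp_def of_real_mult[symmetric] exp_add[symmetric] del: of_real_mult)
  have bdd: "\<exists>D. \<forall>t. norm (f t) \<le> D" if f: "smooth1 f" and z: "\<And>t. 1 < \<bar>t\<bar> \<Longrightarrow> f t = 0" for f
  proof -
    have "compact (f ` {-1..1})"
      using smooth1_continuous[OF f] by (intro compact_continuous_image) auto
    then obtain M where M: "\<And>t. t \<in> {-1..1} \<Longrightarrow> norm (f t) \<le> M"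
      by (metis compact_imp_bounded bounded_iff imageI)
    have "norm (f t) \<le> \<bar>M\<bar>" for t
    proof (cases "1 < \<bar>t\<bar>")
      case False
      then have "t \<in> {-1..1}" by (auto simp: abs_if split: if_splits)
      then show ?thesis using M by force
    qed (use z in simp)
    then show ?thesis by blast
  qed
  have z1: "vd \<theta> t = 0" if "1 < \<bar>t\<bar>" for t
    using vd_zero_outside[of 1 0 \<theta> t] z that by auto
  have z2: "vd (vd \<theta>) t = 0" if "1 < \<bar>t\<bar>" for t
    using vd_zero_outside[of 1 0 "vd \<theta>" t] z1 that by auto
  obtain D0 D1 D2 where D: "\<And>t. norm (\<theta> t) \<le> D0" "\<And>t. norm (vd \<theta> t) \<le> D1" "\<And>t. norm (vd (vd \<theta>) t) \<le> D2"
    using bdd[OF s z] bdd[OF smooth1_vd[OF s] z1] bdd[OF smooth1_vd[OF smooth1_vd[OF s]] z2] by blast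
  show ?thesis
    by (rule that[of \<theta> "max 1 (max D0 (max D1 D2))", OF s one _ z])
      (use D in \<open>auto simp: le_max_iff_disj\<close>)
qed

lemma compact_tsupport:
  assumes "\<And>x. x \<notin> K \<Longrightarrow> f x = 0" "bounded K"
  shows "compact (tsupport (f :: 'a::euclidean_space \<Rightarrow> complex))"
proof -
  have "{x. f x \<noteq> 0} \<subseteq> K" using assms(1) by blast
  then show ?thesis
    unfolding tsupport_def compact_closure using assms(2) bounded_subset by blast
qed

section \<open>Smooth functions of two variables with a scaled second variable\<close>

lemma smooth2_coinduct:
  assumes "P f" and step: "\<And>g. P g \<Longrightarrow> continuous_on UNIV g \<and> (\<forall>x y. (\<lambda>s. g (s, y)) differentiable (at x)
      \<and> (\<lambda>s. g (x, s)) differentiable (at y)) \<and> P (dx g) \<and> P (dy g)"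
  shows "smooth2 f"
proof -
  have "P (pder bs f)" for bs
    by (induction bs) (use assms in auto)
  then show ?thesis unfolding smooth2_def using step by blast
qed

text \<open>The two-variable analogue of \<open>smooth_module\<close>: an invariant that contains
  the products F(x) G(s(x) y) and survives both partial derivatives.\<close>

inductive scaled_sum :: "(real \<Rightarrow> real) \<Rightarrow> (real \<times> real \<Rightarrow> complex) \<Rightarrow> bool" for s where
  scaled_gen: "smooth1 F \<Longrightarrow> smooth1 G \<Longrightarrow> scaled_sum s (\<lambda>(x, y). F x * G (s x * y))"
| scaled_add: "scaled_sum s f \<Longrightarrow> scaled_sum s g \<Longrightarrow> scaled_sum s (\<lambda>z. f z + g z)"

text \<open>Recording the logarithmic derivative \<open>q\<close> of \<open>s\<close> keeps y hidden
  in the scaled variable: d/dx G(s x * y) = q x * (t * G' t) at t = s x * y, and t * G' t is again a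
  smooth function of t alone.\<close>

locale scaling =
  fixes s q :: "real \<Rightarrow> real"
  assumes s: "smooth1 (\<lambda>x. complex_of_real (s x))" and q: "smooth1 (\<lambda>x. complex_of_real (q x))"
    and s': "(s has_real_derivative q x * s x) (at x)"
begin

lemma scaled_has_dx:
  assumes F: "smooth1 F" and G: "smooth1 G"
  shows "((\<lambda>x. F x * G (s x * y)) has_vector_derivative
     (vd F x * G (s x * y) + (F x * of_real (q x)) * (of_real (s x * y) * vd G (s x * y)))) (at x)"
proof -
  have "((\<lambda>x. s x * y) has_vector_derivative (q x * s x * y)) (at x)"
    using DERIV_cmult_right[OF s'] by (simp add: has_real_derivative_iff_has_vector_derivative)
  from vector_diff_chain_at[OF this smooth1_has_vd[OF G]]
  have "((\<lambda>x. G (s x * y)) has_vector_derivative of_real (q x * s x * y) * vd G (s x * y)) (at x)"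
    by (simp add: o_def scaleR_conv_of_real)
  from has_vector_derivative_mult[OF smooth1_has_vd[OF F] this] show ?thesis
    by (simp add: algebra_simps)
qed

lemma scaled_has_dy:
  assumes G: "smooth1 G"
  shows "((\<lambda>y. F x * G (s x * y)) has_vector_derivative (F x * of_real (s x)) * vd G (s x * y)) (at y)"
proof -
  have "((\<lambda>y. s x * y) has_vector_derivative (s x)) (at y)"
    by (auto intro!: derivative_eq_intros simp: has_real_derivative_iff_has_vector_derivative[symmetric])
  from vector_diff_chain_at[OF this smooth1_has_vd[OF G]]
  have "((\<lambda>y. G (s x * y)) has_vector_derivative of_real (s x) * vd G (s x * y)) (at y)"
    by (simp add: o_def scaleR_conv_of_real)
  from has_vector_derivative_mult[OF has_vector_derivative_const[of "F x"] this] show ?thesis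
    by (simp add: algebra_simps)
qed

lemma dx_scaled:
  assumes F: "smooth1 F" and G: "smooth1 G"
  shows "dx (\<lambda>(x, y). F x * G (s x * y)) = (\<lambda>(x, y). vd F x * G (s x * y)
     + (F x * of_real (q x)) * (of_real (s x * y) * vd G (s x * y)))"
  unfolding dx_def using vector_derivative_at[OF scaled_has_dx[OF assms]] by (auto simp: fun_eq_iff)

lemma dy_scaled:
  assumes G: "smooth1 G"
  shows "dy (\<lambda>(x, y). F x * G (s x * y)) = (\<lambda>(x, y). (F x * of_real (s x)) * vd G (s x * y))"
  unfolding dy_def using vector_derivative_at[OF scaled_has_dy[OF assms]] by (auto simp: fun_eq_iff)

lemma s_continuous: "continuous_on A s"
  using s' by (meson DERIV_isCont continuous_at_imp_continuous_on)

lemma scaled_sum_step: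
  assumes "scaled_sum s g"
  shows "continuous_on UNIV g \<and> (\<forall>x y. (\<lambda>s. g (s, y)) differentiable (at x)
      \<and> (\<lambda>s. g (x, s)) differentiable (at y)) \<and> scaled_sum s (dx g) \<and> scaled_sum s (dy g)"
  using assms
proof induction
  case (scaled_gen F G)
  have "continuous_on UNIV (\<lambda>z. F (fst z) * G (s (fst z) * snd z))"
    by (intro continuous_intros continuous_on_compose2[OF smooth1_continuous[OF scaled_gen(1), of UNIV]]
        continuous_on_compose2[OF smooth1_continuous[OF scaled_gen(2), of UNIV]]
        continuous_on_compose2[OF s_continuous[of UNIV]]) auto
  then have "continuous_on UNIV (\<lambda>(x, y). F x * G (s x * y))"
    by (simp add: case_prod_beta')
  moreover have "scaled_sum s (\<lambda>z. (case z of (x, y) \<Rightarrow> vd F x * G (s x * y))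
      + (case z of (x, y) \<Rightarrow> (F x * of_real (q x)) * ((\<lambda>t. of_real t * vd G t) (s x * y))))"
    using scaled_gen q by (intro scaled_sum.scaled_add scaled_sum.scaled_gen smooth1_mult smooth1_vd smooth1_of_real)
  then have "scaled_sum s (dx (\<lambda>(x, y). F x * G (s x * y)))"
    using dx_scaled[OF scaled_gen] by (simp add: case_prod_beta')
  moreover have "scaled_sum s (dy (\<lambda>(x, y). F x * G (s x * y)))"
    unfolding dy_scaled[OF scaled_gen(2)]
    using scaled_gen s by (intro scaled_sum.scaled_gen smooth1_mult smooth1_vd)
  ultimately show ?case
    using differentiableI_vector[OF scaled_has_dx[OF scaled_gen]] differentiableI_vector[OF scaled_has_dy[OF scaled_gen(2)]]
    by simp
next
  case (scaled_add f g)
  have 1: "dx (\<lambda>z. f z + g z) = (\<lambda>z. dx f z + dx g z)"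
    unfolding dx_def using scaled_add by (auto simp: fun_eq_iff)
  have 2: "dy (\<lambda>z. f z + g z) = (\<lambda>z. dy f z + dy g z)"
    unfolding dy_def using scaled_add by (auto simp: fun_eq_iff)
  show ?case
    unfolding 1 2 using scaled_add
    by (auto intro!: continuous_intros scaled_sum.scaled_add differentiable_add)
qed

lemma smooth2_scaled:
  assumes "smooth1 F" "smooth1 G"
  shows "smooth2 (\<lambda>(x, y). F x * G (s x * y))"
  by (rule smooth2_coinduct[where P = "scaled_sum s"]) (use assms scaled_sum_step scaled_gen in auto)

end

section \<open>The ground state of the anharmonic oscillator\<close>

definition primitive :: "(real \<Rightarrow> real) \<Rightarrow> real \<Rightarrow> real" where
  "primitive f = (\<lambda>t. LBINT y=ereal 0..ereal t. f y)"

lemma primitive_0 [simp]: "primitive f 0 = 0"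
  by (simp add: primitive_def)

lemma DERIV_primitive:
  assumes "continuous_on UNIV f"
  shows "(primitive f has_real_derivative f t) (at t)"
proof -
  define b where "b = \<bar>t\<bar> + 1"
  have b: "- b \<le> 0" "0 \<le> b" "-b \<le> t" "t \<le> b" by (simp_all add: b_def)
  have "((\<lambda>u. LBINT y=ereal 0..ereal u. f y) has_vector_derivative f t) (at t within {-b..b})"
    by (rule interval_integral_FTC2[where a="-b" and b=b and c=0 and f=f, OF b(1,2) continuous_on_subset[OF assms] b(3,4)]) simp
  then have "(primitive f has_vector_derivative f t) (at t within {-b..b})"
    unfolding primitive_def .
  moreover have "t \<in> interior {-b..b}"
    unfolding interior_atLeastAtMost_real by (simp add: b_def abs_if)
  ultimately show ?thesis
    by (metis at_within_interior has_real_derivative_iff_has_vector_derivative)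
qed

lemma continuous_on_DERIV:
  assumes "\<And>t::real. (f has_real_derivative f' t) (at t)"
  shows "continuous_on A f"
  by (meson assms DERIV_isCont continuous_at_imp_continuous_on)

text \<open>K t^(n+1) / (n+1) plus or minus F vanishes at 0 and is nondecreasing. Iterating this
  controls both the Picard iterates and the twice integrated polynomials of
  \<open>smooth_C2_approx\<close>.\<close>

lemma DERIV_power_bound_nonneg:
  fixes F :: "real \<Rightarrow> real"
  assumes "F 0 = 0" and F: "\<And>t. (F has_real_derivative f t) (at t)"
    and b: "\<And>s. \<bar>s\<bar> \<le> T \<Longrightarrow> \<bar>f s\<bar> \<le> K * \<bar>s\<bar> ^ n" and "0 \<le> t" "t \<le> T"
  shows "\<bar>F t\<bar> \<le> K * \<bar>t\<bar> ^ Suc n / real (Suc n)"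
proof -
  have "F t \<le> K * t ^ Suc n / real (Suc n)"
  proof -
    have "K * 0 ^ Suc n / real (Suc n) - F 0 \<le> K * t ^ Suc n / real (Suc n) - F t"
    proof (rule DERIV_nonneg_imp_nondecreasing[OF \<open>0 \<le> t\<close>])
      fix s assume "0 \<le> s" "s \<le> t"
      then have "((\<lambda>s. K * s ^ Suc n / real (Suc n) - F s) has_real_derivative (K * s ^ n - f s)) (at s)"
        by (auto intro!: derivative_eq_intros F simp del: power_Suc)
      moreover have "K * s ^ n - f s \<ge> 0"
        using b[of s] \<open>0 \<le> s\<close> \<open>s \<le> t\<close> \<open>t \<le> T\<close> by auto
      ultimately show "\<exists>y. ((\<lambda>s. K * s ^ Suc n / real (Suc n) - F s) has_real_derivative y) (at s) \<and> 0 \<le> y"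
        by blast
    qed
    then show ?thesis using assms(1) by simp
  qed
  moreover have "- F t \<le> K * t ^ Suc n / real (Suc n)"
  proof -
    have "K * 0 ^ Suc n / real (Suc n) + F 0 \<le> K * t ^ Suc n / real (Suc n) + F t"
    proof (rule DERIV_nonneg_imp_nondecreasing[OF \<open>0 \<le> t\<close>])
      fix s assume "0 \<le> s" "s \<le> t"
      then have "((\<lambda>s. K * s ^ Suc n / real (Suc n) + F s) has_real_derivative (K * s ^ n + f s)) (at s)"
        by (auto intro!: derivative_eq_intros F simp del: power_Suc)
      moreover have "K * s ^ n + f s \<ge> 0"
        using b[of s] \<open>0 \<le> s\<close> \<open>s \<le> t\<close> \<open>t \<le> T\<close> by auto
      ultimately show "\<exists>y. ((\<lambda>s. K * s ^ Suc n / real (Suc n) + F s) has_real_derivative y) (at s) \<and> 0 \<le> y"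
        by blast
    qed
    then show ?thesis using assms(1) by simp
  qed
  ultimately show ?thesis using \<open>0 \<le> t\<close> by (simp add: abs_if)
qed

lemma DERIV_power_bound:
  fixes F :: "real \<Rightarrow> real"
  assumes "F 0 = 0" and F: "\<And>t. (F has_real_derivative f t) (at t)"
    and b: "\<And>s. \<bar>s\<bar> \<le> T \<Longrightarrow> \<bar>f s\<bar> \<le> K * \<bar>s\<bar> ^ n" and "\<bar>t\<bar> \<le> T"
  shows "\<bar>F t\<bar> \<le> K * \<bar>t\<bar> ^ Suc n / real (Suc n)"
proof (cases "t \<ge> 0")
  case True
  then show ?thesis using DERIV_power_bound_nonneg[OF assms(1-3)] assms(4) by auto
next
  case False
  have "((\<lambda>s. F (- s)) has_real_derivative - f (- s)) (at s)" for s
    using F[of "- s"] by (simp add: DERIV_mirror)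
  then have "\<bar>F (- (- t))\<bar> \<le> K * \<bar>- t\<bar> ^ Suc n / real (Suc n)"
    by (rule DERIV_power_bound_nonneg[where F = "\<lambda>s. F (- s)" and T = T, rotated])
      (use b[of "- _"] assms(1,4) False in auto)
  then show ?thesis by simp
qed

text \<open>The solution is the sum of the iterates \<open>a n\<close> with a_0 = 1 and a_(n+1)'' =
  V a_n. Factorial bounds on compact intervals allow termwise differentiation twice.\<close>

lemma linear_ode_exists:
  fixes V :: "real \<Rightarrow> real"
  assumes V: "continuous_on UNIV V"
  obtains u u' where "u 0 = 1" "u' 0 = 0"
    "\<And>t. (u has_real_derivative u' t) (at t)" "\<And>t. (u' has_real_derivative V t * u t) (at t)"
proof -
  define a where "a = rec_nat (\<lambda>_. 1) (\<lambda>_ f. primitive (primitive (\<lambda>t. V t * f t)))"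
  have a0: "a 0 = (\<lambda>_. 1)" and aS: "a (Suc n) = primitive (primitive (\<lambda>t. V t * a n t))" for n
    by (simp_all add: a_def)
  \<comment> \<open>\<open>b n\<close> and \<open>c n\<close> are the first and second derivatives
    of \<open>a n\<close>; both vanish for n = 0 because \<open>a 0\<close> is constant.\<close>
  define b where "b n = (case n of 0 \<Rightarrow> \<lambda>_. 0 | Suc m \<Rightarrow> primitive (\<lambda>t. V t * a m t))" for n
  define c where "c n = (case n of 0 \<Rightarrow> \<lambda>_. 0 | Suc m \<Rightarrow> (\<lambda>t. V t * a m t))" for n
  have bS: "b (Suc n) = primitive (\<lambda>t. V t * a n t)" for n
    by (simp add: b_def)
  have cont: "continuous_on UNIV (a n)" for n
  proof (induction n)
    case (Suc n)
    have "continuous_on UNIV (primitive (\<lambda>t. V t * a n t))"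
      by (rule continuous_on_DERIV[OF DERIV_primitive]) (intro continuous_intros V Suc)
    then show ?case unfolding aS
      by (rule continuous_on_DERIV[OF DERIV_primitive])
  qed (simp add: a0)
  have db: "(b n has_real_derivative c n t) (at t)" for n t
    by (cases n) (auto simp: b_def c_def intro!: DERIV_primitive continuous_intros V cont)
  have da: "(a n has_real_derivative b n t) (at t)" for n t
  proof (cases n)
    case (Suc m)
    have "continuous_on UNIV (b n)" by (rule continuous_on_DERIV[OF db])
    then show ?thesis using Suc by (auto simp: b_def aS intro!: DERIV_primitive)
  qed (simp add: a0 b_def)
  have main: "summable (\<lambda>n. a n t) \<and> summable (\<lambda>n. b n t) \<and>
     ((\<lambda>t. \<Sum>n. a n t) has_real_derivative (\<Sum>n. b n t)) (at t) \<and>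
     ((\<lambda>t. \<Sum>n. b n t) has_real_derivative (\<Sum>n. c n t)) (at t)" for t
  proof -
    \<comment> \<open>The extra 1 puts t into the interior of {-T..T}, as termwise differentiation
      requires.\<close>
    define T where "T = \<bar>t\<bar> + 1"
    have "T \<ge> 1" by (simp add: T_def)
    have "compact (V ` {-T..T})"
      using V by (meson compact_Icc compact_continuous_image continuous_on_subset subset_UNIV)
    then obtain M where M: "\<And>s. s \<in> {-T..T} \<Longrightarrow> \<bar>V s\<bar> \<le> M"
      by (metis compact_imp_bounded bounded_iff imageI real_norm_def)
    have "M \<ge> 0" using M[of 0] \<open>T \<ge> 1\<close> by auto
    define C where "C = M * T"
    have "C \<ge> 0" using \<open>M \<ge> 0\<close> \<open>T \<ge> 1\<close> by (simp add: C_def)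
    \<comment> \<open>Deliberately cruder than the natural M^n |s|^(2n) / (2n)!: each round replaces
      one power of |s| by T and drops one denominator. With C = M * T the bounds still sum to an
      exponential series.\<close>
    have ab: "(\<bar>s\<bar> \<le> T \<longrightarrow> \<bar>a n s\<bar> \<le> C ^ n / fact n * \<bar>s\<bar> ^ n) \<and> (\<bar>s\<bar> \<le> T \<longrightarrow> \<bar>b (Suc n) s\<bar> \<le> M * (C ^ n / fact (Suc n)) * \<bar>s\<bar> ^ Suc n)" for n s
    proof (induction n arbitrary: s)
      case 0
      have "\<bar>b (Suc 0) s\<bar> \<le> M * \<bar>s\<bar> ^ Suc 0 / real (Suc 0)" if "\<bar>s\<bar> \<le> T"
        by (rule DERIV_power_bound[where f = "c (Suc 0)" and T = T])
          (use that M in \<open>auto simp: b_def[of "Suc 0"] c_def a0 abs_le_iff intro!: db\<close>,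
           use db[of "Suc 0"] in \<open>simp add: b_def c_def a0\<close>)
      then show ?case by (simp add: a0)
    next
      case (Suc n)
      have A: "\<bar>a (Suc n) r\<bar> \<le> C ^ Suc n / fact (Suc n) * \<bar>r\<bar> ^ Suc n" if r: "\<bar>r\<bar> \<le> T" for r
      proof -
        have "\<bar>a (Suc n) r\<bar> \<le> M * (C ^ n / fact (Suc n)) * \<bar>r\<bar> ^ Suc (Suc n) / real (Suc (Suc n))"
          by (rule DERIV_power_bound[where f = "b (Suc n)" and T = T]) (use Suc da[of "Suc n"] r in \<open>auto simp: aS simp del: power_Suc fact_Suc\<close>)
        also have "\<dots> \<le> M * (C ^ n / fact (Suc n)) * \<bar>r\<bar> ^ Suc (Suc n) / 1"
          by (intro divide_left_mono mult_nonneg_nonneg) (use \<open>M \<ge> 0\<close> \<open>C \<ge> 0\<close> in auto)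
        also have "\<dots> = M * (C ^ n / fact (Suc n)) * \<bar>r\<bar> ^ Suc n * \<bar>r\<bar>" by simp
        also have "\<dots> \<le> M * (C ^ n / fact (Suc n)) * \<bar>r\<bar> ^ Suc n * T"
          by (intro mult_left_mono mult_nonneg_nonneg) (use \<open>M \<ge> 0\<close> \<open>C \<ge> 0\<close> r in auto)
        also have "\<dots> = C ^ Suc n / fact (Suc n) * \<bar>r\<bar> ^ Suc n" by (simp add: C_def)
        finally show ?thesis .
      qed
      have "\<bar>b (Suc (Suc n)) s\<bar> \<le> M * (C ^ Suc n / fact (Suc n)) * \<bar>s\<bar> ^ Suc (Suc n) / real (Suc (Suc n))"
        if s: "\<bar>s\<bar> \<le> T"
      proof (rule DERIV_power_bound[where f = "c (Suc (Suc n))" and T = T])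
        fix r :: real assume r: "\<bar>r\<bar> \<le> T"
        have "\<bar>V r\<bar> * \<bar>a (Suc n) r\<bar> \<le> M * (C ^ Suc n / fact (Suc n) * \<bar>r\<bar> ^ Suc n)"
          by (intro mult_mono A r M) (use r \<open>M \<ge> 0\<close> in auto)
        then show "\<bar>c (Suc (Suc n)) r\<bar> \<le> M * (C ^ Suc n / fact (Suc n)) * \<bar>r\<bar> ^ Suc n"
          by (simp add: c_def abs_mult)
      qed (use s db[of "Suc (Suc n)"] in \<open>auto simp: bS\<close>)
      also have "M * (C ^ Suc n / fact (Suc n)) * \<bar>s\<bar> ^ Suc (Suc n) / real (Suc (Suc n))
          = M * (C ^ Suc n / fact (Suc (Suc n))) * \<bar>s\<bar> ^ Suc (Suc n)"
        by (simp add: field_simps)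
      finally show ?case using A by blast
    qed
    have summ: "summable (\<lambda>n. K * ((C * T) ^ n / fact n))" for K
      using summable_mult[OF summable_exp[of "C * T"], of K] by (simp add: divide_inverse mult_ac)
    have aa: "\<bar>a n s\<bar> \<le> (C * T) ^ n / fact n" if "\<bar>s\<bar> \<le> T" for n s
    proof -
      have "C ^ n / fact n * \<bar>s\<bar> ^ n \<le> C ^ n / fact n * T ^ n"
        by (intro mult_left_mono power_mono) (use that \<open>C \<ge> 0\<close> in auto)
      then show ?thesis using ab[of s n] that by (simp add: power_mult_distrib)
    qed
    have bb: "\<bar>b (Suc n) s\<bar> \<le> C * ((C * T) ^ n / fact n)" if "\<bar>s\<bar> \<le> T" for n s
    proof -
      have "\<bar>b (Suc n) s\<bar> \<le> M * (C ^ n / fact (Suc n)) * \<bar>s\<bar> ^ Suc n" using ab that by blast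
      also have "\<dots> \<le> M * (C ^ n / fact n) * T ^ Suc n"
        by (intro mult_mono power_mono divide_left_mono fact_mono mult_nonneg_nonneg divide_nonneg_nonneg)
          (use that \<open>C \<ge> 0\<close> \<open>M \<ge> 0\<close> \<open>T \<ge> 1\<close> in auto)
      finally show ?thesis by (simp add: C_def power_mult_distrib mult_ac)
    qed
    have cc: "\<bar>c (Suc n) s\<bar> \<le> M * ((C * T) ^ n / fact n)" if "\<bar>s\<bar> \<le> T" for n s
    proof -
      have "\<bar>V s\<bar> * \<bar>a n s\<bar> \<le> M * ((C * T) ^ n / fact n)"
        by (intro mult_mono aa M) (use that \<open>M \<ge> 0\<close> in auto)
      then show ?thesis by (simp add: c_def abs_mult)
    qed
    have shift: "summable h" if "summable (\<lambda>n. h (Suc n))" for h :: "nat \<Rightarrow> real"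
      using that by (simp add: summable_Suc_iff)
    define Bb where "Bb n = (case n of 0 \<Rightarrow> 0 | Suc m \<Rightarrow> C * ((C * T) ^ m / fact m))" for n
    define Bc where "Bc n = (case n of 0 \<Rightarrow> 0 | Suc m \<Rightarrow> M * ((C * T) ^ m / fact m))" for n
    have Bb: "summable Bb" by (rule shift) (use summ[of C] in \<open>simp add: Bb_def\<close>)
    have Bc: "summable Bc" by (rule shift) (use summ[of M] in \<open>simp add: Bc_def\<close>)
    have bB: "\<bar>b n s\<bar> \<le> Bb n" if "\<bar>s\<bar> \<le> T" for n s
      using bb[OF that] by (cases n) (auto simp: Bb_def b_def)
    have cB: "\<bar>c n s\<bar> \<le> Bc n" if "\<bar>s\<bar> \<le> T" for n s
      using cc[OF that] by (cases n) (auto simp: Bc_def c_def)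
    have ucb: "uniformly_convergent_on {-T..T} (\<lambda>n x. \<Sum>i<n. b i x)"
      by (rule Weierstrass_m_test'[OF _ Bb]) (use bB in \<open>auto simp: abs_le_iff\<close>)
    have ucc: "uniformly_convergent_on {-T..T} (\<lambda>n x. \<Sum>i<n. c i x)"
      by (rule Weierstrass_m_test'[OF _ Bc]) (use cB in \<open>auto simp: abs_le_iff\<close>)
    have sa: "summable (\<lambda>n. a n s)" if "\<bar>s\<bar> \<le> T" for s
      by (rule summable_comparison_test'[OF summ[of 1], of 0]) (use aa[OF that] in simp)
    have sb: "summable (\<lambda>n. b n s)" if "\<bar>s\<bar> \<le> T" for s
      by (rule summable_comparison_test'[OF Bb, of 0]) (use bB[OF that] in simp)
    have t: "t \<in> interior {-T..T}" "0 \<in> {-T..T}" by (auto simp: T_def)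
    have "((\<lambda>t. \<Sum>n. a n t) has_real_derivative (\<Sum>n. b n t)) (at t)"
      by (rule has_field_derivative_series'(2)[OF _ _ ucb t(2) sa t(1)])
        (use \<open>T \<ge> 1\<close> in \<open>auto intro: da has_field_derivative_at_within\<close>)
    moreover have "((\<lambda>t. \<Sum>n. b n t) has_real_derivative (\<Sum>n. c n t)) (at t)"
      by (rule has_field_derivative_series'(2)[OF _ _ ucc t(2) sb t(1)])
        (use \<open>T \<ge> 1\<close> in \<open>auto intro: db has_field_derivative_at_within\<close>)
    ultimately show ?thesis using sa[of t] sb[of t] by (auto simp: T_def)
  qed
  define u where "u t = (\<Sum>n. a n t)" for t
  define u' where "u' t = (\<Sum>n. b n t)" for t
  have cu: "(\<Sum>n. c n t) = V t * u t" for t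
  proof -
    have s: "summable (\<lambda>n. V t * a n t)" using main[of t] by (intro summable_mult) blast
    then have "summable (\<lambda>n. c (Suc n) t)" by (simp add: c_def)
    then have "(\<Sum>n. c (Suc n) t) = (\<Sum>n. c n t) - c 0 t"
      using summable_Suc_iff[of "\<lambda>n. c n t"] suminf_split_head by blast
    moreover have "(\<Sum>n. c (Suc n) t) = V t * u t"
      using main[of t] by (simp add: c_def u_def suminf_mult)
    ultimately show ?thesis by (simp add: c_def)
  qed
  have a00: "a n 0 = (if n = 0 then 1 else 0)" for n by (cases n) (auto simp: a0 aS)
  have b00: "b n 0 = 0" for n by (cases n) (auto simp: b_def)
  show ?thesis
  proof
    show "u 0 = 1" using suminf_finite[of "{0}" "\<lambda>n. a n 0"] by (simp add: u_def a00)
    show "u' 0 = 0" by (simp add: u'_def b00)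
    show "(u has_real_derivative u' t) (at t)" for t
      using main[of t] unfolding u_def u'_def by blast
    show "(u' has_real_derivative V t * u t) (at t)" for t
      using main[of t] unfolding cu unfolding u'_def by blast
  qed
qed

text \<open>Gronwall's argument applied to the energy $d^2 + d'^2$.\<close>

lemma ode_energy_bound:
  fixes d d' V g :: "real \<Rightarrow> real"
  assumes d: "\<And>t. (d has_real_derivative d' t) (at t)"
    and d': "\<And>t. (d' has_real_derivative V t * d t + g t) (at t)"
    and "d 0 = 0" "d' 0 = 0"
    and V: "\<And>t. 0 \<le> t \<Longrightarrow> t \<le> T \<Longrightarrow> \<bar>V t\<bar> \<le> M"
    and g: "\<And>t. 0 \<le> t \<Longrightarrow> t \<le> T \<Longrightarrow> \<bar>g t\<bar> \<le> \<eta>"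
    and "0 \<le> t" "t \<le> T"
  shows "(d t)\<^sup>2 + (d' t)\<^sup>2 \<le> \<eta>\<^sup>2 * t * exp ((M + 2) * t)"
proof -
  \<comment> \<open>The rate M + 2 collects three parts: 1 from 2 d d', M from the potential term,
    and 1 from splitting 2 d' g into d'^2 + g^2.\<close>
  define e where "e s = ((d s)\<^sup>2 + (d' s)\<^sup>2) * exp (- (M + 2) * s)" for s
  have M: "M \<ge> 0" using V[of 0] assms(7,8) by auto
  have "\<eta>\<^sup>2 * 0 - e 0 \<le> \<eta>\<^sup>2 * t - e t"
  proof (rule DERIV_nonneg_imp_nondecreasing[OF \<open>0 \<le> t\<close>])
    fix s assume s: "0 \<le> s" "s \<le> t"
    define D where "D = 2 * d s * d' s + 2 * d' s * (V s * d s + g s)"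
    have "(e has_real_derivative D * exp (- (M + 2) * s) - (M + 2) * e s) (at s)"
      unfolding e_def D_def by (auto intro!: derivative_eq_intros d d' simp: algebra_simps power2_eq_square)
    then have 1: "((\<lambda>s. \<eta>\<^sup>2 * s - e s) has_real_derivative (\<eta>\<^sup>2 - (D * exp (- (M + 2) * s) - (M + 2) * e s))) (at s)"
      by (auto intro!: derivative_eq_intros)
    have Vs: "\<bar>V s\<bar> \<le> M" "\<bar>g s\<bar> \<le> \<eta>" using V g s assms by auto
    have "2 * (d s * d' s) \<le> (d s)\<^sup>2 + (d' s)\<^sup>2" using sum_squares_bound[of "d s" "d' s"] by simp
    moreover have "2 * (d' s * (V s * d s)) \<le> M * ((d s)\<^sup>2 + (d' s)\<^sup>2)"
    proof -
      have "2 * (d' s * (V s * d s)) \<le> \<bar>V s\<bar> * (2 * (\<bar>d s\<bar> * \<bar>d' s\<bar>))"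
        using abs_ge_self[of "2 * (d' s * (V s * d s))"] by (simp add: abs_mult mult_ac)
      also have "\<dots> \<le> M * (2 * (\<bar>d s\<bar> * \<bar>d' s\<bar>))"
        by (intro mult_right_mono Vs) auto
      also have "\<dots> \<le> M * ((d s)\<^sup>2 + (d' s)\<^sup>2)"
        using sum_squares_bound[of "\<bar>d s\<bar>" "\<bar>d' s\<bar>"] M by (intro mult_left_mono) (auto simp: mult_ac)
      finally show ?thesis .
    qed
    moreover have "2 * (d' s * g s) \<le> (d' s)\<^sup>2 + \<eta>\<^sup>2"
    proof -
      have "(g s)\<^sup>2 \<le> \<eta>\<^sup>2" using Vs(2) by (simp add: abs_le_square_iff[symmetric])
      then show ?thesis using sum_squares_bound[of "d' s" "g s"] by simp
    qed
    moreover have "0 \<le> (d s)\<^sup>2" by simp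
    moreover have "D = 2 * (d s * d' s) + 2 * (d' s * (V s * d s)) + 2 * (d' s * g s)"
      by (simp add: D_def algebra_simps)
    moreover have "(M + 2) * ((d s)\<^sup>2 + (d' s)\<^sup>2)
        = M * ((d s)\<^sup>2 + (d' s)\<^sup>2) + 2 * (d s)\<^sup>2 + 2 * (d' s)\<^sup>2"
      by (simp add: algebra_simps)
    ultimately have D: "D \<le> (M + 2) * ((d s)\<^sup>2 + (d' s)\<^sup>2) + \<eta>\<^sup>2"
      by linarith
    have "D * exp (- (M + 2) * s) \<le> ((M + 2) * ((d s)\<^sup>2 + (d' s)\<^sup>2) + \<eta>\<^sup>2) * exp (- (M + 2) * s)"
      by (intro mult_right_mono D) auto
    also have "\<dots> = (M + 2) * e s + \<eta>\<^sup>2 * exp (- (M + 2) * s)"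
      by (simp add: e_def algebra_simps)
    also have "\<dots> \<le> (M + 2) * e s + \<eta>\<^sup>2 * 1"
      by (intro add_left_mono mult_left_mono) (use s M in \<open>auto simp: mult_nonneg_nonneg mult_nonpos_nonneg\<close>)
    finally have "\<eta>\<^sup>2 - (D * exp (- (M + 2) * s) - (M + 2) * e s) \<ge> 0" by simp
    with 1 show "\<exists>y. ((\<lambda>s. \<eta>\<^sup>2 * s - e s) has_real_derivative y) (at s) \<and> 0 \<le> y" by blast
  qed
  then have "e t \<le> \<eta>\<^sup>2 * t" using assms(3,4) by (simp add: e_def)
  then have "e t * exp ((M + 2) * t) \<le> \<eta>\<^sup>2 * t * exp ((M + 2) * t)"
    by (intro mult_right_mono) auto
  moreover have "exp (- (M + 2) * t) * exp ((M + 2) * t) = 1" by (simp add: exp_add[symmetric] algebra_simps)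
  ultimately show ?thesis by (metis e_def mult.assoc mult.right_neutral)
qed

text \<open>Uniqueness run backwards: s \<mapsto> d(t - s) solves a homogeneous equation with zero
  data at s = 0, so the energy bound with no forcing annihilates it.\<close>

lemma ode_nonzero:
  fixes d d' V :: "real \<Rightarrow> real"
  assumes d: "\<And>t. (d has_real_derivative d' t) (at t)"
    and d': "\<And>t. (d' has_real_derivative V t * d t) (at t)"
    and V: "continuous_on UNIV V"
    and "0 \<le> t" "d t = 0" "d' t = 0"
  shows "d 0 = 0"
proof -
  have "compact (V ` {0..t})"
    using V by (meson compact_Icc compact_continuous_image continuous_on_subset subset_UNIV)
  then obtain M where M: "\<And>s. s \<in> {0..t} \<Longrightarrow> \<bar>V s\<bar> \<le> M"
    by (metis compact_imp_bounded bounded_iff imageI real_norm_def)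
  have "((\<lambda>s. d (t - s)) has_real_derivative d' (t - s) * (-1)) (at s)" for s
    by (rule DERIV_chain2[OF d]) (auto intro!: derivative_eq_intros)
  then have "((\<lambda>s. d (t - s)) has_real_derivative - d' (t - s)) (at s)" for s
    by simp
  moreover have "((\<lambda>s. d' (t - s)) has_real_derivative V (t - s) * d (t - s) * (-1)) (at s)" for s
    by (rule DERIV_chain2[OF d']) (auto intro!: derivative_eq_intros)
  then have "((\<lambda>s. - d' (t - s)) has_real_derivative V (t - s) * d (t - s) + 0) (at s)" for s
    using DERIV_minus by fastforce
  ultimately have "(d (t - t))\<^sup>2 + (- d' (t - t))\<^sup>2 \<le> 0\<^sup>2 * t * exp ((M + 2) * t)"
    by (rule ode_energy_bound[where T = t]) (use M assms in auto)
  then show ?thesis by (simp add: sum_power2_le_zero_iff)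
qed

text \<open>(u u')' = u'^2 + V u^2 \<ge> 0, so u u' stays nonnegative, u^2 cannot decrease, and u
  never gets back to 0.\<close>

lemma ode_stays_positive:
  fixes u u' V :: "real \<Rightarrow> real"
  assumes u: "\<And>t. (u has_real_derivative u' t) (at t)"
    and u': "\<And>t. (u' has_real_derivative V t * u t) (at t)"
    and V: "\<And>t. a \<le> t \<Longrightarrow> 0 \<le> V t"
    and "0 < u a" "0 \<le> u' a" "a \<le> t"
  shows "0 < u t"
proof (rule ccontr)
  have uu': "((\<lambda>s. u s * u' s) has_real_derivative ((u' s)\<^sup>2 + V s * (u s)\<^sup>2)) (at s)" for s
    by (auto intro!: derivative_eq_intros u u' simp: power2_eq_square algebra_simps)
  have w: "0 \<le> u s * u' s" if "a \<le> s" for s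
  proof -
    have "u a * u' a \<le> u s * u' s"
      by (rule DERIV_nonneg_imp_nondecreasing[OF that]) (use uu' V in \<open>auto intro!: exI conjI\<close>)
    then show ?thesis using assms(4,5) by (meson less_imp_le mult_nonneg_nonneg order_trans)
  qed
  have usq: "(u a)\<^sup>2 \<le> (u s)\<^sup>2" if "a \<le> s" for s
  proof (rule DERIV_nonneg_imp_nondecreasing[OF that])
    fix r assume "a \<le> r"
    moreover have "((\<lambda>s. (u s)\<^sup>2) has_real_derivative (2 * (u r * u' r))) (at r)"
      by (auto intro!: derivative_eq_intros u)
    ultimately show "\<exists>y. ((\<lambda>s. (u s)\<^sup>2) has_real_derivative y) (at r) \<and> 0 \<le> y"
      using w by (intro exI conjI) auto
  qed
  assume "\<not> 0 < u t"
  then obtain s where s: "a \<le> s" "s \<le> t" "u s = 0"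
    using IVT2'[of u t 0 a] assms(4,6) continuous_on_DERIV[OF u] by fastforce
  then show False using usq[of s] assms(4) by simp
qed

lemma continuous_bounded_Icc:
  fixes f :: "real \<Rightarrow> 'a::real_normed_vector"
  assumes "continuous_on UNIV f"
  obtains B where "B > 0" "\<And>s. a \<le> s \<Longrightarrow> s \<le> b \<Longrightarrow> norm (f s) \<le> B"
proof -
  have "compact (f ` {a..b})"
    using assms by (meson compact_Icc compact_continuous_image continuous_on_subset subset_UNIV)
  then obtain M where "\<And>s. s \<in> {a..b} \<Longrightarrow> norm (f s) \<le> M"
    by (metis compact_imp_bounded bounded_iff imageI)
  then have "norm (f s) \<le> \<bar>M\<bar> + 1" if "a \<le> s" "s \<le> b" for s
    using that by (metis abs_ge_self add_increasing2 atLeastAtMost_iff order_trans zero_le_one)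
  then show ?thesis using that[of "\<bar>M\<bar> + 1"] by auto
qed

lemma continuous_on_abs_powr:
  assumes "p > 0" "continuous_on A f"
  shows "continuous_on A (\<lambda>t. \<bar>f t\<bar> powr p :: real)"
  using assms by (intro continuous_on_powr' continuous_intros) auto

text \<open>The sign of u + u' decides. Since (u + u') exp(-t) is nondecreasing, a positive value of
  u + u' would grow exponentially, yet u + u' \<le> u stays bounded. Hence u + u' \<le> 0, which
  says that u exp(t) does not increase.\<close>

lemma ode_decreasing_decay:
  fixes u u' V :: "real \<Rightarrow> real"
  assumes u: "\<And>t. (u has_real_derivative u' t) (at t)"
    and u': "\<And>t. (u' has_real_derivative V t * u t) (at t)"
    and V: "\<And>t. a \<le> t \<Longrightarrow> 1 \<le> V t"
    and pos: "\<And>t. a \<le> t \<Longrightarrow> 0 < u t" and neg: "\<And>t. a \<le> t \<Longrightarrow> u' t \<le> 0"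
    and "a \<le> t"
  shows "u t \<le> u a * exp a * exp (- t)"
proof -
  have w: "u s + u' s \<le> 0" if "a \<le> s" for s
  proof (rule ccontr)
    define k where "k = u s + u' s"
    assume "\<not> u s + u' s \<le> 0"
    then have "k > 0" by (simp add: k_def)
    have mono: "(u s + u' s) * exp (- s) \<le> (u r + u' r) * exp (- r)" if "s \<le> r" for r
    proof (rule DERIV_nonneg_imp_nondecreasing[OF that])
      fix x assume "s \<le> x"
      then have "a \<le> x" using \<open>a \<le> s\<close> by simp
      have "((\<lambda>x. (u x + u' x) * exp (- x)) has_real_derivative (V x - 1) * u x * exp (- x)) (at x)"
        by (auto intro!: derivative_eq_intros u u' simp: algebra_simps)
      moreover have "(V x - 1) * u x * exp (- x) \<ge> 0"
        using V[OF \<open>a \<le> x\<close>] pos[OF \<open>a \<le> x\<close>] by simp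
      ultimately show "\<exists>y. ((\<lambda>x. (u x + u' x) * exp (- x)) has_real_derivative y) (at x) \<and> 0 \<le> y"
        by blast
    qed
    have "u s \<ge> u r" if "s \<le> r" for r
      by (rule DERIV_nonpos_imp_nonincreasing[OF that]) (use u neg \<open>a \<le> s\<close> in \<open>meson order_trans\<close>)
    then have bnd: "k * exp (r - s) \<le> u s" if "s \<le> r" for r
    proof -
      have "k * exp (- s) * exp r \<le> (u r + u' r) * exp (- r) * exp r"
        using mono[OF that] by (simp add: k_def)
      also have "\<dots> = u r + u' r" by (simp add: exp_minus)
      also have "\<dots> \<le> u s"
        using neg[of r] \<open>a \<le> s\<close> that \<open>\<And>r. s \<le> r \<Longrightarrow> u r \<le> u s\<close>[OF that] by linarith
      finally show ?thesis by (simp add: exp_diff exp_minus field_simps)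
    qed
    have "u s > 0" using pos that by blast
    \<comment> \<open>Evaluating \<open>bnd\<close> at distance u s / k beyond s already contradicts
      it: k * exp (u s / k) \<ge> u s + k > u s.\<close>
    have "u s / k + 1 \<le> exp (u s / k)"
      using exp_ge_add_one_self[of "u s / k"] by (simp only: add.commute)
    then have "k * (u s / k + 1) \<le> k * exp (u s / k)"
      using \<open>k > 0\<close> by simp
    also have "\<dots> \<le> u s" using bnd[of "s + u s / k"] \<open>u s > 0\<close> \<open>k > 0\<close> by simp
    also have "u s = k * (u s / k)" using \<open>k > 0\<close> by simp
    finally show False using \<open>k > 0\<close> by (simp only: mult_le_cancel_left_pos)
  qed
  have "u t * exp t \<le> u a * exp a"
  proof (rule DERIV_nonpos_imp_nonincreasing[OF \<open>a \<le> t\<close>])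
    fix x assume "a \<le> x"
    have "((\<lambda>x. u x * exp x) has_real_derivative (u x + u' x) * exp x) (at x)"
      by (auto intro!: derivative_eq_intros u simp: algebra_simps)
    moreover have "(u x + u' x) * exp x \<le> 0" using w[OF \<open>a \<le> x\<close>] by (simp add: mult_nonpos_nonneg)
    ultimately show "\<exists>y. ((\<lambda>x. u x * exp x) has_real_derivative y) (at x) \<and> y \<le> 0" by blast
  qed
  then have "u t * exp t * exp (- t) \<le> u a * exp a * exp (- t)" by simp
  then show ?thesis by (simp add: exp_minus field_simps)
qed

text \<open>\<open>U l\<close> is the even solution with spectral parameter \<open>l\<close>.  Both having a zero and turning
  upwards in the region where the potential dominates are open conditions on \<open>l\<close>, so neither
  holds at the infimum of the parameters with a zero.\<close>

locale shooting =
  fixes p :: real and U U' :: "real \<Rightarrow> real \<Rightarrow> real"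
  assumes p: "p \<ge> 1"
    and U0: "U l 0 = 1" "U' l 0 = 0"
    and U: "(U l has_real_derivative U' l t) (at t)"
    and U': "(U' l has_real_derivative (\<bar>t\<bar> powr p - l) * U l t) (at t)"
begin

lemma V_cont: "continuous_on UNIV (\<lambda>t. \<bar>t\<bar> powr p - l)"
  using p by (intro continuous_intros continuous_on_abs_powr) auto

lemma U_cont: "continuous_on A (U l)" "continuous_on A (U' l)"
  by (rule continuous_on_DERIV[OF U] continuous_on_DERIV[OF U'])+

text \<open>The reflected function solves the same equation with the same data, so the energy bound
  kills the difference. Positivity and decay therefore need to be proved on the half-line
  only.\<close>

lemma U_even: "U l (- t) = U l t \<and> U' l (- t) = - U' l t"
proof -
  have *: "U l (- t) = U l t \<and> U' l (- t) = - U' l t" if "t \<ge> 0" for t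
  proof -
    obtain M where M: "\<And>s. 0 \<le> s \<Longrightarrow> s \<le> t \<Longrightarrow> norm (\<bar>s\<bar> powr p - l) \<le> M"
      using continuous_bounded_Icc[OF V_cont] by metis
    have 1: "((\<lambda>s. U l (- s)) has_real_derivative - U' l (- s)) (at s)" for s
      using U[of l "- s"] by (simp add: DERIV_mirror)
    have 2: "((\<lambda>s. U' l (- s)) has_real_derivative - ((\<bar>s\<bar> powr p - l) * U l (- s))) (at s)" for s
      using U'[of l "- s"] by (simp add: DERIV_mirror)
    have "(U l t - U l (- t))\<^sup>2 + (U' l t + U' l (- t))\<^sup>2 \<le> 0\<^sup>2 * t * exp ((M + 2) * t)"
    proof (rule ode_energy_bound[where g = "\<lambda>_. 0" and T = t])
      show "((\<lambda>t. U l t - U l (- t)) has_real_derivative (U' l s + U' l (- s))) (at s)" for s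
        using DERIV_diff[OF U 1] by simp
      show "((\<lambda>t. U' l t + U' l (- t)) has_real_derivative (\<bar>s\<bar> powr p - l) * (U l s - U l (- s)) + 0) (at s)" for s
        using DERIV_add[OF U' 2] by (simp add: algebra_simps)
    qed (use that U0 M in auto)
    then show ?thesis by (simp add: sum_power2_le_zero_iff eq_neg_iff_add_eq_0 add.commute)
  qed
  show ?thesis using *[of t] *[of "- t"] by (cases "t \<ge> 0") auto
qed

text \<open>U m - U l solves the equation for m with zero data and the small forcing (l - m) U l, so
  the energy bound is proportional to |m - l|.\<close>

lemma U_continuous_parameter:
  assumes "e > 0" "T \<ge> 0"
  obtains \<delta> where "\<delta> > 0"
    "\<And>m t. \<bar>m - l\<bar> < \<delta> \<Longrightarrow> 0 \<le> t \<Longrightarrow> t \<le> T \<Longrightarrow> \<bar>U m t - U l t\<bar> < e \<and> \<bar>U' m t - U' l t\<bar> < e"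
proof -
  obtain B where B: "B > 0" "\<And>s. 0 \<le> s \<Longrightarrow> s \<le> T \<Longrightarrow> norm (U l s) \<le> B"
    using continuous_bounded_Icc[OF U_cont(1)] by metis
  \<comment> \<open>This must bound the potential for every m in play at once; the summand 1 pays
    for |m - l| < 1, whence the minimum with 1 in \<open>\<delta>\<close>.\<close>
  define M where "M = T powr p + \<bar>l\<bar> + 1"
  define K where "K = B * sqrt (T * exp ((M + 2) * T))"
  have "K \<ge> 0" "M \<ge> 0" using B assms by (auto simp: K_def M_def)
  define \<delta> where "\<delta> = min 1 (e / (K + 1))"
  show ?thesis
  proof (rule that[of \<delta>])
    show "\<delta> > 0" using assms \<open>K \<ge> 0\<close> by (simp add: \<delta>_def)
    fix m t assume m: "\<bar>m - l\<bar> < \<delta>" and t: "0 \<le> t" "t \<le> T"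
    have "(U m t - U l t)\<^sup>2 + (U' m t - U' l t)\<^sup>2 \<le> (\<bar>m - l\<bar> * B)\<^sup>2 * t * exp ((M + 2) * t)"
    proof (rule ode_energy_bound[where g = "\<lambda>s. (l - m) * U l s" and T = T])
      show "((\<lambda>t. U m t - U l t) has_real_derivative (U' m s - U' l s)) (at s)" for s
        by (rule DERIV_diff[OF U U])
      show "((\<lambda>t. U' m t - U' l t) has_real_derivative (\<bar>s\<bar> powr p - m) * (U m s - U l s) + (l - m) * U l s) (at s)" for s
        using DERIV_diff[OF U' U'] by (simp add: algebra_simps)
      fix s assume s: "0 \<le> s" "s \<le> T"
      have "s powr p \<le> T powr p" using s p by (intro powr_mono2) auto
      moreover have "s powr p \<ge> 0" by simp
      moreover have "\<bar>m - l\<bar> < 1" using m by (simp add: \<delta>_def)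
      ultimately show "\<bar>\<bar>s\<bar> powr p - m\<bar> \<le> M" using s unfolding M_def by linarith
      show "\<bar>(l - m) * U l s\<bar> \<le> \<bar>m - l\<bar> * B"
        using B(2)[OF s] by (simp add: abs_mult abs_minus_commute mult_left_mono)
    qed (use U0 t in auto)
    also have "\<dots> \<le> (\<bar>m - l\<bar> * B)\<^sup>2 * T * exp ((M + 2) * T)"
      by (intro mult_mono mult_nonneg_nonneg) (use t \<open>M \<ge> 0\<close> in \<open>auto simp: mult_left_mono\<close>)
    also have "\<dots> = (\<bar>m - l\<bar> * K)\<^sup>2"
      using assms by (simp add: K_def power_mult_distrib)
    finally have *: "(U m t - U l t)\<^sup>2 + (U' m t - U' l t)\<^sup>2 \<le> (\<bar>m - l\<bar> * K)\<^sup>2" .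
    have "\<bar>U m t - U l t\<bar>\<^sup>2 \<le> (\<bar>m - l\<bar> * K)\<^sup>2" "\<bar>U' m t - U' l t\<bar>\<^sup>2 \<le> (\<bar>m - l\<bar> * K)\<^sup>2"
      using * zero_le_power2[of "U m t - U l t"] zero_le_power2[of "U' m t - U' l t"] unfolding power2_abs by linarith+
    then have "\<bar>U m t - U l t\<bar> \<le> \<bar>m - l\<bar> * K" "\<bar>U' m t - U' l t\<bar> \<le> \<bar>m - l\<bar> * K"
      using \<open>K \<ge> 0\<close> by (auto intro: power2_le_imp_le)
    moreover have "\<bar>m - l\<bar> * K < e"
    proof -
      have "\<bar>m - l\<bar> * K \<le> \<bar>m - l\<bar> * (K + 1)" by (simp add: mult_left_mono)
      also have "\<dots> < e / (K + 1) * (K + 1)"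
        using m \<open>K \<ge> 0\<close> by (intro mult_strict_right_mono) (auto simp: \<delta>_def)
      finally show ?thesis using \<open>K \<ge> 0\<close> by simp
    qed
    ultimately show "\<bar>U m t - U l t\<bar> < e \<and> \<bar>U' m t - U' l t\<bar> < e" by simp
  qed
qed

definition crossing :: "real set" where
  "crossing = {l. \<exists>t\<ge>0. U l t \<le> 0}"

text \<open>Sturm comparison with cos(pi t), which vanishes at 1/2. On {0..1/2} the potential is at
  most 1, so with l = 1 + pi^2 a positive solution has a nonincreasing Wronskian \<open>W\<close>;
  but W 0 = 0 and W (1/2) = pi U(1/2) > 0.\<close>

lemma crossing_nonempty: "1 + pi\<^sup>2 \<in> crossing"
proof (rule ccontr)
  define l where "l = 1 + pi\<^sup>2"
  assume "1 + pi\<^sup>2 \<notin> crossing"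
  then have pos: "U l t > 0" if "t \<ge> 0" for t
    using that unfolding crossing_def l_def mem_Collect_eq by (meson not_le)
  define W where "W t = U' l t * cos (pi * t) + pi * U l t * sin (pi * t)" for t
  have "W (1/2) \<le> W 0"
  proof (rule DERIV_nonpos_imp_nonincreasing[where f = W])
    fix t :: real assume t: "0 \<le> t" "t \<le> 1/2"
    have "(W has_real_derivative ((\<bar>t\<bar> powr p - 1) * U l t * cos (pi * t))) (at t)"
      unfolding W_def by (auto intro!: derivative_eq_intros U U' simp: l_def algebra_simps power2_eq_square)
    moreover have "(\<bar>t\<bar> powr p - 1) * U l t * cos (pi * t) \<le> 0"
    proof -
      have "t powr p \<le> 1" using t p by (intro powr_le1) auto
      moreover have "pi * t \<le> pi * (1/2)" using t by (intro mult_left_mono) auto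
      then have "cos (pi * t) \<ge> 0" using t mult_nonneg_nonneg[of pi t] pi_ge_zero by (intro cos_ge_zero) linarith+
      ultimately show ?thesis using pos[of t] t by (simp add: mult_nonpos_nonneg)
    qed
    ultimately show "\<exists>y. (W has_real_derivative y) (at t) \<and> y \<le> 0" by blast
  qed simp
  moreover have "W 0 = 0" "W (1/2) = pi * U l (1/2)" by (simp_all add: W_def U0)
  ultimately show False using pos[of "1/2"] pi_gt_zero by (simp add: mult_le_0_iff)
qed

text \<open>For l \<le> 0 the coefficient |t|^p - l is nonnegative everywhere, so a solution
  starting at 1 with slope 0 stays positive.\<close>

lemma crossing_pos: "l \<in> crossing \<Longrightarrow> l > 0"
proof (rule ccontr)
  assume "l \<in> crossing" "\<not> l > 0"
  then obtain t where t: "t \<ge> 0" "U l t \<le> 0" by (auto simp: crossing_def)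
  have "U l t > 0"
    by (rule ode_stays_positive[OF U U', of 0]) (use U0 t \<open>\<not> l > 0\<close> in \<open>auto simp: le_diff_eq intro: order_trans[OF _ powr_ge_zero]\<close>)
  then show False using t by simp
qed

definition level :: real where "level = Inf crossing"

lemma bdd_crossing: "bdd_below crossing"
  using crossing_pos by (meson bdd_belowI less_imp_le)

text \<open>A zero alone need not persist under perturbation, but touching 0 from above would give a
  double zero, which uniqueness forbids. So the solution would be strictly negative somewhere, and
  then also for slightly smaller parameters, below the infimum.\<close>

lemma level_pos: "t \<ge> 0 \<Longrightarrow> U level t > 0"
proof (rule ccontr)
  assume t: "t \<ge> 0" "\<not> U level t > 0"
  have "\<exists>t\<ge>0. U level t < 0"
  proof (rule ccontr)
    assume "\<not> (\<exists>t\<ge>0. U level t < 0)"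
    then have nn: "U level s \<ge> 0" if "s \<ge> 0" for s using that by (meson not_le)
    then have z: "U level t = 0" using t by (meson antisym not_le)
    then have "t > 0" using t U0 by (metis order_le_less zero_neq_one)
    have "U' level t = 0"
      by (rule DERIV_local_min[OF U \<open>t > 0\<close>]) (use nn z in auto)
    then have "U level 0 = 0"
      using ode_nonzero[OF U U' V_cont \<open>t \<ge> 0\<close> z] by simp
    then show False using U0 by simp
  qed
  then obtain r where r: "r \<ge> 0" "U level r < 0" by blast
  obtain \<delta> where \<delta>: "\<delta> > 0"
    "\<And>m t. \<bar>m - level\<bar> < \<delta> \<Longrightarrow> 0 \<le> t \<Longrightarrow> t \<le> r \<Longrightarrow> \<bar>U m t - U level t\<bar> < - U level r \<and> \<bar>U' m t - U' level t\<bar> < - U level r"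
    by (rule U_continuous_parameter[of "- U level r" r level]) (use r in auto)
  have "U (level - \<delta>/2) r < 0" using \<delta>(2)[of "level - \<delta>/2" r] r \<delta>(1) by auto
  then have "level - \<delta>/2 \<in> crossing" using r by (auto simp: crossing_def intro!: exI[of _ r])
  then have "level \<le> level - \<delta>/2" unfolding level_def by (rule cInf_lower[OF _ bdd_crossing])
  then show False using \<open>\<delta> > 0\<close> by simp
qed

text \<open>Uses t \<le> t powr p, valid for t \<ge> 1 and p \<ge> 1.\<close>

lemma potential_large: "t \<ge> \<bar>l\<bar> + k \<Longrightarrow> k \<ge> 1 \<Longrightarrow> k \<le> \<bar>t\<bar> powr p - l"
proof -
  assume "t \<ge> \<bar>l\<bar> + k" "k \<ge> 1"
  moreover from this have "t powr 1 \<le> t powr p" using p by (intro powr_mono) auto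
  ultimately show ?thesis by auto
qed

lemma level_decreasing:
  assumes "t \<ge> \<bar>level\<bar> + 2"
  shows "U' level t \<le> 0"
proof (rule ccontr)
  assume "\<not> U' level t \<le> 0"
  have "t \<ge> 0" using assms by simp
  obtain s where s: "s \<in> {0..t}" "\<And>r. r \<in> {0..t} \<Longrightarrow> U level s \<le> U level r"
    using continuous_attains_inf[of "{0..t}" "U level"] U_cont \<open>t \<ge> 0\<close> by auto
  \<comment> \<open>Closeness within \<open>e\<close> preserves both positivity on {0..t} and the
    upward slope at t.\<close>
  define e where "e = min (U level s) (U' level t)"
  have "e > 0" using \<open>\<not> U' level t \<le> 0\<close> level_pos[of s] s(1) by (auto simp: e_def)
  obtain \<delta> where \<delta>: "\<delta> > 0"
    "\<And>m r. \<bar>m - level\<bar> < \<delta> \<Longrightarrow> 0 \<le> r \<Longrightarrow> r \<le> t \<Longrightarrow> \<bar>U m r - U level r\<bar> < e \<and> \<bar>U' m r - U' level r\<bar> < e"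
    using U_continuous_parameter[OF \<open>e > 0\<close> \<open>t \<ge> 0\<close>, of level] by metis
  \<comment> \<open>The minimum with 1 gives m \<le> level + 1, so that beyond t the potential still
    dominates m and \<open>ode_stays_positive\<close> applies; m would then not be a crossing
    parameter.\<close>
  obtain m where m: "m \<in> crossing" "m < level + min \<delta> 1"
    using cInf_lessD[of crossing "level + min \<delta> 1"] crossing_nonempty \<delta>(1) by (auto simp: level_def)
  have "level \<le> m" using m(1) unfolding level_def by (rule cInf_lower[OF _ bdd_crossing])
  with m have md: "\<bar>m - level\<bar> < \<delta>" "m \<le> level + 1" by auto
  have pos1: "U m r > 0" if "0 \<le> r" "r \<le> t" for r
    using \<delta>(2)[OF md(1) that] s(2)[of r] that by (auto simp: e_def)
  have "U' m t > 0" using \<delta>(2)[OF md(1) \<open>t \<ge> 0\<close>] by (auto simp: e_def)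
  have "U m r > 0" if "t \<le> r" for r
  proof (rule ode_stays_positive[OF U U' _ pos1 _ that])
    show "0 \<le> \<bar>x\<bar> powr p - m" if "t \<le> x" for x
      using potential_large[of level 2 x] assms that md by simp
  qed (use \<open>U' m t > 0\<close> \<open>t \<ge> 0\<close> in auto)
  with pos1 m(1) show False by (force simp: crossing_def not_less[symmetric])
qed

text \<open>The bound for U' follows from that for U: far out the solution is convex and decreasing,
  so |U'(t)| is at most the drop of U over {t - 1..t}, hence at most U(t - 1). The shift by 1 costs
  the factor exp 1.\<close>

lemma level_decay:
  obtains C where "C > 0" "\<And>t. \<bar>U level t\<bar> \<le> C * exp (- \<bar>t\<bar>)" "\<And>t. \<bar>U' level t\<bar> \<le> C * exp (- \<bar>t\<bar>)"
proof -
  define a where "a = \<bar>level\<bar> + 2"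
  have d: "U level t \<le> U level a * exp a * exp (- t)" if "a \<le> t" for t
    by (rule ode_decreasing_decay[OF U U' _ _ _ that])
      (use potential_large[of level 2] level_pos level_decreasing in \<open>force simp: a_def\<close>)+
  define K where "K = U level a * exp a"
  have "K > 0" using level_pos[of a] by (simp add: K_def a_def)
  have d': "\<bar>U' level t\<bar> \<le> K * exp 1 * exp (- t)" if "a + 1 \<le> t" for t
  proof -
    obtain z where z: "t - 1 < z" "z < t" "U level t - U level (t - 1) = (t - (t - 1)) * U' level z"
      using MVT2[of "t - 1" t "U level" "U' level"] U by auto
    have "U' level z \<le> U' level t"
    proof (rule DERIV_nonneg_imp_nondecreasing[where f = "U' level"])
      fix x assume "z \<le> x"
      then have "a \<le> x" using z that by simp
      then have "x \<ge> 0" by (simp add: a_def)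
      with \<open>a \<le> x\<close> have "0 \<le> (\<bar>x\<bar> powr p - level) * U level x"
        using potential_large[of level 2 x] level_pos[of x] by (simp add: a_def)
      then show "\<exists>y. (U' level has_real_derivative y) (at x) \<and> 0 \<le> y"
        using U' by blast
    qed (use z in simp)
    then have "- U' level t \<le> U level (t - 1)"
      using z(3) level_pos[of t] that by (simp add: a_def abs_if split: if_splits)
    also have "\<dots> \<le> K * exp (- (t - 1))" using d[of "t - 1"] that by (simp add: K_def)
    finally have "- U' level t \<le> K * exp 1 * exp (- t)" by (simp add: exp_diff exp_minus field_simps)
    moreover have "U' level t \<le> 0" using level_decreasing that by (simp add: a_def)
    ultimately show ?thesis by simp
  qed
  obtain B1 where B1: "B1 > 0" "\<And>s. 0 \<le> s \<Longrightarrow> s \<le> a + 1 \<Longrightarrow> norm (U level s) \<le> B1"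
    using continuous_bounded_Icc[OF U_cont(1)] by metis
  obtain B2 where B2: "B2 > 0" "\<And>s. 0 \<le> s \<Longrightarrow> s \<le> a + 1 \<Longrightarrow> norm (U' level s) \<le> B2"
    using continuous_bounded_Icc[OF U_cont(2)] by metis
  define C where "C = K * exp 1 + (B1 + B2) * exp (a + 1)"
  have "C > 0" using \<open>K > 0\<close> B1(1) B2(1) by (simp add: C_def add_pos_pos)
  have main: "\<bar>U level t\<bar> \<le> C * exp (- t) \<and> \<bar>U' level t\<bar> \<le> C * exp (- t)" if "t \<ge> 0" for t
  proof (cases "t \<le> a + 1")
    case True
    have "(B1 + B2) * 1 \<le> (B1 + B2) * (exp (a + 1) * exp (- t))"
      using True B1(1) B2(1) by (intro mult_left_mono) (auto simp: exp_add[symmetric])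
    also have "\<dots> \<le> C * exp (- t)"
      using \<open>K > 0\<close> by (simp add: C_def algebra_simps)
    finally show ?thesis using B1 B2 B1(2)[OF that True] B2(2)[OF that True] by auto
  next
    case False
    have "U level t \<le> K * exp (- t)" using d[of t] False by (simp add: K_def)
    also have "\<dots> \<le> (K * exp 1) * exp (- t)" using \<open>K > 0\<close> by simp
    finally have "\<bar>U level t\<bar> \<le> (K * exp 1) * exp (- t)" using level_pos[OF that] by simp
    moreover have "\<bar>U' level t\<bar> \<le> (K * exp 1) * exp (- t)" using d'[of t] False by simp
    moreover have "(K * exp 1) * exp (- t) \<le> C * exp (- t)"
      using B1(1) B2(1) by (intro mult_right_mono) (auto simp: C_def)
    ultimately show ?thesis by linarith
  qed
  have "\<bar>U level t\<bar> \<le> C * exp (- \<bar>t\<bar>) \<and> \<bar>U' level t\<bar> \<le> C * exp (- \<bar>t\<bar>)" for t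
    using main[of t] main[of "- t"] U_even[of level t] by (cases "t \<ge> 0") auto
  then show ?thesis using that \<open>C > 0\<close> by blast
qed

end

lemma ground_state_exists:
  assumes "p \<ge> (1::real)"
  obtains l C :: real and u u' :: "real \<Rightarrow> real" where "C > 0"
    "\<And>t. (u has_real_derivative u' t) (at t)"
    "\<And>t. (u' has_real_derivative (\<bar>t\<bar> powr p - l) * u t) (at t)"
    "\<And>t. u t > 0" "\<And>t. \<bar>u t\<bar> \<le> C * exp (- \<bar>t\<bar>)" "\<And>t. \<bar>u' t\<bar> \<le> C * exp (- \<bar>t\<bar>)"
proof -
  have "\<exists>u u'. u 0 = 1 \<and> u' 0 = 0 \<and> (\<forall>t. (u has_real_derivative u' t) (at t)) \<and>
      (\<forall>t. (u' has_real_derivative (\<bar>t\<bar> powr p - l) * u t) (at t))" for l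
  proof -
    have "continuous_on UNIV (\<lambda>t. \<bar>t\<bar> powr p - l)"
      using assms by (intro continuous_intros continuous_on_abs_powr) auto
    from linear_ode_exists[OF this] show ?thesis by metis
  qed
  then obtain U U' where "shooting p U U'"
    unfolding shooting_def using assms by metis
  then interpret shooting p U U' .
  have "U level t > 0" for t
    using level_pos[of t] level_pos[of "- t"] U_even[of level t] by (cases "t \<ge> 0") auto
  with level_decay U U' that show ?thesis by metis
qed

section \<open>Smooth approximations of the ground state\<close>

lemma smooth1_real_polynomial:
  assumes "real_polynomial_function Q"
  shows "smooth1 (\<lambda>t. complex_of_real (Q t))"
  using assms
proof induction
  case (linear f)
  have "f t = f 1 * t" for t
    using bounded_linear.linear[OF linear] linear_scale[of f t 1] by simp
  then have "(\<lambda>t. complex_of_real (f t)) = (\<lambda>t. complex_of_real (f 1) * complex_of_real t)"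
    by (metis of_real_mult)
  then show ?case by (simp add: smooth1_mult smooth1_const smooth1_of_real)
qed (auto intro: smooth1_const smooth1_add smooth1_mult)

text \<open>Only the second derivative is approximated, by Weierstrass; two integrations from the
  exact values at 0 recover the rest. Each integration over |t| \<le> M loses at most a factor M,
  hence the tolerance \<delta> / M^2.\<close>

lemma smooth_C2_approx:
  fixes u u' u'' :: "real \<Rightarrow> real"
  assumes u: "\<And>t. (u has_real_derivative u' t) (at t)" and u': "\<And>t. (u' has_real_derivative u'' t) (at t)"
    and u'': "continuous_on UNIV u''" and "M \<ge> 1" "\<delta> > 0"
  obtains P P' P'' where "\<And>t. (P has_real_derivative P' t) (at t)" "\<And>t. (P' has_real_derivative P'' t) (at t)"
    "smooth1 (\<lambda>t. complex_of_real (P t))"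
    "\<And>t. \<bar>t\<bar> \<le> M \<Longrightarrow> \<bar>P t - u t\<bar> \<le> \<delta> \<and> \<bar>P' t - u' t\<bar> \<le> \<delta> \<and> \<bar>P'' t - u'' t\<bar> \<le> \<delta>"
proof -
  have "\<delta> / M\<^sup>2 > 0" using assms by simp
  moreover have "continuous_on {-M..M} u''" using u'' continuous_on_subset by blast
  ultimately obtain Q where Q: "real_polynomial_function Q" "\<And>x. x \<in> {-M..M} \<Longrightarrow> \<bar>u'' x - Q x\<bar> < \<delta> / M\<^sup>2"
    using Stone_Weierstrass_real_polynomial_function[of "{-M..M}" u''] compact_Icc by metis
  define P' where "P' t = primitive Q t + u' 0" for t
  define P where "P t = primitive P' t + u 0" for t
  have Qc: "continuous_on UNIV Q"
    using Q(1) by (simp add: continuous_on_polymonial_function real_polynomial_function_eq)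
  have dP': "(P' has_real_derivative Q t) (at t)" for t
    unfolding P'_def by (auto intro!: derivative_eq_intros DERIV_primitive Qc)
  have dP: "(P has_real_derivative P' t) (at t)" for t
    unfolding P_def by (auto intro!: derivative_eq_intros DERIV_primitive continuous_on_DERIV[OF dP'])
  have b2: "\<bar>Q t - u'' t\<bar> \<le> \<delta> / M\<^sup>2 * \<bar>t\<bar> ^ 0" if "\<bar>t\<bar> \<le> M" for t
  proof -
    have "t \<in> {-M..M}" using that by (simp add: abs_le_iff)
    from Q(2)[OF this] show ?thesis by (simp add: abs_minus_commute)
  qed
  have b1: "\<bar>P' t - u' t\<bar> \<le> \<delta> / M\<^sup>2 * \<bar>t\<bar> ^ Suc 0" if "\<bar>t\<bar> \<le> M" for t
    using DERIV_power_bound[of "\<lambda>t. P' t - u' t" "\<lambda>t. Q t - u'' t", OF _ DERIV_diff[OF dP' u'] b2 that]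
    by (simp add: P'_def)
  have b0: "\<bar>P t - u t\<bar> \<le> \<delta> / M\<^sup>2 * \<bar>t\<bar> ^ Suc (Suc 0) / real (Suc (Suc 0))" if "\<bar>t\<bar> \<le> M" for t
    using DERIV_power_bound[of "\<lambda>t. P t - u t" "\<lambda>t. P' t - u' t", OF _ DERIV_diff[OF dP u] b1 that]
    by (simp add: P_def)
  show ?thesis
  proof (rule that[OF dP dP'])
    show "smooth1 (\<lambda>t. complex_of_real (P t))"
      by (rule smooth1_I[OF of_real_has_vector_derivative[OF dP]],
          rule smooth1_I[OF of_real_has_vector_derivative[OF dP']], rule smooth1_real_polynomial[OF Q(1)])
    fix t assume t: "\<bar>t\<bar> \<le> M"
    have "1 \<le> M\<^sup>2" using \<open>M \<ge> 1\<close> by (simp add: one_le_power)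
    have "M \<le> M\<^sup>2" using \<open>M \<ge> 1\<close> by (simp add: power2_eq_square)
    have le: "\<delta> / M\<^sup>2 * x \<le> \<delta>" if "x \<le> M\<^sup>2" for x
    proof -
      have "\<delta> / M\<^sup>2 * x \<le> \<delta> / M\<^sup>2 * M\<^sup>2" using that assms by (intro mult_left_mono) auto
      then show ?thesis using \<open>M \<ge> 1\<close> by simp
    qed
    have "t\<^sup>2 \<le> M\<^sup>2" using t abs_le_square_iff[of t M] \<open>M \<ge> 1\<close> by simp
    then have "\<bar>t\<bar> ^ Suc (Suc 0) \<le> M\<^sup>2" by (simp add: power2_eq_square)
    moreover have "\<delta> / M\<^sup>2 * \<bar>t\<bar> ^ Suc (Suc 0) / real (Suc (Suc 0)) \<le> \<delta> / M\<^sup>2 * \<bar>t\<bar> ^ Suc (Suc 0)"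
      using \<open>\<delta> > 0\<close> by (intro divide_left_mono[of 1, simplified]) auto
    ultimately have "\<bar>P t - u t\<bar> \<le> \<delta>" using b0[OF t] le by force
    moreover have "\<bar>P' t - u' t\<bar> \<le> \<delta>"
      using b1[OF t] le[of "\<bar>t\<bar> ^ Suc 0"] t \<open>M \<le> M\<^sup>2\<close> by force
    moreover have "\<bar>Q t - u'' t\<bar> \<le> \<delta>"
      using b2[OF t] le[of "\<bar>t\<bar> ^ 0"] \<open>1 \<le> M\<^sup>2\<close> by force
    ultimately show "\<bar>P t - u t\<bar> \<le> \<delta> \<and> \<bar>P' t - u' t\<bar> \<le> \<delta> \<and> \<bar>Q t - u'' t\<bar> \<le> \<delta>" by blast
  qed
qed

text \<open>One factor 1 + t^2 absorbs the multipliers 1 + t^2, |t| and t^2 of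
  \<open>near_ground_state\<close>, the other provides its decay 1 / (1 + t^2), and 1 + |t|^p comes
  from the potential.\<close>

lemma poly_weight_exp_bounded:
  assumes "p \<ge> (0::real)"
  obtains K where "K > 0" "\<And>t. (1 + t\<^sup>2)\<^sup>2 * (1 + \<bar>t\<bar> powr p) * exp (- \<bar>t\<bar>) \<le> K"
proof -
  define N where "N = nat \<lceil>p\<rceil>"
  define K where "K = 2 * fact (N + 4) * exp (1::real)"
  show ?thesis
  proof (rule that[of K])
    show "K > 0" by (simp add: K_def)
    fix t :: real
    define x where "x = 1 + \<bar>t\<bar>"
    have "x \<ge> 1" by (simp add: x_def)
    have "\<bar>t\<bar> powr p \<le> x powr p" using assms by (intro powr_mono2) (auto simp: x_def)
    also have "\<dots> \<le> x powr (real N)" using \<open>x \<ge> 1\<close> by (intro powr_mono) (auto simp: N_def real_nat_ceiling_ge)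
    also have "\<dots> = x ^ N" using \<open>x \<ge> 1\<close> by (simp add: powr_realpow)
    finally have "1 + \<bar>t\<bar> powr p \<le> 2 * x ^ N" using one_le_power[OF \<open>x \<ge> 1\<close>, of N] by simp
    moreover have "(1 + t\<^sup>2)\<^sup>2 \<le> (x\<^sup>2)\<^sup>2"
      by (intro power_mono) (auto simp: x_def power2_eq_square algebra_simps)
    ultimately have "(1 + t\<^sup>2)\<^sup>2 * (1 + \<bar>t\<bar> powr p) \<le> (x\<^sup>2)\<^sup>2 * (2 * x ^ N)"
      by (intro mult_mono) (auto simp: add_nonneg_nonneg)
    also have "\<dots> = 2 * x ^ (N + 4)" by (simp add: power_add power_mult[symmetric] mult_ac)
    also have "\<dots> \<le> 2 * (fact (N + 4) * exp x)"
      using power_le_fact_exp[of x "N + 4"] \<open>x \<ge> 1\<close> by simp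
    finally have "(1 + t\<^sup>2)\<^sup>2 * (1 + \<bar>t\<bar> powr p) * exp (- \<bar>t\<bar>) \<le> 2 * (fact (N + 4) * exp x) * exp (- \<bar>t\<bar>)"
      by (intro mult_right_mono) auto
    also have "\<dots> = K"
      by (simp add: K_def x_def exp_add exp_minus field_simps del: fact_Suc)
    finally show "(1 + t\<^sup>2)\<^sup>2 * (1 + \<bar>t\<bar> powr p) * exp (- \<bar>t\<bar>) \<le> K" .
  qed
qed

lemma smooth1_lipschitz:
  assumes "smooth1 f" "\<And>t. norm (vd f t) \<le> D"
  shows "norm (f x - f y) \<le> D * \<bar>x - y\<bar>"
proof -
  have "norm (f x - f y) \<le> D * norm (x - y)"
  proof (rule differentiable_bound[of UNIV f "\<lambda>t h. h *\<^sub>R vd f t"])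
    show "onorm (\<lambda>h. h *\<^sub>R vd f t) \<le> D" for t
      using assms(2)[of t] by (intro onorm_le) (simp add: mult.commute[of D] mult_left_mono)
  qed (use smooth1_has_vd[OF assms(1)] in \<open>auto simp: has_vector_derivative_def\<close>)
  then show ?thesis by simp
qed

text \<open>Below, \<open>K\<close> is fixed before \<open>\<epsilon>\<close>.\<close>

definition near_ground_state ::
    "real \<Rightarrow> real \<Rightarrow> (real \<Rightarrow> real) \<Rightarrow> real \<Rightarrow> real \<Rightarrow> (real \<Rightarrow> complex) \<Rightarrow> bool" where
  "near_ground_state p l u K \<epsilon> h \<longleftrightarrow> (\<forall>t.
      (1 + t\<^sup>2) * norm (h t) \<le> K / (1 + t\<^sup>2) \<and>
      \<bar>t\<bar> * norm (vd h t) \<le> K / (1 + t\<^sup>2) \<and>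
      t\<^sup>2 * norm (vd (vd h) t) \<le> K / (1 + t\<^sup>2) \<and>
      \<bar>t\<bar> powr p * norm (h t) \<le> K / (1 + t\<^sup>2) \<and>
      norm (Hop p h t - complex_of_real l * h t) \<le> \<epsilon> / (1 + t\<^sup>2) \<and>
      norm (h t - complex_of_real (u t)) \<le> \<epsilon> / (1 + t\<^sup>2))"

text \<open>h is \<theta>(\<eta> t) times a smooth function close to u on the support of the cutoff.
  Each derivative of the cutoff brings a factor \<eta>, so the defect of h is O(\<eta>), while the
  size and decay of h are governed by those of u whatever \<eta> \<le> 1 is.\<close>

lemma approx_ground_state:
  fixes p l C :: real and u u' :: "real \<Rightarrow> real"
  assumes p: "p \<ge> 1" and C: "C > 0"
    and u: "\<And>t. (u has_real_derivative u' t) (at t)"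
    and u': "\<And>t. (u' has_real_derivative (\<bar>t\<bar> powr p - l) * u t) (at t)"
    and ub: "\<And>t. \<bar>u t\<bar> \<le> C * exp (- \<bar>t\<bar>)" and u'b: "\<And>t. \<bar>u' t\<bar> \<le> C * exp (- \<bar>t\<bar>)"
  shows "\<exists>K>0. \<forall>\<epsilon>>0. \<exists>h\<in>C0inf1. near_ground_state p l u K \<epsilon> h"
proof -
  obtain \<theta> :: "real \<Rightarrow> complex" and D where \<theta>: "smooth1 \<theta>" "\<theta> 0 = 1" "D \<ge> 1"
    "\<And>t. 1 < \<bar>t\<bar> \<Longrightarrow> \<theta> t = 0"
    "\<And>t. norm (\<theta> t) \<le> D" "\<And>t. norm (vd \<theta> t) \<le> D" "\<And>t. norm (vd (vd \<theta>) t) \<le> D"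
    using cutoff_exists by blast
  obtain K0 where K0: "K0 > 0" "\<And>t. (1 + t\<^sup>2)\<^sup>2 * (1 + \<bar>t\<bar> powr p) * exp (- \<bar>t\<bar>) \<le> K0"
    using poly_weight_exp_bounded[of p] p by auto
  \<comment> \<open>D bounds the cutoff, C + 1 the approximant relative to exp(-|t|), and 1 + |l|
    turns 1 + |t|^p + |l| into a multiple of 1 + |t|^p. The 4 counts the contributions 1 + 2 + 1 to
    the defect of h.\<close>
  define A where "A = 4 * D * (C + 1) * (1 + \<bar>l\<bar>)"
  have A: "A > 0" using \<theta>(3) C by (simp add: A_def add_pos_nonneg)
  define R where "R t = (1 + \<bar>t\<bar> powr p) * exp (- \<bar>t\<bar>)" for t
  have R: "exp (- \<bar>t\<bar>) \<le> R t" "R t \<ge> 0" for t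
    by (auto simp: R_def add_nonneg_nonneg algebra_simps)
  have weight: "w * (B * R t) \<le> B * K0 / (1 + t\<^sup>2)" if "w \<le> 1 + t\<^sup>2" "B \<ge> 0" for w t B
  proof -
    have "(1 + t\<^sup>2) * (w * (B * R t)) \<le> (1 + t\<^sup>2) * ((1 + t\<^sup>2) * (B * R t))"
      using that R by (intro mult_left_mono mult_right_mono mult_nonneg_nonneg) auto
    also have "\<dots> = B * ((1 + t\<^sup>2)\<^sup>2 * (1 + \<bar>t\<bar> powr p) * exp (- \<bar>t\<bar>))"
      by (simp add: R_def power2_eq_square algebra_simps)
    also have "\<dots> \<le> B * K0" using that K0 by (intro mult_left_mono) auto
    finally show ?thesis by (simp add: field_simps add_pos_nonneg)
  qed
  have tabs: "\<bar>t\<bar> \<le> 1 + t\<^sup>2" for t :: real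
    using sum_squares_bound[of 1 "\<bar>t\<bar>"] by simp
  have "\<exists>h \<in> C0inf1. \<forall>t.
      (1 + t\<^sup>2) * norm (h t) \<le> (2 * A * K0) / (1 + t\<^sup>2) \<and>
      \<bar>t\<bar> * norm (vd h t) \<le> (2 * A * K0) / (1 + t\<^sup>2) \<and>
      t\<^sup>2 * norm (vd (vd h) t) \<le> (2 * A * K0) / (1 + t\<^sup>2) \<and>
      \<bar>t\<bar> powr p * norm (h t) \<le> (2 * A * K0) / (1 + t\<^sup>2) \<and>
      norm (Hop p h t - complex_of_real l * h t) \<le> \<epsilon> / (1 + t\<^sup>2) \<and>
      norm (h t - complex_of_real (u t)) \<le> \<epsilon> / (1 + t\<^sup>2)" if \<epsilon>: "\<epsilon> > 0" for \<epsilon>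
  proof -
    \<comment> \<open>The defect will be at most 2 \<eta> A K0 / (1 + t^2), which this choice makes
      at most \<epsilon> / (1 + t^2).\<close>
    define \<eta> where "\<eta> = min 1 (\<epsilon> / (2 * A * K0))"
    have \<eta>: "\<eta> > 0" "\<eta> \<le> 1" using \<epsilon> A K0 by (auto simp: \<eta>_def)
    have "\<eta> \<le> \<epsilon> / (2 * A * K0)" by (simp add: \<eta>_def)
    then have \<eta>\<epsilon>: "2 * \<eta> * A * K0 \<le> \<epsilon>" using A K0 by (simp add: field_simps)
    define M where "M = 1 / \<eta>"
    have M: "M \<ge> 1" "1 / M = \<eta>" using \<eta> by (auto simp: M_def)
    have "continuous_on UNIV (\<lambda>t. (\<bar>t\<bar> powr p - l) * u t)"
      using p by (intro continuous_intros continuous_on_abs_powr continuous_on_DERIV[OF u]) auto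
    \<comment> \<open>The precision includes exp(-M) so that on |t| \<le> M the error is below
      \<eta> exp(-|t|) and the approximant inherits the decay of u.\<close>
    from smooth_C2_approx[OF u u' this M(1), of "\<eta> * exp (- M)"] \<eta>
    obtain P P' P'' where dP: "\<And>t. (P has_real_derivative P' t) (at t)"
      and dP': "\<And>t. (P' has_real_derivative P'' t) (at t)"
      and sP: "smooth1 (\<lambda>t. complex_of_real (P t))"
      and close: "\<And>t. \<bar>t\<bar> \<le> M \<Longrightarrow> \<bar>P t - u t\<bar> \<le> \<eta> * exp (- M) \<and> \<bar>P' t - u' t\<bar> \<le> \<eta> * exp (- M)
        \<and> \<bar>P'' t - (\<bar>t\<bar> powr p - l) * u t\<bar> \<le> \<eta> * exp (- M)"
      by (metis exp_gt_zero mult_pos_pos)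
    have vP: "vd (\<lambda>t. complex_of_real (P t)) = (\<lambda>t. complex_of_real (P' t))"
      by (rule vd_eqI[OF of_real_has_vector_derivative[OF dP]])
    have vP': "vd (\<lambda>t. complex_of_real (P' t)) = (\<lambda>t. complex_of_real (P'' t))"
      by (rule vd_eqI[OF of_real_has_vector_derivative[OF dP']])
    have sP': "smooth1 (\<lambda>t. complex_of_real (P' t))" using smooth1_vd[OF sP] vP by simp
    define T where "T t = \<theta> (\<eta> * t + 0)" for t
    have sT: "smooth1 T" unfolding T_def by (rule smooth1_affine[OF \<theta>(1)])
    have vT: "vd T = (\<lambda>t. complex_of_real \<eta> * vd \<theta> (\<eta> * t + 0))"
      unfolding T_def by (rule vd_affine[OF \<theta>(1)])
    have vvT: "vd (vd T) = (\<lambda>t. complex_of_real \<eta> * (complex_of_real \<eta> * vd (vd \<theta>) (\<eta> * t + 0)))"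
      unfolding vT
      using vd_mult[OF smooth1_const[of "complex_of_real \<eta>"] smooth1_affine[OF smooth1_vd[OF \<theta>(1)], of \<eta> 0]]
        vd_affine[OF smooth1_vd[OF \<theta>(1)], of \<eta> 0] by simp
    have T0: "T t = 0" "vd T t = 0" "vd (vd T) t = 0" if "M < \<bar>t\<bar>" for t
    proof -
      have T: "T t = 0" if "M < \<bar>t - 0\<bar>" for t
        using that \<eta> unfolding T_def by (intro \<theta>(4)) (auto simp: M_def field_simps abs_mult)
      have vT: "vd T t = 0" if "M < \<bar>t - 0\<bar>" for t
        by (rule vd_zero_outside[OF T that])
      have "vd (vd T) t = 0" if "M < \<bar>t - 0\<bar>" for t
        by (rule vd_zero_outside[OF vT that])
      then show "T t = 0" "vd T t = 0" "vd (vd T) t = 0" using T vT that by auto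
    qed
    have Tb: "norm (T t) \<le> D" "norm (vd T t) \<le> \<eta> * D" "norm (vd (vd T) t) \<le> \<eta> * D" for t
    proof -
      show "norm (T t) \<le> D" by (simp add: T_def \<theta>)
      show "norm (vd T t) \<le> \<eta> * D" using \<eta> by (simp add: vT norm_mult \<theta>)
      have "\<eta> * (\<eta> * norm (vd (vd \<theta>) (\<eta> * t + 0))) \<le> \<eta> * (1 * D)"
        using \<eta> by (intro mult_left_mono mult_mono \<theta>) auto
      then show "norm (vd (vd T) t) \<le> \<eta> * D" using \<eta> by (simp add: vvT norm_mult)
    qed
    define h where "h t = T t * complex_of_real (P t)" for t
    have sh: "smooth1 h" unfolding h_def by (intro smooth1_mult sT sP)
    have vh: "vd h = (\<lambda>t. T t * complex_of_real (P' t) + vd T t * complex_of_real (P t))"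
      unfolding h_def using vd_mult[OF sT sP] vP by simp
    have vvh: "vd (vd h) = (\<lambda>t. T t * complex_of_real (P'' t) + 2 * vd T t * complex_of_real (P' t) + vd (vd T) t * complex_of_real (P t))"
      unfolding vh using vd_add[OF smooth1_mult[OF sT sP'] smooth1_mult[OF smooth1_vd[OF sT] sP]]
        vd_mult[OF sT sP'] vd_mult[OF smooth1_vd[OF sT] sP] vP vP' by (simp add: algebra_simps)
    have hC: "h \<in> C0inf1"
    proof -
      have "compact (tsupport h)"
        by (rule compact_tsupport[where K = "{-M..M}"]) (use T0 in \<open>auto simp: h_def abs_le_iff not_le\<close>)
      then show ?thesis using sh by (simp add: C0inf1_def)
    qed
    \<comment> \<open>The first bound has no potential factor because it will still be multiplied by
      |t|^p. The factor 1 + |t| in the last one stems from |\<theta>(\<eta> t) - 1| \<le> D \<eta>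
      |t|.\<close>
    have main: "norm (h t) \<le> A * exp (- \<bar>t\<bar>) \<and> norm (h t) \<le> A * R t \<and> norm (vd h t) \<le> A * R t \<and> norm (vd (vd h) t) \<le> 2 * A * R t \<and>
        norm (Hop p h t - complex_of_real l * h t) \<le> 2 * \<eta> * A * R t \<and>
        norm (h t - complex_of_real (u t)) \<le> (1 + \<bar>t\<bar>) * (\<eta> * A * R t)" for t
    proof (cases "M < \<bar>t\<bar>")
      case True
      \<comment> \<open>Here h vanishes and only u is left in h - u; the small factor is gained from
        1 < \<eta> |t|.\<close>
      have "norm (complex_of_real (u t)) \<le> C * exp (- \<bar>t\<bar>)" using ub by simp
      also have "\<dots> \<le> A * R t"
      proof -
        have "C * 1 \<le> (C + 1) * (4 * D * (1 + \<bar>l\<bar>))"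
          using C \<theta>(3) mult_mono[of 1 "4 * D" 1 "1 + \<bar>l\<bar>"] by (intro mult_mono) auto
        then have "C \<le> A" by (simp only: A_def mult_ac mult_1)
        then show ?thesis using R(1)[of t] A by (intro mult_mono) auto
      qed
      also have "\<dots> \<le> (\<eta> * \<bar>t\<bar>) * (A * R t)"
      proof -
        have "1 \<le> \<eta> * \<bar>t\<bar>" using True \<eta> by (simp add: M_def field_simps)
        then show ?thesis using mult_right_mono[of 1 "\<eta> * \<bar>t\<bar>" "A * R t"] A R(2)[of t] by simp
      qed
      also have "\<dots> \<le> (1 + \<bar>t\<bar>) * (\<eta> * A * R t)"
        using A R(2)[of t] \<eta> by (simp add: algebra_simps)
      finally show ?thesis
        using T0[OF True] A R(2)[of t] \<eta> by (simp add: vvh h_def Hop_def) (simp add: vh)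
    next
      case False
      then have t: "\<bar>t\<bar> \<le> M" by simp
      define E where "E = exp (- \<bar>t\<bar>)"
      have E: "E > 0" by (simp add: E_def)
      define k where "k = (1 + \<bar>l\<bar>) * (1 + \<bar>t\<bar> powr p)"
      have "\<bar>t\<bar> powr p \<ge> 0" by simp
      then have k: "k \<ge> 1" "1 + \<bar>t\<bar> powr p + \<bar>l\<bar> \<le> k"
        by (simp_all add: k_def algebra_simps)
      have AR: "A * R t = 4 * (D * ((C + 1) * (k * E)))" by (simp add: A_def R_def k_def E_def)
      have eM: "\<eta> * exp (- M) \<le> \<eta> * E" using t \<eta> by (simp add: E_def)
      then have c0: "\<bar>P t - u t\<bar> \<le> \<eta> * E" and c1: "\<bar>P' t - u' t\<bar> \<le> \<eta> * E"
        and c2: "\<bar>P'' t - (\<bar>t\<bar> powr p - l) * u t\<bar> \<le> \<eta> * E"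
        using close[OF t] by auto
      have \<eta>E: "\<eta> * E \<le> 1 * E" using \<eta> E by (intro mult_right_mono) auto
      have V: "\<bar>\<bar>t\<bar> powr p - l\<bar> \<le> \<bar>t\<bar> powr p + \<bar>l\<bar>" by (simp add: abs_le_iff abs_if add_increasing)
      have P0: "\<bar>P t\<bar> \<le> (C + 1) * E"
        using c0 ub[of t] \<eta>E unfolding E_def[symmetric] distrib_right by linarith
      have P1: "\<bar>P' t\<bar> \<le> (C + 1) * E"
        using c1 u'b[of t] \<eta>E unfolding E_def[symmetric] distrib_right by linarith
      have P2: "\<bar>P'' t\<bar> \<le> (C + 1) * (k * E)"
      proof -
        have "\<bar>(\<bar>t\<bar> powr p - l) * u t\<bar> \<le> (\<bar>t\<bar> powr p + \<bar>l\<bar>) * (C * E)"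
          unfolding abs_mult using V ub[of t] by (intro mult_mono) (auto simp: E_def)
        then have "\<bar>P'' t\<bar> \<le> (\<bar>t\<bar> powr p + \<bar>l\<bar>) * (C * E) + 1 * E" using c2 \<eta>E by linarith
        also have "\<dots> \<le> k * (C * E) + k * E"
          using k E C \<open>\<bar>t\<bar> powr p \<ge> 0\<close> by (intro add_mono mult_right_mono) (auto simp: less_imp_le)
        finally show ?thesis by (simp add: algebra_simps)
      qed
      have kE: "(C + 1) * E \<le> (C + 1) * (k * E)" using k E C by simp
      define X where "X = (C + 1) * (k * E)"
      have X: "X \<ge> 0" "(C + 1) * E \<le> X" using kE E C k by (auto simp: X_def)
      have D0: "D \<ge> 0" using \<theta>(3) by simp
      have nT: "norm (T t * complex_of_real a) \<le> D * X" "norm (vd T t * complex_of_real a) \<le> \<eta> * (D * X)"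
          "norm (vd (vd T) t * complex_of_real a) \<le> \<eta> * (D * X)" if "\<bar>a\<bar> \<le> X" for a
      proof -
        show "norm (T t * complex_of_real a) \<le> D * X"
          using mult_mono[OF Tb(1)[of t] that D0] by (simp add: norm_mult)
        show "norm (vd T t * complex_of_real a) \<le> \<eta> * (D * X)"
          using mult_mono[OF Tb(2)[of t] that] D0 \<eta> by (simp add: norm_mult mult.assoc)
        show "norm (vd (vd T) t * complex_of_real a) \<le> \<eta> * (D * X)"
          using mult_mono[OF Tb(3)[of t] that] D0 \<eta> by (simp add: norm_mult mult.assoc)
      qed
      have PX: "\<bar>P t\<bar> \<le> X" "\<bar>P' t\<bar> \<le> X" "\<bar>P'' t\<bar> \<le> X" using P0 P1 P2 X by (auto simp: X_def)
      have DX: "0 \<le> D * X" "\<eta> * (D * X) \<le> D * X" using D0 X \<eta> by (auto simp: mult_left_le_one_le)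
      have ARX: "A * R t = 4 * (D * X)" by (simp add: AR X_def)
      have 1: "norm (h t) \<le> A * R t"
        using nT(1)[OF PX(1)] DX by (simp add: h_def ARX)
      have 2: "norm (vd h t) \<le> A * R t"
        using norm_triangle_ineq[of "T t * complex_of_real (P' t)" "vd T t * complex_of_real (P t)"]
          nT(1)[OF PX(2)] nT(2)[OF PX(1)] DX unfolding ARX vh by linarith
      have r: "norm (2 * vd T t * complex_of_real (P' t)) \<le> 2 * (\<eta> * (D * X))"
        using nT(2)[OF PX(2)] by (simp add: norm_mult mult.assoc)
      have 3: "norm (vd (vd h) t) \<le> 2 * A * R t"
        using norm_triangle_ineq[of "T t * complex_of_real (P'' t) + 2 * vd T t * complex_of_real (P' t)" "vd (vd T) t * complex_of_real (P t)"]
          norm_triangle_ineq[of "T t * complex_of_real (P'' t)" "2 * vd T t * complex_of_real (P' t)"]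
          nT(1)[OF PX(3)] nT(3)[OF PX(1)] r DX ARX unfolding vvh mult.assoc[of 2] by linarith
      define Z where "Z = - P'' t + (\<bar>t\<bar> powr p - l) * P t"
      have Zb: "\<bar>Z\<bar> \<le> \<eta> * (k * E)"
      proof -
        have "\<bar>(\<bar>t\<bar> powr p - l) * (P t - u t)\<bar> \<le> (\<bar>t\<bar> powr p + \<bar>l\<bar>) * (\<eta> * E)"
          unfolding abs_mult using V c0 \<open>\<bar>t\<bar> powr p \<ge> 0\<close> by (intro mult_mono) auto
        moreover have "Z = (\<bar>t\<bar> powr p - l) * (P t - u t) - (P'' t - (\<bar>t\<bar> powr p - l) * u t)"
          by (simp add: Z_def algebra_simps)
        ultimately have "\<bar>Z\<bar> \<le> (\<bar>t\<bar> powr p + \<bar>l\<bar>) * (\<eta> * E) + \<eta> * E" using c2 by linarith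
        also have "\<dots> = (1 + \<bar>t\<bar> powr p + \<bar>l\<bar>) * (\<eta> * E)" by (simp add: algebra_simps)
        also have "\<dots> \<le> k * (\<eta> * E)" using k E \<eta> by (intro mult_right_mono) auto
        finally show ?thesis by (simp add: mult_ac)
      qed
      have ZX: "norm (T t * complex_of_real Z) \<le> \<eta> * (D * X)"
      proof -
        have "k * E \<le> X" using C k E by (simp add: X_def)
        then have "\<eta> * (k * E) \<le> \<eta> * X" using \<eta> by simp
        then have "\<bar>Z\<bar> \<le> \<eta> * X" using Zb by linarith
        from mult_mono[OF Tb(1)[of t] this D0] show ?thesis by (simp add: norm_mult mult_ac)
      qed
      have "Hop p h t - complex_of_real l * h t = T t * complex_of_real Z - 2 * vd T t * complex_of_real (P' t) - vd (vd T) t * complex_of_real (P t)"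
        by (simp add: Hop_def vvh h_def Z_def algebra_simps)
      then have "norm (Hop p h t - complex_of_real l * h t) \<le> \<eta> * (D * X) + 2 * (\<eta> * (D * X)) + \<eta> * (D * X)"
        using norm_triangle_ineq4[of "T t * complex_of_real Z - 2 * vd T t * complex_of_real (P' t)" "vd (vd T) t * complex_of_real (P t)"]
          norm_triangle_ineq4[of "T t * complex_of_real Z" "2 * vd T t * complex_of_real (P' t)"]
          ZX r nT(3)[OF PX(1)] by (simp only:)
      also have "\<dots> = \<eta> * (A * R t)" by (simp add: ARX)
      also have "\<dots> \<le> 2 * \<eta> * A * R t" using A R(2)[of t] \<eta> by (simp add: mult.assoc)
      finally have 4: "norm (Hop p h t - complex_of_real l * h t) \<le> 2 * \<eta> * A * R t" .
      have "norm (T t - 1) \<le> D * (\<eta> * \<bar>t\<bar>)"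
        using smooth1_lipschitz[OF \<theta>(1) \<theta>(6), of "\<eta> * t" 0] \<theta>(2) \<eta> by (simp add: T_def abs_mult)
      moreover have uX: "\<bar>u t\<bar> \<le> X"
        using ub[of t] X(2) E unfolding E_def[symmetric] distrib_right by linarith
      ultimately have a: "norm ((T t - 1) * complex_of_real (u t)) \<le> D * (\<eta> * \<bar>t\<bar>) * X"
        unfolding norm_mult using uX D0 \<eta> by (intro mult_mono) auto
      have b: "norm (T t * complex_of_real (P t - u t)) \<le> D * (\<eta> * X)"
      proof -
        have "1 * E \<le> (C + 1) * E" using C E by (intro mult_right_mono) auto
        then have "\<eta> * E \<le> \<eta> * X" using \<eta> X by simp
        then show ?thesis unfolding norm_mult norm_of_real using c0 D0 Tb(1)[of t] by (intro mult_mono) auto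
      qed
      have "h t - complex_of_real (u t) = T t * complex_of_real (P t - u t) + (T t - 1) * complex_of_real (u t)"
        by (simp add: h_def algebra_simps)
      then have "norm (h t - complex_of_real (u t)) \<le> D * (\<eta> * X) + D * (\<eta> * \<bar>t\<bar>) * X"
        using norm_triangle_ineq[of "T t * complex_of_real (P t - u t)" "(T t - 1) * complex_of_real (u t)"] a b by simp
      also have "\<dots> = (1 + \<bar>t\<bar>) * (\<eta> * (D * X))" by (simp add: algebra_simps)
      also have "\<dots> \<le> (1 + \<bar>t\<bar>) * (\<eta> * (4 * (D * X)))"
        using DX \<eta> by (intro mult_left_mono) auto
      finally have 5: "norm (h t - complex_of_real (u t)) \<le> (1 + \<bar>t\<bar>) * (\<eta> * A * R t)"
        by (simp add: ARX mult.assoc)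
      have "norm (h t) \<le> D * ((C + 1) * E)"
        using mult_mono[OF Tb(1)[of t] P0 D0] by (simp add: h_def norm_mult)
      also have "\<dots> \<le> (1 + \<bar>l\<bar>) * 4 * (D * ((C + 1) * E))"
        using D0 C E mult_right_mono[of 1 "(1 + \<bar>l\<bar>) * 4" "D * ((C + 1) * E)"] by simp
      finally have 0: "norm (h t) \<le> A * exp (- \<bar>t\<bar>)"
        by (simp only: A_def E_def mult_ac)
      show ?thesis using 0 1 2 3 4 5 by blast
    qed
    show ?thesis
    proof (intro bexI[OF _ hC] allI conjI)
      fix t
      note m = main[of t]
      have AA: "A * R t \<le> 2 * A * R t" using A R(2)[of t] by simp
      have le: "w * b \<le> (B * K0) / (1 + t\<^sup>2)" if "b \<le> B * R t" "0 \<le> w" "w \<le> 1 + t\<^sup>2" "B \<ge> 0" for w b B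
        using weight[OF that(3,4)] mult_left_mono[OF that(1,2)] by (rule order_trans[rotated])
      have mm: "norm (h t) \<le> 2 * A * R t" "norm (vd h t) \<le> 2 * A * R t" "norm (vd (vd h) t) \<le> 2 * A * R t"
        using m AA by linarith+
      show "(1 + t\<^sup>2) * norm (h t) \<le> (2 * A * K0) / (1 + t\<^sup>2)"
        by (rule le[OF mm(1)]) (use A in auto)
      show "\<bar>t\<bar> * norm (vd h t) \<le> (2 * A * K0) / (1 + t\<^sup>2)"
        by (rule le[OF mm(2)]) (use A tabs in auto)
      show "t\<^sup>2 * norm (vd (vd h) t) \<le> (2 * A * K0) / (1 + t\<^sup>2)"
        by (rule le[OF mm(3)]) (use A in auto)
      have "\<bar>t\<bar> powr p * norm (h t) \<le> \<bar>t\<bar> powr p * (A * exp (- \<bar>t\<bar>))"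
        using m by (intro mult_left_mono) auto
      also have "\<dots> \<le> A * R t" using A by (simp add: R_def algebra_simps)
      also have "\<dots> \<le> 2 * A * R t" by (rule AA)
      finally have "1 * (\<bar>t\<bar> powr p * norm (h t)) \<le> (2 * A * K0) / (1 + t\<^sup>2)"
        by (intro le) (use A in auto)
      then show "\<bar>t\<bar> powr p * norm (h t) \<le> (2 * A * K0) / (1 + t\<^sup>2)" by simp
      have e: "2 * \<eta> * A * K0 / (1 + t\<^sup>2) \<le> \<epsilon> / (1 + t\<^sup>2)"
        using \<eta>\<epsilon> by (intro divide_right_mono) auto
      have "1 * norm (Hop p h t - complex_of_real l * h t) \<le> (2 * \<eta> * A * K0) / (1 + t\<^sup>2)"
        by (rule le) (use m A \<eta> in auto)
      then show "norm (Hop p h t - complex_of_real l * h t) \<le> \<epsilon> / (1 + t\<^sup>2)" using e by simp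
      \<comment> \<open>Halving the weight compensates for doubling the bound, so that
        \<open>le\<close> applies with the same B as for the defect.\<close>
      have "(1 + \<bar>t\<bar>) / 2 * (2 * \<eta> * A * R t) \<le> (2 * \<eta> * A * K0) / (1 + t\<^sup>2)"
      proof (rule le[OF order_refl])
        have "(1 + a) / 2 \<le> 1 + b" if "a \<le> 1 + b" "0 \<le> b" for a b :: real
          using that by simp
        from this[OF tabs zero_le_power2] show "(1 + \<bar>t\<bar>) / 2 \<le> 1 + t\<^sup>2" .
      qed (use A \<eta> in auto)
      then show "norm (h t - complex_of_real (u t)) \<le> \<epsilon> / (1 + t\<^sup>2)"
        using m e by (simp add: mult.assoc)
    qed
  qed
  then show ?thesis
    unfolding near_ground_state_def using A K0 by (intro exI[of _ "2 * A * K0"]) simp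
qed

section \<open>The lowest eigenvalue\<close>

lemma l2norm_sq: "(l2norm f)\<^sup>2 = (\<integral>x. (cmod (f x))\<^sup>2 \<partial>lborel)"
  by (simp add: l2norm_def)

lemma sq_int_dominated:
  assumes "f \<in> borel_measurable lborel" "integrable lborel g" "\<And>x. (cmod (f x))\<^sup>2 \<le> g x"
  shows "sq_int f" "(l2norm f)\<^sup>2 \<le> integral\<^sup>L lborel g"
proof -
  have "integrable lborel (\<lambda>x. (cmod (f x))\<^sup>2)"
    by (rule Bochner_Integration.integrable_bound[OF assms(2)])
      (use assms in \<open>auto intro!: AE_I2 order_trans[OF _ abs_ge_self]\<close>)
  then show "sq_int f" "(l2norm f)\<^sup>2 \<le> integral\<^sup>L lborel g"
    using assms by (auto simp: sq_int_def l2norm_sq intro!: integral_mono)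
qed

lemma cmod_add_sq: "(cmod (a + b))\<^sup>2 \<le> 2 * (cmod a)\<^sup>2 + 2 * (cmod b)\<^sup>2"
proof -
  have "(cmod (a + b))\<^sup>2 \<le> (cmod a + cmod b)\<^sup>2"
    by (intro power_mono norm_triangle_ineq) auto
  then show ?thesis
    using sum_squares_bound[of "cmod a" "cmod b"] by (simp add: power2_sum)
qed

text \<open>A squared triangle inequality with a factor 2; the loss is harmless where only
  convergence to 0 is at stake.\<close>

lemma sq_int_add:
  assumes "sq_int f" "sq_int g"
  shows "sq_int (\<lambda>x. f x + g x)"
    and "(l2norm (\<lambda>x. f x + g x))\<^sup>2 \<le> 2 * (l2norm f)\<^sup>2 + 2 * (l2norm g)\<^sup>2"
proof -
  have i: "integrable lborel (\<lambda>x. 2 * (cmod (f x))\<^sup>2 + 2 * (cmod (g x))\<^sup>2)"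
    using assms by (auto simp: sq_int_def)
  have m: "(\<lambda>x. f x + g x) \<in> borel_measurable lborel"
    using assms by (auto simp: sq_int_def)
  show "sq_int (\<lambda>x. f x + g x)" by (rule sq_int_dominated[OF m i cmod_add_sq])
  show "(l2norm (\<lambda>x. f x + g x))\<^sup>2 \<le> 2 * (l2norm f)\<^sup>2 + 2 * (l2norm g)\<^sup>2"
    using sq_int_dominated(2)[OF m i cmod_add_sq] assms by (simp add: l2norm_sq sq_int_def)
qed

lemma sq_int_cmult:
  assumes "sq_int f"
  shows "sq_int (\<lambda>x. c * f x)" "(l2norm (\<lambda>x. c * f x))\<^sup>2 = (cmod c)\<^sup>2 * (l2norm f)\<^sup>2"
  using assms by (auto simp: sq_int_def l2norm_sq norm_mult power_mult_distrib)

lemma sq_int_diff: "sq_int f \<Longrightarrow> sq_int g \<Longrightarrow> sq_int (\<lambda>x. f x - g x)"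
  using sq_int_add(1)[of f "\<lambda>x. - 1 * g x"] sq_int_cmult(1)[of g "- 1"] by simp

lemma l2norm_nonneg [simp]: "l2norm f \<ge> 0"
  by (simp add: l2norm_def)

lemma tendsto_zero_l2:
  "(\<lambda>n. (l2norm (f n))\<^sup>2) \<longlonglongrightarrow> 0 \<longleftrightarrow> (\<lambda>n. l2norm (f n)) \<longlonglongrightarrow> 0"
proof
  assume "(\<lambda>n. (l2norm (f n))\<^sup>2) \<longlonglongrightarrow> 0"
  from tendsto_real_sqrt[OF this] show "(\<lambda>n. l2norm (f n)) \<longlonglongrightarrow> 0" by simp
next
  assume "(\<lambda>n. l2norm (f n)) \<longlonglongrightarrow> 0"
  from tendsto_power[OF this, of 2] show "(\<lambda>n. (l2norm (f n))\<^sup>2) \<longlonglongrightarrow> 0" by simp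
qed

lemma integrable_lorentzian: "integrable lborel (\<lambda>t::real. 1 / (1 + t\<^sup>2))"
  using integrable_inverse_1_plus_square by (simp add: set_integrable_def divide_inverse)

lemma lorentzian_sq_le: "(1 / (1 + t\<^sup>2))\<^sup>2 \<le> 1 / (1 + (t::real)\<^sup>2)"
proof -
  have "1 / (1 + t\<^sup>2) \<le> 1" by (simp add: divide_le_eq add_pos_nonneg)
  moreover have "0 \<le> 1 / (1 + t\<^sup>2)" by (simp add: add_nonneg_nonneg)
  ultimately show ?thesis unfolding power2_eq_square[of "1 / _"] by (intro mult_left_le_one_le)
qed

lemma sq_int_lorentzian:
  fixes f :: "real \<Rightarrow> complex"
  assumes "f \<in> borel_measurable borel" "\<And>t. cmod (f t) \<le> B / (1 + t\<^sup>2)"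
  shows "sq_int f" "(l2norm f)\<^sup>2 \<le> B\<^sup>2 * (\<integral>t. 1 / (1 + t\<^sup>2) \<partial>lborel)"
proof -
  have "(cmod (f t))\<^sup>2 \<le> B\<^sup>2 * (1 / (1 + t\<^sup>2))" for t
  proof -
    have "(cmod (f t))\<^sup>2 \<le> (B / (1 + t\<^sup>2))\<^sup>2" by (intro power_mono assms) auto
    also have "\<dots> = B\<^sup>2 * (1 / (1 + t\<^sup>2))\<^sup>2" by (simp add: power_divide)
    also have "\<dots> \<le> B\<^sup>2 * (1 / (1 + t\<^sup>2))" by (intro mult_left_mono lorentzian_sq_le) auto
    finally show ?thesis .
  qed
  moreover have "f \<in> borel_measurable lborel" using assms(1) by simp
  ultimately have *: "sq_int f" "(l2norm f)\<^sup>2 \<le> (\<integral>t. B\<^sup>2 * (1 / (1 + t\<^sup>2)) \<partial>lborel)"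
    using sq_int_dominated[OF _ integrable_mult_right[OF integrable_lorentzian]] by blast+
  show "sq_int f" by (rule *)
  show "(l2norm f)\<^sup>2 \<le> B\<^sup>2 * (\<integral>t. 1 / (1 + t\<^sup>2) \<partial>lborel)"
    using *(2) by (simp only: integral_mult_right_zero)
qed

lemma integrable_compact_support:
  fixes f :: "'a::euclidean_space \<Rightarrow> 'b::{banach, second_countable_topology}"
  assumes "continuous_on UNIV f" "compact K" "\<And>x. x \<notin> K \<Longrightarrow> f x = 0"
  shows "integrable lborel f"
proof -
  have "integrable lborel (\<lambda>x. indicator K x *\<^sub>R f x)"
    using assms continuous_on_subset by (intro borel_integrable_compact) blast+
  also have "(\<lambda>x. indicator K x *\<^sub>R f x) = f"
    using assms(3) by (auto simp: fun_eq_iff indicator_def)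
  finally show ?thesis .
qed

section \<open>Test functions, the quadratic form of H_p - l, and the lowest eigenvalue\<close>

lemma C0inf1_support:
  assumes "\<phi> \<in> C0inf1"
  obtains B where "B > 0" "\<And>t. B < \<bar>t\<bar> \<Longrightarrow> \<phi> t = 0"
proof -
  have "bounded (tsupport \<phi>)" using assms compact_imp_bounded by (auto simp: C0inf1_def)
  then obtain B where B: "\<And>x. x \<in> tsupport \<phi> \<Longrightarrow> \<bar>x\<bar> \<le> B"
    by (auto simp: bounded_iff)
  have "\<phi> t = 0" if "max 1 B < \<bar>t\<bar>" for t
  proof (rule ccontr)
    assume "\<phi> t \<noteq> 0"
    then have "t \<in> tsupport \<phi>" using closure_subset by (force simp: tsupport_def)
    then show False using B that by force
  qed
  then show ?thesis using that[of "max 1 B"] by auto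
qed

lemma Hop_continuous:
  assumes "smooth1 \<phi>" "p \<ge> 1"
  shows "continuous_on A (Hop p \<phi>)"
  unfolding Hop_def using assms
  by (intro continuous_intros continuous_on_abs_powr smooth1_continuous smooth1_vd) auto

lemma Hop_support:
  assumes "\<And>t. B < \<bar>t\<bar> \<Longrightarrow> \<phi> t = 0" "B < \<bar>t\<bar>"
  shows "vd \<phi> t = 0" "Hop p \<phi> t = 0"
proof -
  have 1: "vd \<phi> t = 0" if "B < \<bar>t - 0\<bar>" for t
    by (rule vd_zero_outside[OF _ that]) (use assms(1) in auto)
  have "vd (vd \<phi>) t = 0" if "B < \<bar>t - 0\<bar>" for t
    by (rule vd_zero_outside[OF 1 that])
  then show "vd \<phi> t = 0" "Hop p \<phi> t = 0" using 1 assms by (auto simp: Hop_def)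
qed

lemma C0inf1_integrable:
  assumes \<phi>: "\<phi> \<in> C0inf1" and "p \<ge> 1"
  shows "sq_int \<phi>" "sq_int (Hop p \<phi>)"
    "integrable lborel (\<lambda>t. Re ((Hop p \<phi> t - complex_of_real l * \<phi> t) * cnj (\<phi> t)))"
proof -
  obtain B where B: "\<And>t. B < \<bar>t\<bar> \<Longrightarrow> \<phi> t = 0" using C0inf1_support[OF \<phi>] by metis
  have s: "smooth1 \<phi>" using \<phi> by (simp add: C0inf1_def)
  have B': "\<phi> t = 0" "Hop p \<phi> t = 0" if "t \<notin> {-B..B}" for t
  proof -
    have "B < \<bar>t\<bar>" using that by auto
    then show "\<phi> t = 0" "Hop p \<phi> t = 0" using B Hop_support(2)[OF B] by auto
  qed
  note c = smooth1_continuous[OF s] Hop_continuous[OF s \<open>p \<ge> 1\<close>]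
  have m: "f \<in> borel_measurable lborel" if "continuous_on UNIV f" for f :: "real \<Rightarrow> complex"
    using borel_measurable_continuous_onI[OF that] by simp
  show "sq_int \<phi>" unfolding sq_int_def
    by (intro conjI m c integrable_compact_support[where K = "{-B..B}"] continuous_intros) (use B' in auto)
  show "sq_int (Hop p \<phi>)" unfolding sq_int_def
    by (intro conjI m c integrable_compact_support[where K = "{-B..B}"] continuous_intros) (use B' in auto)
  show "integrable lborel (\<lambda>t. Re ((Hop p \<phi> t - complex_of_real l * \<phi> t) * cnj (\<phi> t)))"
    by (intro integrable_compact_support[where K = "{-B..B}"] continuous_intros c) (use B' in auto)
qed

text \<open>With $r = u'/u$ the integrand is $F' + |\phi' - r\phi|^2$ for a compactly supported $F$.\<close>

lemma Hop_form_nonneg: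
  fixes u u' :: "real \<Rightarrow> real"
  assumes p: "p \<ge> 1" and u: "\<And>t. (u has_real_derivative u' t) (at t)"
    and u': "\<And>t. (u' has_real_derivative (\<bar>t\<bar> powr p - l) * u t) (at t)"
    and pos: "\<And>t. u t > 0" and \<phi>: "\<phi> \<in> C0inf1"
  shows "0 \<le> (\<integral>t. Re ((Hop p \<phi> t - complex_of_real l * \<phi> t) * cnj (\<phi> t)) \<partial>lborel)"
proof -
  obtain B where "B > 0" and B: "\<And>t. B < \<bar>t\<bar> \<Longrightarrow> \<phi> t = 0" using C0inf1_support[OF \<phi>] by metis
  have s: "smooth1 \<phi>" using \<phi> by (simp add: C0inf1_def)
  define r where "r t = u' t / u t" for t
  \<comment> \<open>The Riccati equation of the logarithmic derivative. In the derivative of r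
    |\<phi>|^2 it yields the potential together with the -r^2 that completes the square.\<close>
  have r': "(r has_real_derivative (\<bar>t\<bar> powr p - l) - (r t)\<^sup>2) (at t)" for t
  proof -
    have "(r has_real_derivative ((\<bar>t\<bar> powr p - l) * u t * u t - u' t * u' t) / (u t * u t)) (at t)"
      unfolding r_def using pos[of t] by (intro DERIV_divide u u') auto
    moreover have "((\<bar>t\<bar> powr p - l) * u t * u t - u' t * u' t) / (u t * u t) = (\<bar>t\<bar> powr p - l) - (r t)\<^sup>2"
      using pos[of t] by (simp add: r_def field_simps power2_eq_square)
    ultimately show ?thesis by simp
  qed
  have dRe: "((\<lambda>t. Re (f t)) has_real_derivative Re (vd f t)) (at t)"
    and dIm: "((\<lambda>t. Im (f t)) has_real_derivative Im (vd f t)) (at t)" if "smooth1 f" for f t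
    using bounded_linear.has_vector_derivative[OF bounded_linear_Re smooth1_has_vd[OF that]]
      bounded_linear.has_vector_derivative[OF bounded_linear_Im smooth1_has_vd[OF that]]
    by (auto simp: has_real_derivative_iff_has_vector_derivative)
  define a where "a t = Re (\<phi> t)" for t
  define b where "b t = Im (\<phi> t)" for t
  define a1 where "a1 t = Re (vd \<phi> t)" for t
  define b1 where "b1 t = Im (vd \<phi> t)" for t
  define a2 where "a2 t = Re (vd (vd \<phi>) t)" for t
  define b2 where "b2 t = Im (vd (vd \<phi>) t)" for t
  have d: "(a has_real_derivative a1 t) (at t)" "(b has_real_derivative b1 t) (at t)"
    "(a1 has_real_derivative a2 t) (at t)" "(b1 has_real_derivative b2 t) (at t)" for t
    unfolding a_def b_def a1_def b1_def a2_def b2_def by (intro dRe dIm s smooth1_vd)+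
  define F where "F t = - (a1 t * a t + b1 t * b t) + r t * ((a t)\<^sup>2 + (b t)\<^sup>2)" for t
  define g where "g t = Re ((Hop p \<phi> t - complex_of_real l * \<phi> t) * cnj (\<phi> t))" for t
  define k where "k t = (a1 t - r t * a t)\<^sup>2 + (b1 t - r t * b t)\<^sup>2" for t
  have g: "g t = (- a2 t + (\<bar>t\<bar> powr p - l) * a t) * a t + (- b2 t + (\<bar>t\<bar> powr p - l) * b t) * b t" for t
    by (simp add: g_def Hop_def a_def b_def a2_def b2_def algebra_simps)
  have F: "(F has_real_derivative g t - k t) (at t)" for t
    unfolding F_def
    by (auto intro!: derivative_eq_intros d r' simp: g k_def power2_eq_square algebra_simps)
  have zero: "\<phi> t = 0" "vd \<phi> t = 0" "Hop p \<phi> t = 0" if "B < \<bar>t\<bar>" for t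
    using B[OF that] Hop_support[OF B that] by auto
  have "((\<lambda>t. g t - k t) has_integral (F (B + 1) - F (- (B + 1)))) {- (B + 1)..B + 1}"
    using \<open>B > 0\<close> F by (intro fundamental_theorem_of_calculus)
      (auto simp: has_real_derivative_iff_has_vector_derivative[symmetric] intro: has_field_derivative_at_within)
  moreover have "F (B + 1) - F (- (B + 1)) = 0"
    using \<open>B > 0\<close> zero[of "B + 1"] zero[of "- (B + 1)"] by (simp add: F_def a_def b_def)
  ultimately have 1: "((\<lambda>t. g t - k t) has_integral 0) {- (B + 1)..B + 1}" by simp
  have "integrable lborel g"
    using C0inf1_integrable(3)[OF \<phi> p] unfolding g_def .
  from has_integral_integral_lborel[OF this]
  have "((\<lambda>t. if t \<in> {- (B + 1)..B + 1} then g t else 0) has_integral integral\<^sup>L lborel g) UNIV"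
    by (rule has_integral_eq[rotated]) (use \<open>B > 0\<close> zero in \<open>auto simp: g_def\<close>)
  then have 2: "(g has_integral integral\<^sup>L lborel g) {- (B + 1)..B + 1}"
    unfolding has_integral_restrict_UNIV .
  have "0 \<le> integral\<^sup>L lborel g"
    by (rule has_integral_le[OF 1 2]) (simp add: k_def)
  then show ?thesis unfolding g_def .
qed

text \<open>With c = l - m the form inequality reads c |\<phi>|^2 \<le> Re (z * cnj \<phi>) after
  integration, where z = (H_p - m) \<phi>; a pointwise Young inequality weighted by c removes the
  mixed term. Being a norm estimate on test functions, it passes to the closure.\<close>

lemma Hop_lower_bound:
  fixes u u' :: "real \<Rightarrow> real"
  assumes p: "p \<ge> 1" and u: "\<And>t. (u has_real_derivative u' t) (at t)"
    and u': "\<And>t. (u' has_real_derivative (\<bar>t\<bar> powr p - l) * u t) (at t)"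
    and pos: "\<And>t. u t > 0" and \<phi>: "\<phi> \<in> C0inf1" and "m < l"
  shows "(l - m)\<^sup>2 * (l2norm \<phi>)\<^sup>2 \<le> (l2norm (\<lambda>t. Hop p \<phi> t - complex_of_real m * \<phi> t))\<^sup>2"
proof -
  define c where "c = l - m"
  have c: "c > 0" using assms by (simp add: c_def)
  define z where "z t = Hop p \<phi> t - complex_of_real m * \<phi> t" for t
  note i = C0inf1_integrable[OF \<phi> p]
  have zi: "sq_int z" unfolding z_def by (intro sq_int_diff sq_int_cmult i)
  have "0 \<le> (\<integral>t. Re ((Hop p \<phi> t - complex_of_real l * \<phi> t) * cnj (\<phi> t)) \<partial>lborel)"
    by (rule Hop_form_nonneg[OF p u u' pos \<phi>])
  also have "\<dots> \<le> (\<integral>t. (1 / (2 * c)) * (cmod (z t))\<^sup>2 - (c / 2) * (cmod (\<phi> t))\<^sup>2 \<partial>lborel)"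
  proof (rule integral_mono)
    show "integrable lborel (\<lambda>t. (1 / (2 * c)) * (cmod (z t))\<^sup>2 - (c / 2) * (cmod (\<phi> t))\<^sup>2)"
      using zi i(1) by (auto simp: sq_int_def)
    fix t
    have "Re ((Hop p \<phi> t - complex_of_real l * \<phi> t) * cnj (\<phi> t)) = Re (z t * cnj (\<phi> t)) - c * (cmod (\<phi> t))\<^sup>2"
      by (simp add: z_def c_def cmod_def power2_eq_square algebra_simps)
    moreover have "Re (z t * cnj (\<phi> t)) \<le> cmod (z t) * cmod (\<phi> t)"
      using complex_Re_le_cmod[of "z t * cnj (\<phi> t)"] by (simp add: norm_mult)
    moreover have "cmod (z t) * cmod (\<phi> t) \<le> (1 / (2 * c)) * (cmod (z t))\<^sup>2 + (c / 2) * (cmod (\<phi> t))\<^sup>2"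
    proof -
      have "0 \<le> (cmod (z t) - c * cmod (\<phi> t))\<^sup>2 / (2 * c)" using c by simp
      also have "\<dots> = (1 / (2 * c)) * (cmod (z t))\<^sup>2 + (c / 2) * (cmod (\<phi> t))\<^sup>2 - cmod (z t) * cmod (\<phi> t)"
        using c by (simp add: field_simps power2_eq_square)
      finally show ?thesis by simp
    qed
    ultimately show "Re ((Hop p \<phi> t - complex_of_real l * \<phi> t) * cnj (\<phi> t)) \<le> (1 / (2 * c)) * (cmod (z t))\<^sup>2 - (c / 2) * (cmod (\<phi> t))\<^sup>2"
      by linarith
  qed (rule i)
  also have "\<dots> = (1 / (2 * c)) * (l2norm z)\<^sup>2 - (c / 2) * (l2norm \<phi>)\<^sup>2"
    using zi i(1) by (simp add: l2norm_sq sq_int_def)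
  finally have "c\<^sup>2 * (l2norm \<phi>)\<^sup>2 \<le> (l2norm z)\<^sup>2"
    using c by (simp add: field_simps power2_eq_square)
  then show ?thesis by (simp add: c_def z_def[abs_def])
qed

text \<open>The infimum is attained at l. The ground state lies in the closed graph because the
  approximations with precision 1/(n+1) and their images converge in L2, being close in the
  square-integrable weight 1/(1 + t^2). For m < l, test functions converging to an eigenfunction of
  m would have (H_p - m) \<phi>_n tending to 0, so by \<open>Hop_lower_bound\<close> the
  eigenfunction would have norm 0.\<close>

lemma gamma_eq:
  fixes u u' :: "real \<Rightarrow> real"
  assumes p: "p \<ge> 1" and C: "C > 0" and u: "\<And>t. (u has_real_derivative u' t) (at t)"
    and u': "\<And>t. (u' has_real_derivative (\<bar>t\<bar> powr p - l) * u t) (at t)"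
    and pos: "\<And>t. u t > 0"
    and ub: "\<And>t. \<bar>u t\<bar> \<le> C * exp (- \<bar>t\<bar>)" and u'b: "\<And>t. \<bar>u' t\<bar> \<le> C * exp (- \<bar>t\<bar>)"
  shows "gamma p = l"
  unfolding gamma_def
proof (rule cInf_eq_minimum)
  define w where "w t = complex_of_real (u t)" for t
  obtain K where "K > 0" and K: "\<And>\<epsilon>. \<epsilon> > 0 \<Longrightarrow> \<exists>h\<in>C0inf1. near_ground_state p l u K \<epsilon> h"
    using approx_ground_state[OF p C u u' ub u'b] by blast
  have "\<exists>\<phi>. \<forall>n. \<phi> n \<in> C0inf1 \<and> (\<forall>t. (1 + t\<^sup>2) * norm (\<phi> n t) \<le> K / (1 + t\<^sup>2) \<and>
      norm (Hop p (\<phi> n) t - complex_of_real l * \<phi> n t) \<le> inverse (real (Suc n)) / (1 + t\<^sup>2) \<and>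
      norm (\<phi> n t - w t) \<le> inverse (real (Suc n)) / (1 + t\<^sup>2))"
  proof (intro choice allI)
    fix n
    have "inverse (real (Suc n)) > 0" by simp
    from K[OF this] obtain h where "h \<in> C0inf1" "\<forall>t. (1 + t\<^sup>2) * norm (h t) \<le> K / (1 + t\<^sup>2)"
      "\<forall>t. norm (Hop p h t - complex_of_real l * h t) \<le> inverse (real (Suc n)) / (1 + t\<^sup>2)"
      "\<forall>t. norm (h t - w t) \<le> inverse (real (Suc n)) / (1 + t\<^sup>2)"
      unfolding w_def near_ground_state_def by blast
    then show "\<exists>h. h \<in> C0inf1 \<and> (\<forall>t. (1 + t\<^sup>2) * norm (h t) \<le> K / (1 + t\<^sup>2) \<and>
      norm (Hop p h t - complex_of_real l * h t) \<le> inverse (real (Suc n)) / (1 + t\<^sup>2) \<and>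
      norm (h t - w t) \<le> inverse (real (Suc n)) / (1 + t\<^sup>2))"
      by blast
  qed
  then obtain \<phi> where \<phi>: "\<And>n. \<phi> n \<in> C0inf1"
    "\<And>n t. (1 + t\<^sup>2) * norm (\<phi> n t) \<le> K / (1 + t\<^sup>2)"
    "\<And>n t. norm (Hop p (\<phi> n) t - complex_of_real l * \<phi> n t) \<le> inverse (real (Suc n)) / (1 + t\<^sup>2)"
    "\<And>n t. norm (\<phi> n t - w t) \<le> inverse (real (Suc n)) / (1 + t\<^sup>2)"
    by blast
  have wc: "continuous_on UNIV w"
    unfolding w_def by (intro continuous_intros continuous_on_DERIV[OF u])
  have mw: "w \<in> borel_measurable borel" by (rule borel_measurable_continuous_onI[OF wc])
  have m\<phi>: "\<phi> n \<in> borel_measurable borel" "Hop p (\<phi> n) \<in> borel_measurable borel" for n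
    using C0inf1_integrable(1,2)[OF \<phi>(1) p] by (auto simp: sq_int_def)
  have "cmod (w t) \<le> (K + 1) / (1 + t\<^sup>2)" for t
  proof -
    have "1 * norm (\<phi> 0 t) \<le> (1 + t\<^sup>2) * norm (\<phi> 0 t)" by (intro mult_right_mono) auto
    then have "norm (\<phi> 0 t) \<le> K / (1 + t\<^sup>2)" using \<phi>(2)[of t 0] by simp
    moreover have "norm (w t) \<le> norm (\<phi> 0 t) + norm (\<phi> 0 t - w t)"
      by (metis norm_minus_commute norm_triangle_sub)
    ultimately show ?thesis using \<phi>(4)[of 0 t] by (simp add: add_divide_distrib)
  qed
  then have wi: "sq_int w" by (rule sq_int_lorentzian(1)[OF mw])
  define J where "J = (\<integral>t. 1 / (1 + (t::real)\<^sup>2) \<partial>lborel)"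
  have lim0: "(\<lambda>n. (B * inverse (real (Suc n)))\<^sup>2 * J) \<longlonglongrightarrow> 0" for B
    using tendsto_mult[OF tendsto_power[OF tendsto_mult[OF tendsto_const[of B] LIMSEQ_inverse_real_of_nat], of 2] tendsto_const[of J]]
    by simp
  have conv: "(\<lambda>n. l2norm (f n)) \<longlonglongrightarrow> 0"
    if "\<And>n t. cmod (f n t) \<le> B * inverse (real (Suc n)) / (1 + t\<^sup>2)" "\<And>n. f n \<in> borel_measurable borel"
    for f :: "nat \<Rightarrow> real \<Rightarrow> complex" and B
  proof -
    have "(\<lambda>n. (l2norm (f n))\<^sup>2) \<longlonglongrightarrow> 0"
      by (rule tendsto_sandwich[OF _ _ tendsto_const lim0[of B]])
        (use sq_int_lorentzian(2)[OF that(2,1)] in \<open>auto simp: J_def\<close>)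
    then show ?thesis by (simp add: tendsto_zero_l2)
  qed
  have "(w, \<lambda>t. complex_of_real l * w t) \<in> Hp_graph p"
    unfolding Hp_graph_def closure_graph_def
  proof (clarify, intro conjI exI[of _ \<phi>] allI)
    show "(\<lambda>n. l2dist (\<phi> n) w) \<longlonglongrightarrow> 0"
      unfolding l2dist_def by (rule conv[of _ 1]) (use \<phi>(4) mw m\<phi> in auto)
    show "(\<lambda>n. l2dist (Hop p (\<phi> n)) (\<lambda>t. complex_of_real l * w t)) \<longlonglongrightarrow> 0"
      unfolding l2dist_def
    proof (rule conv[of _ "1 + \<bar>l\<bar>"])
      fix n t
      have "Hop p (\<phi> n) t - complex_of_real l * w t = (Hop p (\<phi> n) t - complex_of_real l * \<phi> n t) + complex_of_real l * (\<phi> n t - w t)"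
        by (simp add: algebra_simps)
      then have "cmod (Hop p (\<phi> n) t - complex_of_real l * w t) \<le> cmod (Hop p (\<phi> n) t - complex_of_real l * \<phi> n t) + \<bar>l\<bar> * cmod (\<phi> n t - w t)"
        by (metis norm_mult norm_of_real norm_triangle_ineq real_norm_def)
      also have "\<dots> \<le> inverse (real (Suc n)) / (1 + t\<^sup>2) + \<bar>l\<bar> * (inverse (real (Suc n)) / (1 + t\<^sup>2))"
        by (intro add_mono mult_left_mono \<phi>) auto
      also have "\<dots> = (1 + \<bar>l\<bar>) * inverse (real (Suc n)) / (1 + t\<^sup>2)"
        by (simp add: algebra_simps add_divide_distrib)
      finally show "cmod (Hop p (\<phi> n) t - complex_of_real l * w t) \<le> (1 + \<bar>l\<bar>) * inverse (real (Suc n)) / (1 + t\<^sup>2)" .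
    qed (use mw m\<phi> in auto)
  qed (use wi \<phi> in \<open>auto intro: sq_int_cmult\<close>)
  moreover have "l2norm w \<noteq> 0"
  proof
    assume "l2norm w = 0"
    then have "(\<integral>x. (cmod (w x))\<^sup>2 \<partial>lborel) = 0" using l2norm_sq[of w] by simp
    then have "AE x in lborel. (cmod (w x))\<^sup>2 = 0"
      using wi integral_nonneg_eq_0_iff_AE[of lborel "\<lambda>x. (cmod (w x))\<^sup>2"] by (simp add: sq_int_def)
    then have "AE x in (lborel :: real measure). False"
      using pos by (auto simp: w_def less_imp_neq[THEN not_sym])
    then have "ae_filter (lborel :: real measure) = bot" by (simp add: trivial_limit_def)
    then show False by (simp add: ae_filter_eq_bot_iff)
  qed
  moreover have "l2dist (\<lambda>t. complex_of_real l * w t) (\<lambda>t. complex_of_real l * w t) = 0"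
    by (simp add: l2dist_def l2norm_def)
  ultimately show "l \<in> {l::real. \<exists>u v. (u, v) \<in> Hp_graph p \<and> l2norm u \<noteq> 0 \<and> l2dist v (\<lambda>t. complex_of_real l * u t) = 0}"
    by blast
next
  fix m assume "m \<in> {l::real. \<exists>u v. (u, v) \<in> Hp_graph p \<and> l2norm u \<noteq> 0 \<and> l2dist v (\<lambda>t. complex_of_real l * u t) = 0}"
  then obtain w v \<phi> where w: "sq_int w" "sq_int v" "l2norm w \<noteq> 0" "l2dist v (\<lambda>t. complex_of_real m * w t) = 0"
    and \<phi>: "\<And>n. \<phi> n \<in> C0inf1" "(\<lambda>n. l2dist (\<phi> n) w) \<longlonglongrightarrow> 0" "(\<lambda>n. l2dist (Hop p (\<phi> n)) v) \<longlonglongrightarrow> 0"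
    unfolding Hp_graph_def closure_graph_def by blast
  show "l \<le> m"
  proof (rule ccontr)
    assume "\<not> l \<le> m"
    define c where "c = l - m"
    have c: "c > 0" using \<open>\<not> l \<le> m\<close> by (simp add: c_def)
    define X where "X n = (l2dist (\<phi> n) w)\<^sup>2" for n
    define Y where "Y n = (l2dist (Hop p (\<phi> n)) v)\<^sup>2" for n
    have XY: "X \<longlonglongrightarrow> 0" "Y \<longlonglongrightarrow> 0"
      unfolding X_def Y_def using \<phi>(2,3) by (simp_all add: l2dist_def tendsto_zero_l2)
    have bound: "(l2norm w)\<^sup>2 \<le> 2 * X n + 2 * ((2 * Y n + 4 * m\<^sup>2 * X n) / c\<^sup>2)" for n
    proof -
      note i = C0inf1_integrable(1,2)[OF \<phi>(1) p, of n]
      have "(l2norm (\<lambda>x. - 1 * (\<phi> n x - w x) + \<phi> n x))\<^sup>2 \<le> 2 * (l2norm (\<lambda>x. - 1 * (\<phi> n x - w x)))\<^sup>2 + 2 * (l2norm (\<phi> n))\<^sup>2"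
        by (intro sq_int_add sq_int_cmult sq_int_diff i w)
      also have "(l2norm (\<lambda>x. - 1 * (\<phi> n x - w x)))\<^sup>2 = X n"
        using sq_int_cmult(2)[OF sq_int_diff[OF i(1) w(1)], of "- 1"] by (simp add: X_def l2dist_def)
      finally have 1: "(l2norm w)\<^sup>2 \<le> 2 * X n + 2 * (l2norm (\<phi> n))\<^sup>2" by simp
      \<comment> \<open>The eigenvalue equation holds only in L2, so v cannot be rewritten to m w;
        the null function \<open>e\<close> carries the difference along.\<close>
      define e where "e x = v x - complex_of_real m * w x" for x
      have e: "sq_int e" "(l2norm e)\<^sup>2 = 0"
        using w by (auto simp: e_def[abs_def] l2dist_def intro!: sq_int_diff sq_int_cmult)
      define d where "d x = e x + complex_of_real (- m) * (\<phi> n x - w x)" for x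
      have d: "sq_int d" "(l2norm d)\<^sup>2 \<le> 2 * (m\<^sup>2 * X n)"
        using sq_int_add[OF e(1) sq_int_cmult(1)[OF sq_int_diff[OF i(1) w(1)]], of "complex_of_real (- m)"]
          sq_int_cmult(2)[OF sq_int_diff[OF i(1) w(1)], of "complex_of_real (- m)"] e(2)
        by (auto simp: d_def[abs_def] X_def l2dist_def)
      have "(l2norm (\<lambda>x. (Hop p (\<phi> n) x - v x) + d x))\<^sup>2 \<le> 2 * (l2norm (\<lambda>x. Hop p (\<phi> n) x - v x))\<^sup>2 + 2 * (l2norm d)\<^sup>2"
        by (intro sq_int_add sq_int_diff i w d)
      also have "\<dots> \<le> 2 * Y n + 4 * m\<^sup>2 * X n" using d(2) by (simp add: Y_def l2dist_def mult_ac)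
      also have "(\<lambda>x. (Hop p (\<phi> n) x - v x) + d x) = (\<lambda>x. Hop p (\<phi> n) x - complex_of_real m * \<phi> n x)"
        by (simp add: d_def e_def fun_eq_iff algebra_simps)
      finally have "c\<^sup>2 * (l2norm (\<phi> n))\<^sup>2 \<le> 2 * Y n + 4 * m\<^sup>2 * X n"
        using Hop_lower_bound[OF p u u' pos \<phi>(1), of m n] c by (simp add: c_def)
      then have "(l2norm (\<phi> n))\<^sup>2 \<le> (2 * Y n + 4 * m\<^sup>2 * X n) / c\<^sup>2"
        using c by (simp add: field_simps)
      with 1 show ?thesis by linarith
    qed
    have "(\<lambda>n. 2 * X n + 2 * ((2 * Y n + 4 * m\<^sup>2 * X n) / c\<^sup>2)) \<longlonglongrightarrow> 2 * 0 + 2 * ((2 * 0 + 4 * m\<^sup>2 * 0) / c\<^sup>2)"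
      using c by (intro tendsto_intros XY) auto
    then have "(l2norm w)\<^sup>2 \<le> 2 * 0 + 2 * ((2 * 0 + 4 * m\<^sup>2 * 0) / c\<^sup>2)"
      by (rule LIMSEQ_le_const) (use bound in blast)
    then show False using w(3) by simp
  qed
qed

section \<open>Singular sequences\<close>

text \<open>Mean value theorem: the exponent a - 1 is negative, so the derivative is largest at the
  lower end M, and its factor a is below 1.\<close>

lemma powr_diff_le:
  fixes A B M a :: real
  assumes "0 < M" "M \<le> A" "M \<le> B" "0 < a" "a < 1"
  shows "\<bar>A powr a - B powr a\<bar> \<le> M powr (a - 1) * \<bar>A - B\<bar>"
proof -
  have *: "y powr a - x powr a \<le> M powr (a - 1) * (y - x)" if "M \<le> x" "x < y" for x y
  proof -
    have "((\<lambda>z. z powr a) has_real_derivative a * z powr (a - 1)) (at z)" if "x \<le> z" for z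
      using that \<open>M \<le> x\<close> assms by (intro has_real_derivative_powr) auto
    then obtain z where z: "x < z" "z < y" "y powr a - x powr a = (y - x) * (a * z powr (a - 1))"
      using MVT2[OF \<open>x < y\<close>, of "\<lambda>z. z powr a" "\<lambda>z. a * z powr (a - 1)"] by blast
    have "z powr (a - 1) \<le> M powr (a - 1)"
      using z that assms by (intro powr_mono2') auto
    then have "a * z powr (a - 1) \<le> 1 * M powr (a - 1)"
      using assms by (intro mult_mono) auto
    then have "(y - x) * (a * z powr (a - 1)) \<le> (y - x) * M powr (a - 1)"
      using that by (intro mult_left_mono) auto
    then show ?thesis using z(3) by (simp add: mult.commute)
  qed
  have **: "x powr a \<le> y powr a" if "M \<le> x" "x < y" for x y
    using that assms by (intro powr_mono2) auto
  consider "A = B" | "A < B" | "B < A" by linarith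
  then show ?thesis
    using *[of A B] *[of B A] **[of A B] **[of B A] assms by cases (auto simp: abs_if)
qed

text \<open>The scaling \<open>s\<close> of \<open>y\<close> is $(1+x^2)^{a/2}$ instead of $|x|^a$ to make it smooth at
  \<open>x = 0\<close>; this costs an error of the same order \<open>(N\<^sup>2) powr (a - 1)\<close> as replacing
  $(x^2+y^2)^a$ by $s(x)^2$.\<close>

locale weyl =
  fixes p l k K D :: real and u :: "real \<Rightarrow> real" and \<theta> :: "real \<Rightarrow> complex"
  assumes p: "p \<ge> 1" and k: "k \<ge> 0" and K: "K > 0" and D: "D \<ge> 1"
    and \<theta>: "smooth1 \<theta>" and \<theta>_support: "\<And>t. 1 < \<bar>t\<bar> \<Longrightarrow> \<theta> t = 0"
    and \<theta>_bound: "\<And>t. norm (\<theta> t) \<le> D" "\<And>t. norm (vd \<theta> t) \<le> D" "\<And>t. norm (vd (vd \<theta>) t) \<le> D"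
begin

definition a :: real where "a = p / (p + 2)"
definition s :: "real \<Rightarrow> real" where "s x = (1 + x\<^sup>2) powr (a / 2)"
text \<open>The logarithmic derivative s'/s = a x / (1 + x^2), written with a power so that
  \<open>smooth1_powr\<close> covers it.\<close>

definition q :: "real \<Rightarrow> real" where "q x = a * (x * (1 + x\<^sup>2) powr (- 1))"

lemma exponent_bounds: "0 < a" "a < 1" "a * (p + 2) = p"
  using p by (auto simp: a_def)

lemma s_ge_1: "1 \<le> s x"
  using exponent_bounds by (auto simp: s_def intro!: ge_one_powr_ge_zero)

lemma s_sq: "(s x)\<^sup>2 = (1 + x\<^sup>2) powr a"
  by (simp add: s_def power2_eq_square powr_add[symmetric])

lemma s_mono: "0 \<le> x \<Longrightarrow> x \<le> y \<Longrightarrow> s x \<le> s y"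
  using exponent_bounds unfolding s_def by (intro powr_mono2 add_left_mono power_mono) (auto simp: add_nonneg_nonneg)

lemma one_plus_sq_pos: "0 < 1 + (x::real)\<^sup>2" by (simp add: add_pos_nonneg)

lemma q_eq: "q x = a * x / (1 + x\<^sup>2)"
  using one_plus_sq_pos[of x] by (simp add: q_def powr_minus_divide)

sublocale scaling s q
proof
  show "smooth1 (\<lambda>x. complex_of_real (s x))" unfolding s_def by (rule smooth1_powr)
  show "smooth1 (\<lambda>x. complex_of_real (q x))"
    unfolding q_def of_real_mult by (intro smooth1_mult smooth1_const smooth1_of_real smooth1_powr)
  show "(s has_real_derivative q x * s x) (at x)" for x
  proof -
    have "((\<lambda>x. 1 + x\<^sup>2) has_real_derivative 2 * x) (at x)"
      by (auto intro!: derivative_eq_intros)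
    from DERIV_chain2[OF has_real_derivative_powr[OF one_plus_sq_pos, where r = "a / 2"] this]
    have "(s has_real_derivative (a / 2) * (1 + x\<^sup>2) powr (a / 2 - 1) * (2 * x)) (at x)"
      by (simp only: s_def[abs_def])
    moreover have "(a / 2) * (1 + x\<^sup>2) powr (a / 2 - 1) * (2 * x) = q x * s x"
    proof -
      have "(a / 2) * (P / Y) * (2 * x) = a * x / Y * P" for P Y :: real by simp
      then show ?thesis using one_plus_sq_pos[of x] by (simp only: q_eq s_def powr_diff powr_one less_imp_le)
    qed
    ultimately show ?thesis by simp
  qed
qed

lemma DERIV_q: "(q has_real_derivative a * (1 - x\<^sup>2) / (1 + x\<^sup>2)\<^sup>2) (at x)"
proof -
  have "q = (\<lambda>x. a * x / (1 + x\<^sup>2))" by (simp add: q_eq fun_eq_iff)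
  then show ?thesis using one_plus_sq_pos[of x]
    by (auto intro!: derivative_eq_intros simp: field_simps power2_eq_square)
qed

lemma vd_q: "vd (\<lambda>x. complex_of_real (q x)) = (\<lambda>x. complex_of_real (a * (1 - x\<^sup>2) / (1 + x\<^sup>2)\<^sup>2))"
  by (rule vd_eqI[OF of_real_has_vector_derivative[OF DERIV_q]])

text \<open>The cutoff is stretched by N, so each of its derivatives is smaller by 1/N. The constant
  c is left free for the normalisation in L2.\<close>

definition E :: "real \<Rightarrow> real \<Rightarrow> real \<Rightarrow> complex" where
  "E c N x = complex_of_real c * (\<theta> (1 / N * x + (- 2)) * cis (k * x))"

lemma smooth1_E: "smooth1 (E c N)"
  unfolding E_def by (intro smooth1_mult smooth1_const smooth1_cis smooth1_affine \<theta>)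

lemma E_support:
  assumes "N > 0" "x \<notin> {N..3 * N}"
  shows "E c N x = 0"
proof -
  have "1 < \<bar>1 / N * x + (- 2)\<bar>" using assms by (auto simp: field_simps abs_if)
  then show ?thesis by (simp add: E_def \<theta>_support)
qed

lemma vd_E: "vd (E c N) = (\<lambda>x. complex_of_real c * ((\<i> * complex_of_real k * \<theta> (1 / N * x + (- 2)) +
    complex_of_real (1 / N) * vd \<theta> (1 / N * x + (- 2))) * cis (k * x)))"
proof -
  note S = smooth1_affine[OF \<theta>, of "1 / N" "- 2"]
  show ?thesis
    unfolding E_def
    using vd_mult[OF smooth1_const[of "complex_of_real c"] smooth1_mult[OF S smooth1_cis[of k]]]
      vd_mult[OF S smooth1_cis[of k]] vd_affine[OF \<theta>, of "1 / N" "- 2"] vd_cis[of k]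
    by (simp add: algebra_simps)
qed

text \<open>The plane wave part cancels, and every surviving term has a derivative on the cutoff and
  hence a factor 1/N.\<close>

lemma vd_vd_E: "vd (vd (E c N)) x + (complex_of_real k)\<^sup>2 * E c N x = complex_of_real c *
    ((2 * \<i> * complex_of_real k * complex_of_real (1 / N) * vd \<theta> (1 / N * x + (- 2)) +
    (complex_of_real (1 / N))\<^sup>2 * vd (vd \<theta>) (1 / N * x + (- 2))) * cis (k * x))"
proof -
  note S = smooth1_affine[OF \<theta>, of "1 / N" "- 2"]
  note S1 = smooth1_affine[OF smooth1_vd[OF \<theta>], of "1 / N" "- 2"]
  have T: "smooth1 (\<lambda>x. \<i> * complex_of_real k * \<theta> (1 / N * x + (- 2)) +
    complex_of_real (1 / N) * vd \<theta> (1 / N * x + (- 2)))"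
    by (intro smooth1_add smooth1_mult smooth1_const S S1)
  have vT: "vd (\<lambda>x. \<i> * complex_of_real k * \<theta> (1 / N * x + (- 2)) +
    complex_of_real (1 / N) * vd \<theta> (1 / N * x + (- 2))) = (\<lambda>x. \<i> * complex_of_real k * (complex_of_real (1 / N) * vd \<theta> (1 / N * x + (- 2))) +
    complex_of_real (1 / N) * (complex_of_real (1 / N) * vd (vd \<theta>) (1 / N * x + (- 2))))"
    using vd_add[OF smooth1_mult[OF smooth1_const[of "\<i> * complex_of_real k"] S] smooth1_mult[OF smooth1_const[of "complex_of_real (1 / N)"] S1]]
      vd_mult[OF smooth1_const[of "\<i> * complex_of_real k"] S] vd_mult[OF smooth1_const[of "complex_of_real (1 / N)"] S1]
      vd_affine[OF \<theta>, of "1 / N" "- 2"] vd_affine[OF smooth1_vd[OF \<theta>], of "1 / N" "- 2"] by simp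
  have "vd (vd (E c N)) = (\<lambda>x. complex_of_real c * ((\<i> * complex_of_real k * \<theta> (1 / N * x + (- 2)) +
    complex_of_real (1 / N) * vd \<theta> (1 / N * x + (- 2))) * (\<i> * complex_of_real k * cis (k * x)) +
    (\<i> * complex_of_real k * (complex_of_real (1 / N) * vd \<theta> (1 / N * x + (- 2))) +
    complex_of_real (1 / N) * (complex_of_real (1 / N) * vd (vd \<theta>) (1 / N * x + (- 2)))) * cis (k * x)))"
    unfolding vd_E
    using vd_mult[OF smooth1_const[of "complex_of_real c"] smooth1_mult[OF T smooth1_cis[of k]]]
      vd_mult[OF T smooth1_cis[of k]] vT vd_cis[of k] by simp
  moreover have "\<i> * (\<i> * z) = - z" for z by (simp add: mult.assoc[symmetric])
  ultimately show ?thesis by (simp add: E_def power2_eq_square algebra_simps)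
qed

lemma E_bounds:
  assumes "N \<ge> 1" "c \<ge> 0"
  shows "norm (E c N x) \<le> c * D" "norm (vd (E c N) x) \<le> c * D * (1 + k)"
    "norm (vd (vd (E c N)) x + (complex_of_real k)\<^sup>2 * E c N x) \<le> c * D * (1 + 2 * k) / N"
proof -
  let ?y = "1 / N * x + (- 2)"
  show "norm (E c N x) \<le> c * D"
    using \<theta>_bound assms by (auto simp: E_def norm_mult intro!: mult_left_mono)
  have D0: "D \<ge> 0" using D by simp
  have N: "1 / N \<le> 1" "0 < 1 / N" using assms by auto
  have "norm (\<i> * complex_of_real k * \<theta> ?y + complex_of_real (1 / N) * vd \<theta> ?y) \<le> k * D + 1 * D"
  proof (rule norm_triangle_le[OF add_mono])
    show "norm (\<i> * complex_of_real k * \<theta> ?y) \<le> k * D"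
      using k \<theta>_bound(1)[of ?y] by (simp add: norm_mult mult_left_mono)
    have "(1 / N) * norm (vd \<theta> ?y) \<le> 1 * D" using N D0 by (intro mult_mono \<theta>_bound) auto
    then show "norm (complex_of_real (1 / N) * vd \<theta> ?y) \<le> 1 * D" using assms by (simp add: norm_mult norm_divide)
  qed
  from mult_left_mono[OF this assms(2)]
  have "norm (vd (E c N) x) \<le> c * (k * D + 1 * D)"
    using assms by (simp only: vd_E norm_mult norm_cis norm_of_real abs_of_nonneg mult_1_right)
  also have "\<dots> = c * D * (1 + k)" by (simp add: algebra_simps)
  finally show "norm (vd (E c N) x) \<le> c * D * (1 + k)" .
  have "norm (2 * \<i> * complex_of_real k * complex_of_real (1 / N) * vd \<theta> ?y + (complex_of_real (1 / N))\<^sup>2 * vd (vd \<theta>) ?y)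
      \<le> 2 * k * (1 / N) * D + (1 / N) * D"
  proof (rule norm_triangle_le[OF add_mono])
    have "norm (2 * \<i> * complex_of_real k * complex_of_real (1 / N) * vd \<theta> ?y) = 2 * k * (1 / N) * norm (vd \<theta> ?y)"
      using k assms by (simp add: norm_mult norm_divide)
    also have "\<dots> \<le> 2 * k * (1 / N) * D" using k N by (intro mult_left_mono \<theta>_bound) auto
    finally show "norm (2 * \<i> * complex_of_real k * complex_of_real (1 / N) * vd \<theta> ?y) \<le> 2 * k * (1 / N) * D" .
    have "norm ((complex_of_real (1 / N))\<^sup>2 * vd (vd \<theta>) ?y) = (1 / N) * ((1 / N) * norm (vd (vd \<theta>) ?y))"
      using assms by (simp add: norm_mult norm_divide norm_power power2_eq_square)
    also have "\<dots> \<le> (1 / N) * (1 * D)" using N D0 by (intro mult_left_mono mult_mono \<theta>_bound) auto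
    finally show "norm ((complex_of_real (1 / N))\<^sup>2 * vd (vd \<theta>) ?y) \<le> (1 / N) * D" by simp
  qed
  from mult_left_mono[OF this assms(2)]
  have "norm (vd (vd (E c N)) x + (complex_of_real k)\<^sup>2 * E c N x) \<le> c * (2 * k * (1 / N) * D + (1 / N) * D)"
    using assms by (simp only: vd_vd_E norm_mult norm_cis norm_of_real abs_of_nonneg mult_1_right)
  also have "\<dots> = c * D * (1 + 2 * k) / N" by (simp add: algebra_simps add_divide_distrib)
  finally show "norm (vd (vd (E c N)) x + (complex_of_real k)\<^sup>2 * E c N x) \<le> c * D * (1 + 2 * k) / N" .
qed

text \<open>The middle quantity is q'. The derivative and the square are really O(1/N^2), but the
  common bound 1/N suffices.\<close>

lemma q_bounds:
  assumes "1 \<le> N" "N \<le> x"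
  shows "\<bar>q x\<bar> \<le> 1 / N" "\<bar>a * (1 - x\<^sup>2) / (1 + x\<^sup>2)\<^sup>2\<bar> \<le> 1 / N" "(q x)\<^sup>2 \<le> 1 / N"
proof -
  have x: "x \<ge> 1" using assms by simp
  have "\<bar>q x\<bar> \<le> 1 * x / (1 + x\<^sup>2)"
    using exponent_bounds x one_plus_sq_pos[of x] by (simp add: q_eq abs_mult divide_right_mono)
  also have "\<dots> \<le> 1 / x" using x one_plus_sq_pos[of x] by (simp add: field_simps power2_eq_square)
  also have "\<dots> \<le> 1 / N" using assms by (simp add: frac_le)
  finally show q: "\<bar>q x\<bar> \<le> 1 / N" .
  have "\<bar>a * (1 - x\<^sup>2)\<bar> \<le> 1 * (1 + x\<^sup>2)"
    unfolding abs_mult using exponent_bounds by (intro mult_mono) (auto simp: abs_le_iff)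
  then have "\<bar>a * (1 - x\<^sup>2) / (1 + x\<^sup>2)\<^sup>2\<bar> \<le> (1 + x\<^sup>2) / (1 + x\<^sup>2)\<^sup>2"
    using one_plus_sq_pos[of x] by (simp add: abs_divide divide_right_mono)
  also have "\<dots> = 1 / (1 + x\<^sup>2)" using one_plus_sq_pos[of x] by (simp add: power2_eq_square)
  also have "\<dots> \<le> 1 / N"
  proof -
    have "N \<le> x * x" using assms x mult_mono[of 1 x N x] by auto
    then show ?thesis using assms one_plus_sq_pos[of x] by (intro divide_left_mono) (auto simp: power2_eq_square)
  qed
  finally show "\<bar>a * (1 - x\<^sup>2) / (1 + x\<^sup>2)\<^sup>2\<bar> \<le> 1 / N" .
  have "(q x)\<^sup>2 = \<bar>q x\<bar> * \<bar>q x\<bar>" by (simp add: power2_eq_square)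
  also have "\<dots> \<le> (1 / N) * 1" using q assms by (intro mult_mono) (auto intro: order_trans)
  finally show "(q x)\<^sup>2 \<le> 1 / N" by simp
qed

text \<open>With w = x^2 / (1 + x^2), the identity a + a p / 2 = p / 2 gives |x y|^p = w^(p/2) s^2
  |s y|^p exactly. The defect 1 - w^(p/2) is at most p / (2 x^2) by the tangent bounds for exp and
  ln, and s^2 = (1 + x^2)^a turns this into the power a - 1.\<close>

lemma potential_scaling:
  assumes "1 \<le> N" "N \<le> x"
  shows "\<bar>\<bar>x * y\<bar> powr p - (s x)\<^sup>2 * \<bar>s x * y\<bar> powr p\<bar> \<le> p * (N\<^sup>2) powr (a - 1) * \<bar>s x * y\<bar> powr p"
proof -
  have x: "x \<ge> 1" using assms by simp
  define w where "w = x\<^sup>2 / (1 + x\<^sup>2)"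
  have w: "w > 0" using x one_plus_sq_pos[of x] by (simp add: w_def)
  have s0: "s x > 0" using s_ge_1[of x] by simp
  have "x powr p = (x\<^sup>2) powr (p / 2)"
  proof -
    have "x powr p = (x powr 2) powr (p / 2)" by (simp add: powr_powr)
    then show ?thesis using x by simp
  qed
  also have "x\<^sup>2 = w * (1 + x\<^sup>2)" using one_plus_sq_pos[of x] by (simp add: w_def)
  also have "(w * (1 + x\<^sup>2)) powr (p / 2) = w powr (p / 2) * (1 + x\<^sup>2) powr (p / 2)"
    using w one_plus_sq_pos[of x] by (simp add: powr_mult)
  also have "(1 + x\<^sup>2) powr (p / 2) = (s x)\<^sup>2 * s x powr p"
  proof -
    have e: "a + a / 2 * p = p / 2" using exponent_bounds(3) by (simp add: field_simps)
    have "(1 + x\<^sup>2) powr (p / 2) = (1 + x\<^sup>2) powr (a + a / 2 * p)"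
      by (simp only: e)
    also have "\<dots> = (1 + x\<^sup>2) powr a * ((1 + x\<^sup>2) powr (a / 2)) powr p"
      by (simp only: powr_add powr_powr)
    finally show ?thesis unfolding s_def[symmetric] s_sq[symmetric] .
  qed
  finally have xp: "x powr p = w powr (p / 2) * ((s x)\<^sup>2 * s x powr p)" .
  have "\<bar>x * y\<bar> powr p = x powr p * \<bar>y\<bar> powr p" using x by (simp add: abs_mult powr_mult)
  also have "\<dots> = w powr (p / 2) * (s x)\<^sup>2 * \<bar>s x * y\<bar> powr p"
    using s0 by (simp add: xp abs_mult powr_mult mult_ac)
  finally have eq: "\<bar>x * y\<bar> powr p - (s x)\<^sup>2 * \<bar>s x * y\<bar> powr p = - ((1 - w powr (p / 2)) * (s x)\<^sup>2 * \<bar>s x * y\<bar> powr p)"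
    by (simp add: algebra_simps)
  have "w \<le> 1" using one_plus_sq_pos[of x] by (simp add: w_def)
  then have w1: "w powr (p / 2) \<le> 1" using w p by (intro powr_le1) auto
  have "1 - w powr (p / 2) \<le> (p / 2) * (1 / x\<^sup>2)"
  proof -
    have "ln (1 / w) \<le> 1 / w - 1" using w by (intro ln_le_minus_one) auto
    moreover have "1 / w - 1 = 1 / x\<^sup>2" using x by (simp add: w_def field_simps)
    ultimately have "- (1 / x\<^sup>2) \<le> ln w" using w by (simp add: ln_div)
    then have "(p / 2) * - (1 / x\<^sup>2) \<le> (p / 2) * ln w" using p by (intro mult_left_mono) auto
    moreover have "1 + (p / 2) * ln w \<le> w powr (p / 2)"
      using w exp_ge_add_one_self[of "(p / 2) * ln w"] by (simp add: powr_def)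
    ultimately show ?thesis by linarith
  qed
  then have "(1 - w powr (p / 2)) * (s x)\<^sup>2 \<le> (p / 2) * (1 / x\<^sup>2) * (s x)\<^sup>2"
    by (intro mult_right_mono) auto
  also have "\<dots> \<le> (p / 2) * (2 / (1 + x\<^sup>2)) * (s x)\<^sup>2"
  proof -
    have "1 \<le> x\<^sup>2" using x by (simp add: one_le_power)
    then have "2 / (x\<^sup>2 + x\<^sup>2) \<le> 2 / (1 + x\<^sup>2)"
      using one_plus_sq_pos[of x] by (intro divide_left_mono add_right_mono mult_pos_pos) auto
    then have "1 / x\<^sup>2 \<le> 2 / (1 + x\<^sup>2)" by simp
    then show ?thesis using p by (intro mult_right_mono mult_left_mono) auto
  qed
  also have "\<dots> = p * (1 + x\<^sup>2) powr (a - 1)"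
    using one_plus_sq_pos[of x] by (simp add: s_sq powr_diff)
  also have "\<dots> \<le> p * (N\<^sup>2) powr (a - 1)"
  proof -
    have "N\<^sup>2 \<le> x\<^sup>2" using assms by (intro power_mono) auto
    then have "N\<^sup>2 \<le> 1 + x\<^sup>2" by simp
    then show ?thesis using p exponent_bounds assms by (intro mult_left_mono powr_mono2') auto
  qed
  finally have "(1 - w powr (p / 2)) * (s x)\<^sup>2 * \<bar>s x * y\<bar> powr p \<le> p * (N\<^sup>2) powr (a - 1) * \<bar>s x * y\<bar> powr p"
    by (intro mult_right_mono) auto
  then show ?thesis using w1 by (simp add: eq)
qed

text \<open>The bases differ by 1 - y^2, and |y| \<le> |s y| because s \<ge> 1. The resulting factor
  1 + t^2 is the weight put on h in \<open>near_ground_state\<close>.\<close>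

lemma level_scaling:
  assumes "1 \<le> N" "N \<le> x"
  shows "\<bar>(s x)\<^sup>2 - (x\<^sup>2 + y\<^sup>2) powr a\<bar> \<le> (N\<^sup>2) powr (a - 1) * (1 + (s x * y)\<^sup>2)"
proof -
  have "N\<^sup>2 \<le> x\<^sup>2" using assms by (intro power_mono) auto
  then have "\<bar>(1 + x\<^sup>2) powr a - (x\<^sup>2 + y\<^sup>2) powr a\<bar> \<le> (N\<^sup>2) powr (a - 1) * \<bar>(1 + x\<^sup>2) - (x\<^sup>2 + y\<^sup>2)\<bar>"
    using assms exponent_bounds by (intro powr_diff_le) (auto simp: add_increasing add_increasing2)
  also have "\<dots> \<le> (N\<^sup>2) powr (a - 1) * (1 + (s x * y)\<^sup>2)"
  proof (intro mult_left_mono)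
    have "1 * y\<^sup>2 \<le> (s x)\<^sup>2 * y\<^sup>2"
      using s_ge_1[of x] by (intro mult_right_mono) (auto simp: one_le_power)
    moreover have "0 \<le> y\<^sup>2" by simp
    ultimately show "\<bar>(1 + x\<^sup>2) - (x\<^sup>2 + y\<^sup>2)\<bar> \<le> 1 + (s x * y)\<^sup>2"
      unfolding power_mult_distrib abs_le_iff by linarith
  qed simp
  finally show ?thesis by (simp add: s_sq)
qed

definition \<psi> :: "real \<Rightarrow> real \<Rightarrow> (real \<Rightarrow> complex) \<Rightarrow> real \<times> real \<Rightarrow> complex" where
  "\<psi> c N h = (\<lambda>(x, y). E c N x * h (s x * y))"

text \<open>In order, the summands are the remainder of the wave packet, the mixed x-derivatives,
  the terms from q' and from q^2, the defect of h magnified by s^2, the mismatch of the potential,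
  and the mismatch of the subtracted level. The main terms s^2 H_p h and l s^2 h have been combined
  into the defect.\<close>

lemma Lop_psi:
  assumes h: "smooth1 h"
  shows "Lop p l (\<psi> c N h) (x, y) - (complex_of_real k)\<^sup>2 * \<psi> c N h (x, y) =
    (let t = s x * y; z = E c N x in
      - (vd (vd (E c N)) x + (complex_of_real k)\<^sup>2 * z) * h t
      - 2 * vd (E c N) x * of_real (q x) * (of_real t * vd h t)
      - z * of_real (a * (1 - x\<^sup>2) / (1 + x\<^sup>2)\<^sup>2) * (of_real t * vd h t)
      - z * of_real ((q x)\<^sup>2) * (of_real t * vd h t + of_real (t\<^sup>2) * vd (vd h) t)
      + z * (of_real ((s x)\<^sup>2) * (Hop p h t - of_real l * h t)
        + of_real (\<bar>x * y\<bar> powr p - (s x)\<^sup>2 * \<bar>t\<bar> powr p) * h t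
        + of_real (l * ((s x)\<^sup>2 - (x\<^sup>2 + y\<^sup>2) powr a)) * h t))"
proof -
  note sE = smooth1_E[of c N]
  \<comment> \<open>The Euler operator t d/dt, through which each x-derivative acts on the scaled
    profile; applied twice it gives t h' + t^2 h''.\<close>
  define H where "H t = of_real t * vd h t" for t
  have sH: "smooth1 H" unfolding H_def by (intro smooth1_mult smooth1_of_real smooth1_vd h)
  have vH: "vd H = (\<lambda>t. of_real t * vd (vd h) t + vd h t)"
  proof -
    have "vd complex_of_real = (\<lambda>_. 1)"
      by (rule vd_eqI) (use of_real_has_vector_derivative[of "\<lambda>t. t" 1] in auto)
    then show ?thesis unfolding H_def using vd_mult[OF smooth1_of_real smooth1_vd[OF h]] by simp
  qed
  have sEq: "smooth1 (\<lambda>x. E c N x * of_real (q x))" by (intro smooth1_mult sE q)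
  have vEq: "vd (\<lambda>x. E c N x * of_real (q x)) x = E c N x * of_real (a * (1 - x\<^sup>2) / (1 + x\<^sup>2)\<^sup>2) + vd (E c N) x * of_real (q x)" for x
    using vd_mult[OF sE q] by (simp only: vd_q)
  define r where "r = a * (1 - x\<^sup>2) / (1 + x\<^sup>2)\<^sup>2"
  have dx1: "dx (\<psi> c N h) = (\<lambda>(x, y). vd (E c N) x * h (s x * y) + (E c N x * of_real (q x)) * H (s x * y))"
    unfolding \<psi>_def H_def by (rule dx_scaled[OF sE h])
  have dx2: "dx (dx (\<psi> c N h)) (x, y) =
      (vd (vd (E c N)) x * h (s x * y) + (vd (E c N) x * of_real (q x)) * (of_real (s x * y) * vd h (s x * y)))
      + (vd (\<lambda>x. E c N x * of_real (q x)) x * H (s x * y)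
        + (E c N x * of_real (q x) * of_real (q x)) * (of_real (s x * y) * vd H (s x * y)))"
    unfolding dx1 unfolding dx_def
    using vector_derivative_at[OF has_vector_derivative_add[OF scaled_has_dx[OF smooth1_vd[OF sE] h] scaled_has_dx[OF sEq sH]]]
    by simp
  have dy1: "dy (\<psi> c N h) = (\<lambda>(x, y). (E c N x * of_real (s x)) * vd h (s x * y))"
    unfolding \<psi>_def by (rule dy_scaled[OF h])
  have dy2: "dy (dy (\<psi> c N h)) (x, y) = (E c N x * of_real (s x) * of_real (s x)) * vd (vd h) (s x * y)"
    unfolding dy1 using dy_scaled[OF smooth1_vd[OF h], of "\<lambda>x. E c N x * of_real (s x)"] by (simp add: fun_eq_iff)
  show ?thesis
    unfolding Let_def Lop_def prod.case dx2 dy2 vEq vH r_def[symmetric] a_def[symmetric]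
    unfolding Hop_def H_def \<psi>_def prod.case
    by (simp add: algebra_simps power2_eq_square)
qed

text \<open>The 1/N part collects K (1 + 2k), 2 K (1 + k), K and 2 K from the derivative terms, and
  1 from the defect of h. The second part is the mismatch of potential and level.\<close>

definition rate :: "real \<Rightarrow> real" where
  "rate N = (K * (6 + 4 * k) + 1) / N + K * (p + \<bar>l\<bar>) * (N\<^sup>2) powr (a - 1)"

lemma rate_tendsto_0: "(\<lambda>n. rate (real (Suc n))) \<longlonglongrightarrow> 0"
proof -
  have 1: "filterlim (\<lambda>n. real (Suc n)) at_top sequentially"
    by (intro filterlim_compose[OF filterlim_real_sequentially] filterlim_Suc)
  have "((\<lambda>N. (K * (6 + 4 * k) + 1) / N + K * (p + \<bar>l\<bar>) * (N\<^sup>2) powr (a - 1)) \<longlongrightarrow> 0 + K * (p + \<bar>l\<bar>) * 0) at_top"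
    using exponent_bounds
    by (intro tendsto_add tendsto_mult tendsto_const tendsto_divide_0[OF tendsto_const] tendsto_neg_powr
        filterlim_at_top_imp_at_infinity filterlim_ident filterlim_pow_at_top) auto
  from filterlim_compose[OF this 1] show ?thesis by (simp add: rate_def)
qed

text \<open>Every summand of \<open>Lop_psi\<close> is a multiple of 1 / (1 + t^2) by
  \<open>near_ground_state\<close>. The condition on \<epsilon> offsets the factor s^2 \<le> (1 + 9
  N^2)^a, valid for 0 \<le> x \<le> 3 N, in front of the defect of h.\<close>

lemma Lop_error:
  assumes near: "near_ground_state p l u K \<epsilon> h" and h: "smooth1 h" and N: "N \<ge> 1" and c: "c \<ge> 0"
    and \<epsilon>: "\<epsilon> * (1 + 9 * N\<^sup>2) powr a \<le> 1 / N" "\<epsilon> \<ge> 0"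
  shows "cmod (Lop p l (\<psi> c N h) (x, y) - (complex_of_real k)\<^sup>2 * \<psi> c N h (x, y))
    \<le> c * D * rate N * (indicator {N..3 * N} x * (1 / (1 + (s x * y)\<^sup>2)))"
proof (cases "x \<in> {N..3 * N}")
  case False
  have far: "N < \<bar>x - 2 * N\<bar>" using False N by auto
  have z: "E c N x = 0" if "N < \<bar>x - 2 * N\<bar>" for x
    using that N by (intro E_support) auto
  have z1: "vd (E c N) x = 0" if "N < \<bar>x - 2 * N\<bar>" for x
    by (rule vd_zero_outside[OF z that])
  have "vd (vd (E c N)) x = 0"
    by (rule vd_zero_outside[OF z1 far])
  then show ?thesis using False z[OF far] z1[OF far] by (simp add: Lop_psi[OF h])
next
  case True
  define t where "t = s x * y"
  define g where "g = 1 / (1 + t\<^sup>2)"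
  have g: "g > 0" using one_plus_sq_pos[of t] by (simp add: g_def)
  define B where "B = c * D"
  have B: "B \<ge> 0" using c D by (simp add: B_def)
  define M where "M = (N\<^sup>2) powr (a - 1)"
  have M: "M \<ge> 0" by (simp add: M_def)
  have x: "N \<le> x" "x \<le> 3 * N" using True by auto
  have n: "(1 + t\<^sup>2) * norm (h t) \<le> K * g" "\<bar>t\<bar> * norm (vd h t) \<le> K * g" "t\<^sup>2 * norm (vd (vd h) t) \<le> K * g"
    "\<bar>t\<bar> powr p * norm (h t) \<le> K * g" "norm (Hop p h t - complex_of_real l * h t) \<le> \<epsilon> * g"
    using near unfolding near_ground_state_def g_def by auto
  have "1 * norm (h t) \<le> (1 + t\<^sup>2) * norm (h t)" by (intro mult_right_mono) auto
  then have n0: "norm (h t) \<le> K * g" using n(1) by simp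
  have n1: "norm (of_real t * vd h t) \<le> K * g" using n(2) by (simp add: norm_mult)
  have n2: "norm (of_real (t\<^sup>2) * vd (vd h) t) \<le> K * g" using n(3) by (simp add: norm_mult norm_power)
  have Kg: "K * g \<ge> 0" using K g by simp
  note Eb = E_bounds[OF N c, of x, folded B_def]
  note qb = q_bounds[OF N x(1)]
  have N0: "1 / N \<ge> 0" using N by simp
  define A1 where "A1 = (vd (vd (E c N)) x + (complex_of_real k)\<^sup>2 * E c N x) * h t"
  define A2 where "A2 = 2 * vd (E c N) x * of_real (q x) * (of_real t * vd h t)"
  define A3 where "A3 = E c N x * of_real (a * (1 - x\<^sup>2) / (1 + x\<^sup>2)\<^sup>2) * (of_real t * vd h t)"
  define A4 where "A4 = E c N x * of_real ((q x)\<^sup>2) * (of_real t * vd h t + of_real (t\<^sup>2) * vd (vd h) t)"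
  define A5 where "A5 = of_real ((s x)\<^sup>2) * (Hop p h t - of_real l * h t)"
  define A6 where "A6 = of_real (\<bar>x * y\<bar> powr p - (s x)\<^sup>2 * \<bar>t\<bar> powr p) * h t"
  define A7 where "A7 = of_real (l * ((s x)\<^sup>2 - (x\<^sup>2 + y\<^sup>2) powr a)) * h t"
  have eq: "Lop p l (\<psi> c N h) (x, y) - (complex_of_real k)\<^sup>2 * \<psi> c N h (x, y)
      = - A1 - A2 - A3 - A4 + E c N x * (A5 + A6 + A7)"
    unfolding Lop_psi[OF h] Let_def A1_def A2_def A3_def A4_def A5_def A6_def A7_def t_def
    by (simp only: mult_minus_left)
  have b1: "norm A1 \<le> (B * (1 + 2 * k) / N) * (K * g)"
    unfolding A1_def norm_mult by (intro mult_mono Eb n0) (use B k N in auto)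
  have b2: "norm A2 \<le> 2 * (B * (1 + k)) * (1 / N) * (K * g)"
    unfolding A2_def using Eb(2) qb(1) n1 B k N0 Kg
    by (simp only: norm_mult[of _ "of_real t * _"] norm_mult[of _ "of_real (q x)"] norm_mult[of 2] norm_numeral norm_of_real)
      (intro mult_mono mult_nonneg_nonneg, auto)
  have b3: "norm A3 \<le> B * (1 / N) * (K * g)"
    unfolding A3_def using Eb(1) qb(2) n1 B N0 Kg
    by (simp only: norm_mult[of _ "of_real t * _"] norm_mult[of "E c N x"] norm_of_real)
      (intro mult_mono mult_nonneg_nonneg, auto)
  have "norm (of_real t * vd h t + of_real (t\<^sup>2) * vd (vd h) t) \<le> 2 * (K * g)"
    using norm_triangle_ineq[of "of_real t * vd h t" "of_real (t\<^sup>2) * vd (vd h) t"] n1 n2 by linarith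
  moreover have "\<bar>(q x)\<^sup>2\<bar> \<le> 1 / N" using qb(3) by simp
  ultimately have b4: "norm A4 \<le> B * (1 / N) * (2 * (K * g))"
    unfolding A4_def using Eb(1) B N0 Kg
    by (simp only: norm_mult[of _ "_ + _"] norm_mult[of "E c N x"] norm_of_real)
      (intro mult_mono mult_nonneg_nonneg, auto)
  have b5: "norm A5 \<le> (1 / N) * g"
  proof -
    have "x\<^sup>2 \<le> (3 * N)\<^sup>2" using x N by (intro power_mono) auto
    then have "(s x)\<^sup>2 \<le> (1 + 9 * N\<^sup>2) powr a"
      unfolding s_sq using exponent_bounds by (intro powr_mono2) (auto simp: add_nonneg_nonneg power_mult_distrib)
    then have "(s x)\<^sup>2 * norm (Hop p h t - complex_of_real l * h t) \<le> (1 + 9 * N\<^sup>2) powr a * (\<epsilon> * g)"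
      by (intro mult_mono n) auto
    also have "\<dots> = (\<epsilon> * (1 + 9 * N\<^sup>2) powr a) * g" by simp
    also have "\<dots> \<le> (1 / N) * g" using \<epsilon> g by (intro mult_right_mono) auto
    finally show ?thesis by (simp add: A5_def norm_mult norm_power)
  qed
  have b6: "norm A6 \<le> p * M * (K * g)"
  proof -
    have "norm A6 \<le> (p * M * \<bar>t\<bar> powr p) * norm (h t)"
      unfolding A6_def norm_mult norm_of_real t_def M_def
      by (intro mult_right_mono potential_scaling N x) auto
    also have "\<dots> = p * M * (\<bar>t\<bar> powr p * norm (h t))" by simp
    also have "\<dots> \<le> p * M * (K * g)" using p M n(4) by (intro mult_left_mono) auto
    finally show ?thesis .
  qed
  have b7: "norm A7 \<le> \<bar>l\<bar> * M * (K * g)"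
  proof -
    have "norm A7 = \<bar>l\<bar> * (\<bar>(s x)\<^sup>2 - (x\<^sup>2 + y\<^sup>2) powr a\<bar> * norm (h t))"
      unfolding A7_def norm_mult norm_of_real by (simp add: abs_mult)
    also have "\<dots> \<le> \<bar>l\<bar> * ((M * (1 + t\<^sup>2)) * norm (h t))"
      unfolding t_def M_def by (intro mult_left_mono mult_right_mono level_scaling N x) auto
    also have "\<dots> = \<bar>l\<bar> * M * ((1 + t\<^sup>2) * norm (h t))" by simp
    also have "\<dots> \<le> \<bar>l\<bar> * M * (K * g)" using M n(1) by (intro mult_left_mono) auto
    finally show ?thesis .
  qed
  have "norm (A5 + A6 + A7) \<le> (1 / N) * g + p * M * (K * g) + \<bar>l\<bar> * M * (K * g)"
    using norm_triangle_ineq[of "A5 + A6" A7] norm_triangle_ineq[of A5 A6] b5 b6 b7 by linarith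
  then have b8: "norm (E c N x * (A5 + A6 + A7)) \<le> B * ((1 / N) * g + p * M * (K * g) + \<bar>l\<bar> * M * (K * g))"
    unfolding norm_mult using Eb(1) B by (intro mult_mono) auto
  have "norm (- A1 - A2 - A3 - A4 + E c N x * (A5 + A6 + A7))
      \<le> norm A1 + norm A2 + norm A3 + norm A4 + norm (E c N x * (A5 + A6 + A7))"
    using norm_triangle_ineq[of "- A1 - A2 - A3 - A4" "E c N x * (A5 + A6 + A7)"]
      norm_triangle_ineq4[of "- A1 - A2 - A3" A4] norm_triangle_ineq4[of "- A1 - A2" A3]
      norm_triangle_ineq4[of "- A1" A2] by (simp only: norm_minus_cancel)
  also have "\<dots> \<le> (B * (1 + 2 * k) / N) * (K * g) + 2 * (B * (1 + k)) * (1 / N) * (K * g) + B * (1 / N) * (K * g)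
      + B * (1 / N) * (2 * (K * g)) + B * ((1 / N) * g + p * M * (K * g) + \<bar>l\<bar> * M * (K * g))"
    using b1 b2 b3 b4 b8 by linarith
  also have "\<dots> = B * rate N * g"
    using N by (simp add: rate_def M_def[symmetric] field_simps)
  finally show ?thesis
    unfolding eq using True by (simp add: B_def g_def t_def)
qed

lemma psi_C0inf2:
  assumes h: "h \<in> C0inf1" and N: "N \<ge> 1"
  shows "\<psi> c N h \<in> C0inf2"
proof -
  obtain B where B: "\<And>t. B < \<bar>t\<bar> \<Longrightarrow> h t = 0" using C0inf1_support[OF h] by metis
  have sh: "smooth1 h" using h by (simp add: C0inf1_def)
  have "compact (tsupport (\<psi> c N h))"
  proof (rule compact_tsupport)
    show "bounded ({N..3 * N} \<times> {-B..B})" by (intro bounded_Times) auto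
    fix z assume z: "z \<notin> {N..3 * N} \<times> {-B..B}"
    obtain x y where xy: "z = (x, y)" by (cases z)
    show "\<psi> c N h z = 0"
    proof (cases "x \<in> {N..3 * N}")
      case True
      then have "B < \<bar>y\<bar>" using z xy by auto
      also have "\<bar>y\<bar> \<le> \<bar>s x * y\<bar>"
        using s_ge_1[of x] mult_right_mono[of 1 "s x" "\<bar>y\<bar>"] by (simp add: abs_mult)
      finally show ?thesis by (simp add: \<psi>_def xy B)
    qed (use E_support N in \<open>simp add: \<psi>_def xy\<close>)
  qed
  then show ?thesis
    using smooth2_scaled[OF smooth1_E sh] by (simp add: C0inf2_def \<psi>_def)
qed

end

section \<open>Product integrals and weak convergence\<close>

lemma lborel_product_integral:
  fixes f g :: "real \<Rightarrow> real"
  assumes f: "integrable lborel f" "\<And>x. f x \<ge> 0" and g: "integrable lborel g" "\<And>x. g x \<ge> 0"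
  shows "integrable lborel (\<lambda>(x, y). f x * g y)"
    and "(\<integral>z. (case z of (x, y) \<Rightarrow> f x * g y) \<partial>lborel) = integral\<^sup>L lborel f * integral\<^sup>L lborel g"
proof -
  have [measurable]: "f \<in> borel_measurable borel" "g \<in> borel_measurable borel"
    using f(1) g(1) by (auto dest: borel_measurable_integrable)
  have i: "integrable (lborel \<Otimes>\<^sub>M lborel) (\<lambda>(x, y). f x * g y)"
  proof (rule lborel_pair.Fubini_integrable)
    show "integrable lborel (\<lambda>x. \<integral>y. norm (case (x, y) of (x, y) \<Rightarrow> f x * g y) \<partial>lborel)"
      using f g by (simp add: abs_mult)
  qed (use g in auto)
  then show "integrable lborel (\<lambda>(x, y). f x * g y)" by (simp add: lborel_prod)
  show "(\<integral>z. (case z of (x, y) \<Rightarrow> f x * g y) \<partial>lborel) = integral\<^sup>L lborel f * integral\<^sup>L lborel g"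
    using lborel_pair.integral_fst'[OF i] by (simp add: lborel_prod)
qed

text \<open>Only the part of g over x \<ge> n pairs with f n, and its squared norm, the integral of
  \<open>S n\<close>, tends to 0 by dominated convergence. A Young inequality with parameter e
  separates it from the unit norm of f n.\<close>

lemma weak_limit_zero:
  fixes f :: "nat \<Rightarrow> real \<times> real \<Rightarrow> complex"
  assumes f: "\<And>n. sq_int (f n)" "\<And>n. l2norm (f n) = 1"
    and z: "\<And>n x y. x < real n \<Longrightarrow> f n (x, y) = 0" and g: "sq_int g"
  shows "(\<lambda>n. \<integral>x. f n x * cnj (g x) \<partial>lborel) \<longlonglongrightarrow> 0"
proof -
  define S where "S n z = indicator {z. real n \<le> fst z} z * (cmod (g z))\<^sup>2" for n and z :: "real \<times> real"
  have gm: "g \<in> borel_measurable borel" and gi: "integrable lborel (\<lambda>x. (cmod (g x))\<^sup>2)"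
    using g by (auto simp: sq_int_def)
  have [measurable]: "{z. real n \<le> fst z} \<in> sets (borel :: (real \<times> real) measure)" for n
    by (intro borel_closed closed_Collect_le continuous_intros)
  note [measurable] = gm
  have Sm: "S n \<in> borel_measurable borel" for n
    unfolding S_def by measurable
  have Si: "integrable lborel (S n)" for n
    by (rule Bochner_Integration.integrable_bound[OF gi]) (use Sm in \<open>auto simp: S_def indicator_def\<close>)
  have S0: "(\<lambda>n. integral\<^sup>L lborel (S n)) \<longlonglongrightarrow> integral\<^sup>L (lborel :: (real \<times> real) measure) (\<lambda>_. 0)"
  proof (rule integral_dominated_convergence[where w = "\<lambda>x. (cmod (g x))\<^sup>2"])
    show "AE x in lborel. (\<lambda>n. S n x) \<longlonglongrightarrow> 0"
    proof (rule AE_I2)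
      fix x :: "real \<times> real"
      have "\<forall>\<^sub>F n in sequentially. real n > fst x"
        using filterlim_real_sequentially by (simp add: filterlim_at_top_dense)
      then have "\<forall>\<^sub>F n in sequentially. S n x = 0"
        by eventually_elim (simp add: S_def indicator_def)
      then show "(\<lambda>n. S n x) \<longlonglongrightarrow> 0" by (rule tendsto_eventually)
    qed
  qed (use Si gi in \<open>auto simp: S_def indicator_def\<close>)
  have bound: "norm (\<integral>x. f n x * cnj (g x) \<partial>lborel) \<le> e / 2 + integral\<^sup>L lborel (S n) / (2 * e)" if e: "e > 0" for e n
  proof -
    have fi: "integrable lborel (\<lambda>x. (cmod (f n x))\<^sup>2)" and fm: "f n \<in> borel_measurable borel"
      using f by (auto simp: sq_int_def)
    have i: "integrable lborel (\<lambda>x. (e / 2) * (cmod (f n x))\<^sup>2 + (1 / (2 * e)) * S n x)"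
      using fi Si by auto
    have b: "norm (f n x * cnj (g x)) \<le> (e / 2) * (cmod (f n x))\<^sup>2 + (1 / (2 * e)) * S n x" for x
    proof (cases "real n \<le> fst x")
      case True
      have "0 \<le> (e * cmod (f n x) - cmod (g x))\<^sup>2 / (2 * e)" using e by simp
      also have "\<dots> = (e / 2) * (cmod (f n x))\<^sup>2 + (1 / (2 * e)) * (cmod (g x))\<^sup>2 - cmod (f n x) * cmod (g x)"
        using e by (simp add: field_simps power2_eq_square)
      finally show ?thesis using True by (simp add: S_def norm_mult)
    next
      case False
      then have "f n x = 0" using z[of "fst x" n "snd x"] by simp
      then show ?thesis using e by (simp add: S_def)
    qed
    have "(\<lambda>x. cnj (g x)) \<in> borel_measurable borel"
      by (rule measurable_compose[OF gm]) (intro borel_measurable_continuous_onI continuous_intros)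
    then have "(\<lambda>x. f n x * cnj (g x)) \<in> borel_measurable lborel"
      using fm by simp
    moreover have "norm (f n x * cnj (g x)) \<le> norm ((e / 2) * (cmod (f n x))\<^sup>2 + (1 / (2 * e)) * S n x)" for x
      using order_trans[OF b abs_ge_self] by (simp only: real_norm_def)
    ultimately have fgi: "integrable lborel (\<lambda>x. f n x * cnj (g x))"
      by (intro Bochner_Integration.integrable_bound[OF i] AE_I2)
    have "norm (\<integral>x. f n x * cnj (g x) \<partial>lborel) \<le> (\<integral>x. (e / 2) * (cmod (f n x))\<^sup>2 + (1 / (2 * e)) * S n x \<partial>lborel)"
      by (intro order_trans[OF integral_norm_bound] integral_mono integrable_norm fgi i b)
    also have "\<dots> = (e / 2) * (l2norm (f n))\<^sup>2 + integral\<^sup>L lborel (S n) / (2 * e)"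
      using fi Si by (simp add: l2norm_sq)
    finally show ?thesis using f by simp
  qed
  show ?thesis
  proof (rule tendstoI)
    fix e :: real assume e: "e > 0"
    have "(\<lambda>n. integral\<^sup>L lborel (S n)) \<longlonglongrightarrow> 0" using S0 by simp
    \<comment> \<open>The threshold e * e makes the second half of \<open>bound\<close> less than e
      / 2.\<close>
    then have "\<forall>\<^sub>F n in sequentially. integral\<^sup>L lborel (S n) < e * e"
      using e by (intro order_tendstoD) auto
    then show "\<forall>\<^sub>F n in sequentially. dist (\<integral>x. f n x * cnj (g x) \<partial>lborel) 0 < e"
    proof eventually_elim
      case (elim n)
      then have "integral\<^sup>L lborel (S n) / (2 * e) < e / 2" using e by (simp add: field_simps)
      then show ?case using bound[OF e, of n] by simp
    qed
  qed
qed

section \<open>Norms on the strip, normalisation and conclusion\<close>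

context weyl
begin

definition J :: real where "J = (\<integral>t. 1 / (1 + t\<^sup>2) \<partial>lborel)"

lemma J_nonneg: "J \<ge> 0"
  unfolding J_def by (intro integral_nonneg_AE) (auto simp: add_nonneg_nonneg)

text \<open>On the strip s x \<ge> s N, so the profile is dominated by the one scaled with s N. The
  majorant is then a product of functions of x and y, with integrals 2 N and J / s N.\<close>

lemma sq_int_strip:
  assumes "F \<in> borel_measurable borel" and N: "N \<ge> 1" and "B \<ge> 0"
    and F: "\<And>x y. cmod (F (x, y)) \<le> B * (indicator {N..3 * N} x * (1 / (1 + (s x * y)\<^sup>2)))"
  shows "sq_int F" "(l2norm F)\<^sup>2 \<le> B\<^sup>2 * (2 * N * (J / s N))"
proof -
  define f where "f x = (indicator {N..3 * N} x :: real)" for x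
  define g where "g y = 1 / (1 + (0 + s N * y)\<^sup>2)" for y
  have sN: "s N > 0" using s_ge_1[of N] by simp
  have f: "integrable lborel f" "\<And>x. f x \<ge> 0" "integral\<^sup>L lborel f = 2 * N"
    using N by (auto simp: f_def[abs_def])
  have g: "integrable lborel g" "\<And>x. g x \<ge> 0"
    using lborel_integrable_real_affine[OF integrable_lorentzian, of "s N" 0] sN
    by (auto simp: g_def[abs_def] add_nonneg_nonneg)
  have "J = s N * integral\<^sup>L lborel g"
    using lborel_integral_real_affine[of "s N" "\<lambda>t. 1 / (1 + t\<^sup>2)" 0] sN by (simp add: J_def g_def[abs_def])
  then have gJ: "integral\<^sup>L lborel g = J / s N"
    using sN by (metis less_irrefl nonzero_mult_div_cancel_left)
  note pi = lborel_product_integral[OF f(1,2) g]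
  have "(cmod (F z))\<^sup>2 \<le> B\<^sup>2 * (case z of (x, y) \<Rightarrow> f x * g y)" for z
  proof -
    obtain x y where z: "z = (x, y)" by (cases z)
    define t where "t = s x * y"
    have "(cmod (F z))\<^sup>2 \<le> (B * (f x * (1 / (1 + t\<^sup>2))))\<^sup>2"
      using F[of x y] by (intro power_mono) (auto simp: z f_def t_def)
    also have "\<dots> = B\<^sup>2 * (f x * (1 / (1 + t\<^sup>2))\<^sup>2)"
      by (simp add: power_mult_distrib power_divide f_def indicator_def)
    also have "\<dots> \<le> B\<^sup>2 * (f x * g y)"
    proof (cases "x \<in> {N..3 * N}")
      case True
      then have "s N \<le> s x" using N by (intro s_mono) auto
      then have "(s N)\<^sup>2 * y\<^sup>2 \<le> (s x)\<^sup>2 * y\<^sup>2" using sN by (intro mult_right_mono power_mono) auto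
      then have "1 / (1 + t\<^sup>2) \<le> g y"
        unfolding g_def t_def power_mult_distrib add_0
        by (intro divide_left_mono add_left_mono mult_pos_pos) (auto simp: add_pos_nonneg)
      then have "(1 / (1 + t\<^sup>2))\<^sup>2 \<le> g y" using lorentzian_sq_le[of t] by linarith
      then show ?thesis by (intro mult_left_mono f) auto
    qed (simp add: f_def)
    finally show ?thesis by (simp add: z)
  qed
  moreover have "F \<in> borel_measurable lborel" using assms(1) by simp
  ultimately have *: "sq_int F" "(l2norm F)\<^sup>2 \<le> (\<integral>z. B\<^sup>2 * (case z of (x, y) \<Rightarrow> f x * g y) \<partial>lborel)"
    using sq_int_dominated[OF _ integrable_mult_right[OF pi(1)]] by blast+
  show "sq_int F" by (rule *)
  show "(l2norm F)\<^sup>2 \<le> B\<^sup>2 * (2 * N * (J / s N))"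
    using *(2) by (simp only: integral_mult_right_zero pi(2) f(3) gJ)
qed

lemma psi_measurable:
  assumes "h \<in> C0inf1" "N \<ge> 1"
  shows "\<psi> c N h \<in> borel_measurable borel" "Lop p l (\<psi> c N h) \<in> borel_measurable borel"
proof -
  have sm: "smooth2 (\<psi> c N h)" using psi_C0inf2[OF assms] by (simp add: C0inf2_def)
  have c: "continuous_on UNIV (pder bs (\<psi> c N h))" for bs using sm by (simp add: smooth2_def)
  show "\<psi> c N h \<in> borel_measurable borel"
    using borel_measurable_continuous_onI[OF c[of "[]"]] by simp
  \<comment> \<open>The absolute value around the nonnegative sum of squares only serves to fit
    \<open>continuous_on_abs_powr\<close>.\<close>
  have "continuous_on UNIV (\<lambda>z. - (dx (dx (\<psi> c N h)) z + dy (dy (\<psi> c N h)) z)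
      + complex_of_real (\<bar>fst z * snd z\<bar> powr p - l * \<bar>(fst z)\<^sup>2 + (snd z)\<^sup>2\<bar> powr a) * \<psi> c N h z)"
    using c[of "[]"] c[of "[True, True]"] c[of "[False, False]"] p exponent_bounds
    by (intro continuous_intros continuous_on_abs_powr) auto
  also have "(\<lambda>z. - (dx (dx (\<psi> c N h)) z + dy (dy (\<psi> c N h)) z)
      + complex_of_real (\<bar>fst z * snd z\<bar> powr p - l * \<bar>(fst z)\<^sup>2 + (snd z)\<^sup>2\<bar> powr a) * \<psi> c N h z) = Lop p l (\<psi> c N h)"
    by (auto simp: Lop_def fun_eq_iff a_def)
  finally show "Lop p l (\<psi> c N h) \<in> borel_measurable borel"
    by (rule borel_measurable_continuous_onI)
qed

lemma psi_sq_int: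
  assumes near: "near_ground_state p l u K \<epsilon> h" and h: "h \<in> C0inf1" and N: "N \<ge> 1" and c: "c \<ge> 0"
    and \<epsilon>: "\<epsilon> * (1 + 9 * N\<^sup>2) powr a \<le> 1 / N" "\<epsilon> \<ge> 0"
  shows "sq_int (\<psi> c N h)" "sq_int (Lop p l (\<psi> c N h))"
    "(l2dist (Lop p l (\<psi> c N h)) (\<lambda>z. (complex_of_real k)\<^sup>2 * \<psi> c N h z))\<^sup>2
      \<le> (c * D * rate N)\<^sup>2 * (2 * N * (J / s N))"
proof -
  have sh: "smooth1 h" using h by (simp add: C0inf1_def)
  note m = psi_measurable[OF h N, of c]
  have D0: "D \<ge> 0" using D by simp
  have r0: "rate N \<ge> 0" using N K k p by (auto simp: rate_def intro!: add_nonneg_nonneg divide_nonneg_nonneg)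
  have "cmod (\<psi> c N h (x, y)) \<le> (c * D * K) * (indicator {N..3 * N} x * (1 / (1 + (s x * y)\<^sup>2)))" for x y
  proof (cases "x \<in> {N..3 * N}")
    case True
    define t where "t = s x * y"
    have "1 * norm (h t) \<le> (1 + t\<^sup>2) * norm (h t)" by (intro mult_right_mono) auto
    moreover have "(1 + t\<^sup>2) * norm (h t) \<le> K / (1 + t\<^sup>2)"
      using near by (simp add: near_ground_state_def)
    ultimately have "norm (h t) \<le> K / (1 + t\<^sup>2)" by simp
    then have "norm (E c N x) * norm (h t) \<le> (c * D) * (K / (1 + t\<^sup>2))"
      using E_bounds(1)[OF N c] c D0 by (intro mult_mono) auto
    then show ?thesis using True by (simp add: \<psi>_def norm_mult t_def)
  qed (use E_support N in \<open>simp add: \<psi>_def\<close>)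
  then show s1: "sq_int (\<psi> c N h)"
    by (intro sq_int_strip(1)[OF m(1) N, of "c * D * K"]) (use c D0 K in auto)
  define e where "e z = Lop p l (\<psi> c N h) z - (complex_of_real k)\<^sup>2 * \<psi> c N h z" for z
  have em: "e \<in> borel_measurable borel" unfolding e_def using m by measurable
  have "cmod (e (x, y)) \<le> (c * D * rate N) * (indicator {N..3 * N} x * (1 / (1 + (s x * y)\<^sup>2)))" for x y
    unfolding e_def by (rule Lop_error[OF near sh N c \<epsilon>])
  from sq_int_strip[OF em N _ this] have e: "sq_int e" "(l2norm e)\<^sup>2 \<le> (c * D * rate N)\<^sup>2 * (2 * N * (J / s N))"
    using c D0 r0 by auto
  have "sq_int (\<lambda>z. e z + (complex_of_real k)\<^sup>2 * \<psi> c N h z)"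
    by (intro sq_int_add sq_int_cmult e s1)
  then show "sq_int (Lop p l (\<psi> c N h))" by (simp add: e_def)
  show "(l2dist (Lop p l (\<psi> c N h)) (\<lambda>z. (complex_of_real k)\<^sup>2 * \<psi> c N h z))\<^sup>2
      \<le> (c * D * rate N)\<^sup>2 * (2 * N * (J / s N))"
    using e(2) by (simp add: l2dist_def e_def[abs_def])
qed

text \<open>Restrict to the box |x - 2 N| \<le> r N, |y| \<le> \<tau> / s (3 N). There r \<le> 1
  keeps x \<le> 3 N, the scaled variable stays within \<tau>, and the product is at least u0 / 2 in
  modulus.\<close>

lemma psi_norm_lower:
  assumes i: "sq_int (\<psi> 1 N h)" and N: "N \<ge> 1" and r: "0 < r" "r \<le> 1" and \<tau>: "\<tau> > 0" and u0: "u0 > 0"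
    and \<theta>r: "\<And>z. \<bar>z\<bar> \<le> r \<Longrightarrow> 1 / 2 \<le> norm (\<theta> z)" and h\<tau>: "\<And>t. \<bar>t\<bar> \<le> \<tau> \<Longrightarrow> u0 \<le> norm (h t)"
  shows "u0\<^sup>2 * r * N * \<tau> / s (3 * N) \<le> (l2norm (\<psi> 1 N h))\<^sup>2"
proof -
  define f where "f x = (indicator {2 * N - r * N..2 * N + r * N} x :: real)" for x
  define g where "g x = (indicator {- (\<tau> / s (3 * N))..\<tau> / s (3 * N)} x :: real)" for x
  have s3: "s (3 * N) > 0" using s_ge_1[of "3 * N"] by simp
  have f: "integrable lborel f" "\<And>x. f x \<ge> 0" "integral\<^sup>L lborel f = 2 * r * N"
    using N r by (auto simp: f_def[abs_def])
  have "- (\<tau> / s (3 * N)) \<le> \<tau> / s (3 * N)"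
    using \<tau> s3 by (meson divide_nonneg_pos less_imp_le neg_le_0_iff_le order_trans)
  then have g: "integrable lborel g" "\<And>x. g x \<ge> 0" "integral\<^sup>L lborel g = 2 * \<tau> / s (3 * N)"
    by (auto simp: g_def[abs_def])
  note pi = lborel_product_integral[OF f(1,2) g(1,2)]
  have le: "(u0 / 2)\<^sup>2 * (case z of (x, y) \<Rightarrow> f x * g y) \<le> (cmod (\<psi> 1 N h z))\<^sup>2" for z
  proof -
    obtain x y where z: "z = (x, y)" by (cases z)
    show ?thesis
    proof (cases "x \<in> {2 * N - r * N..2 * N + r * N} \<and> y \<in> {- (\<tau> / s (3 * N))..\<tau> / s (3 * N)}")
      case True
      have "\<bar>1 / N * x + (- 2)\<bar> \<le> r" using True N by (auto simp: abs_le_iff field_simps)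
      then have 1: "1 / 2 \<le> norm (E 1 N x)" using \<theta>r by (simp add: E_def norm_mult)
      have "r * N \<le> N" using r N by simp
      moreover have "2 * N - r * N \<le> x" "x \<le> 2 * N + r * N" using True by auto
      ultimately have "0 \<le> x" "x \<le> 3 * N" using N by linarith+
      then have "s x \<le> s (3 * N)" by (rule s_mono)
      moreover have "\<bar>y\<bar> \<le> \<tau> / s (3 * N)" using True by auto
      ultimately have "s x * \<bar>y\<bar> \<le> s (3 * N) * (\<tau> / s (3 * N))"
        using s3 by (intro mult_mono) auto
      then have "\<bar>s x * y\<bar> \<le> \<tau>" using s3 s_ge_1[of x] by (simp add: abs_mult)
      then have "u0 \<le> norm (h (s x * y))" by (rule h\<tau>)
      then have "1 / 2 * u0 \<le> norm (E 1 N x) * norm (h (s x * y))"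
        using 1 u0 by (intro mult_mono) auto
      then have "(u0 / 2)\<^sup>2 \<le> (cmod (\<psi> 1 N h z))\<^sup>2"
        using u0 by (intro power_mono) (auto simp: \<psi>_def z norm_mult)
      then show ?thesis using True by (simp add: z f_def g_def)
    qed (auto simp: z f_def g_def)
  qed
  have "(\<integral>z. (u0 / 2)\<^sup>2 * (case z of (x, y) \<Rightarrow> f x * g y) \<partial>lborel) \<le> (l2norm (\<psi> 1 N h))\<^sup>2"
    unfolding l2norm_sq using i by (intro integral_mono le integrable_mult_right pi(1)) (auto simp: sq_int_def)
  then have "(u0 / 2)\<^sup>2 * (2 * r * N * (2 * \<tau> / s (3 * N))) \<le> (l2norm (\<psi> 1 N h))\<^sup>2"
    by (simp only: integral_mult_right_zero pi(2) f(3) g(3))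
  then show ?thesis by (simp add: power2_eq_square field_simps)
qed

text \<open>The norm of the product is bounded below with s (3 * N) and the error above with s N;
  this makes them comparable uniformly in N.\<close>

lemma s_triple: "N \<ge> 1 \<Longrightarrow> s (3 * N) \<le> 3 * s N"
proof -
  assume "N \<ge> 1"
  have "s (3 * N) \<le> (9 * (1 + N\<^sup>2)) powr (a / 2)"
    unfolding s_def using exponent_bounds by (intro powr_mono2) (auto simp: power_mult_distrib)
  also have "\<dots> = 9 powr (a / 2) * s N"
    by (simp only: powr_mult s_def)
  also have "\<dots> \<le> 9 powr (1 / 2) * s N"
    using exponent_bounds s_ge_1[of N] by (intro mult_right_mono powr_mono) auto
  also have "(9::real) powr (1 / 2) = 3"
    using powr_half_sqrt[of 9] real_sqrt_abs[of 3] by simp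
  finally show ?thesis .
qed

text \<open>The upper bound for the error carries N / s N and the lower bound for the norm N / s (3
  * N), so N cancels up to the factor 3 of \<open>s_triple\<close>, which turns the constant 2 into
  6. What remains is independent of N apart from \<open>rate\<close>.\<close>

lemma psi_normalised:
  assumes near: "near_ground_state p l u K \<epsilon> h" and h: "h \<in> C0inf1" and N: "N \<ge> 1"
    and \<epsilon>: "\<epsilon> * (1 + 9 * N\<^sup>2) powr a \<le> 1 / N" "\<epsilon> \<ge> 0"
    and r: "0 < r" "r \<le> 1" and \<tau>: "\<tau> > 0" and u0: "u0 > 0"
    and \<theta>r: "\<And>z. \<bar>z\<bar> \<le> r \<Longrightarrow> 1 / 2 \<le> norm (\<theta> z)" and h\<tau>: "\<And>t. \<bar>t\<bar> \<le> \<tau> \<Longrightarrow> u0 \<le> norm (h t)"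
  obtains c where "c \<ge> 0" "l2norm (\<psi> c N h) = 1" "sq_int (\<psi> c N h)" "sq_int (Lop p l (\<psi> c N h))"
    "(l2dist (Lop p l (\<psi> c N h)) (\<lambda>z. (complex_of_real k)\<^sup>2 * \<psi> c N h z))\<^sup>2
      \<le> (6 * D\<^sup>2 * J / (u0\<^sup>2 * r * \<tau>)) * (rate N)\<^sup>2"
proof -
  have s1: "sq_int (\<psi> 1 N h)" by (rule psi_sq_int(1)[OF near h N _ \<epsilon>]) simp
  have s3: "s (3 * N) > 0" "s N > 0" using s_ge_1[of "3 * N"] s_ge_1[of N] by auto
  define L where "L = u0\<^sup>2 * r * N * \<tau> / s (3 * N)"
  have L: "L > 0" using u0 r N \<tau> s3 by (simp add: L_def)
  have LL: "L \<le> (l2norm (\<psi> 1 N h))\<^sup>2"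
    unfolding L_def by (rule psi_norm_lower[OF s1 N r \<tau> u0 \<theta>r h\<tau>])
  define c where "c = 1 / l2norm (\<psi> 1 N h)"
  have n0: "l2norm (\<psi> 1 N h) > 0"
    using L LL by (metis l2norm_nonneg less_eq_real_def not_less zero_eq_power2)
  then have c: "c \<ge> 0" by (simp add: c_def)
  have "\<psi> c N h = (\<lambda>z. complex_of_real c * \<psi> 1 N h z)"
    by (auto simp: \<psi>_def E_def fun_eq_iff)
  then have "(l2norm (\<psi> c N h))\<^sup>2 = c\<^sup>2 * (l2norm (\<psi> 1 N h))\<^sup>2"
    using sq_int_cmult(2)[OF s1, of "complex_of_real c"] by simp
  also have "\<dots> = 1" using n0 by (simp add: c_def power_divide)
  finally have n1: "l2norm (\<psi> c N h) = 1"
    by (metis l2norm_nonneg one_power2 power2_eq_imp_eq zero_le_one)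
  note psi = psi_sq_int[OF near h N c \<epsilon>]
  have c2: "c\<^sup>2 \<le> 1 / L"
    unfolding c_def power_divide power_one using LL L n0 by (intro divide_left_mono mult_pos_pos) auto
  have "(c * D * rate N)\<^sup>2 * (2 * N * (J / s N)) = c\<^sup>2 * ((D * rate N)\<^sup>2 * (2 * N * (J / s N)))"
    by (simp add: power_mult_distrib)
  also have "\<dots> \<le> 1 / L * ((D * rate N)\<^sup>2 * (2 * N * (J / s N)))"
    using c2 N J_nonneg s3 by (intro mult_right_mono) auto
  also have "\<dots> = (2 * D\<^sup>2 * J / (u0\<^sup>2 * r * \<tau>)) * (rate N)\<^sup>2 * (s (3 * N) / s N)"
    using N u0 r \<tau> s3 by (simp add: L_def field_simps power2_eq_square)
  also have "\<dots> \<le> (2 * D\<^sup>2 * J / (u0\<^sup>2 * r * \<tau>)) * (rate N)\<^sup>2 * 3"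
    using s_triple[OF N] s3 J_nonneg u0 r \<tau> by (intro mult_left_mono mult_nonneg_nonneg divide_nonneg_nonneg) (auto simp: divide_le_eq)
  finally have "(l2dist (Lop p l (\<psi> c N h)) (\<lambda>z. (complex_of_real k)\<^sup>2 * \<psi> c N h z))\<^sup>2
      \<le> (6 * D\<^sup>2 * J / (u0\<^sup>2 * r * \<tau>)) * (rate N)\<^sup>2"
    using psi(3) by (simp add: mult_ac)
  then show ?thesis using that c n1 psi(1,2) by blast
qed

end

theorem theorem3p1:
  fixes p :: real
  assumes "p \<ge> 1"
  shows "{complex_of_real l | l. l \<ge> 0} \<subseteq> ess_spec (Lp_graph p (gamma p))"
proof clarify
  fix m :: real assume m: "m \<ge> 0"
  define k where "k = sqrt m"
  have km: "k \<ge> 0" "(complex_of_real k)\<^sup>2 = complex_of_real m"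
    using m by (simp_all add: k_def of_real_power[symmetric] del: of_real_power)
  obtain l C :: real and u u' :: "real \<Rightarrow> real" where C: "C > 0"
    and u: "\<And>t. (u has_real_derivative u' t) (at t)"
    and u': "\<And>t. (u' has_real_derivative (\<bar>t\<bar> powr p - l) * u t) (at t)"
    and pos: "\<And>t. u t > 0" and ub: "\<And>t. \<bar>u t\<bar> \<le> C * exp (- \<bar>t\<bar>)" and u'b: "\<And>t. \<bar>u' t\<bar> \<le> C * exp (- \<bar>t\<bar>)"
    using ground_state_exists[OF assms] by metis
  have gam: "gamma p = l" by (rule gamma_eq[OF assms C u u' pos ub u'b])
  obtain K where K0: "K > 0" and approx: "\<And>\<epsilon>. \<epsilon> > 0 \<Longrightarrow> \<exists>h\<in>C0inf1. near_ground_state p l u K \<epsilon> h"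
    using approx_ground_state[OF assms C u u' ub u'b] by blast
  obtain \<theta> :: "real \<Rightarrow> complex" and D where cut: "smooth1 \<theta>" "\<theta> 0 = 1" "D \<ge> 1"
    "\<And>t. 1 < \<bar>t\<bar> \<Longrightarrow> \<theta> t = 0"
    "\<And>t. norm (\<theta> t) \<le> D" "\<And>t. norm (vd \<theta> t) \<le> D" "\<And>t. norm (vd (vd \<theta>) t) \<le> D"
    using cutoff_exists by blast
  interpret weyl p l k K D u \<theta>
    by unfold_locales (use assms km K0 cut in auto)
  \<comment> \<open>The cutoff has Lipschitz constant D and equals 1 at 0, so it moves by at most
    1/2 within this radius.\<close>
  define r where "r = 1 / (2 * D)"
  have r: "0 < r" "r \<le> 1" using cut(3) by (auto simp: r_def)
  have \<theta>r: "1 / 2 \<le> norm (\<theta> z)" if "\<bar>z\<bar> \<le> r" for z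
  proof -
    have "norm (1 - \<theta> z) \<le> D * \<bar>z\<bar>"
      using smooth1_lipschitz[OF cut(1,6), of 0 z] cut(2) by simp
    also have "\<dots> \<le> D * r" using that cut(3) by (intro mult_left_mono) auto
    also have "\<dots> = 1 / 2" using cut(3) by (simp add: r_def)
    finally show ?thesis using norm_triangle_ineq2[of 1 "1 - \<theta> z"] by simp
  qed
  obtain t0 where t0: "t0 \<in> {-1..1}" "\<And>t. t \<in> {-1..1} \<Longrightarrow> u t0 \<le> u t"
    using continuous_attains_inf[of "{-1..1}" u] continuous_on_DERIV[OF u] by auto
  \<comment> \<open>Half the minimum of u on {-1..1}: an approximation with error at most u0 still
    has modulus at least u0 there, whatever the index n.\<close>
  define u0 where "u0 = u t0 / 2"
  have u0: "u0 > 0" using pos by (simp add: u0_def)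
  \<comment> \<open>The first entry secures the lower bound for h, the second beats the growth of
    s^2 on the strip with N = Suc n.\<close>
  define ep where "ep n = min u0 (1 / (real (Suc n) * (1 + 9 * (real (Suc n))\<^sup>2) powr a))" for n
  have ep: "ep n > 0" "ep n \<le> u0" "ep n * (1 + 9 * (real (Suc n))\<^sup>2) powr a \<le> 1 / real (Suc n)" for n
  proof -
    have y: "(1 + 9 * (real (Suc n))\<^sup>2) powr a > 0"
      using one_plus_sq_pos[of "3 * real (Suc n)"] unfolding power_mult_distrib powr_gt_zero by simp
    then show "ep n > 0" using u0 by (simp add: ep_def)
    have "ep n * (1 + 9 * (real (Suc n))\<^sup>2) powr a
        \<le> 1 / (real (Suc n) * (1 + 9 * (real (Suc n))\<^sup>2) powr a) * (1 + 9 * (real (Suc n))\<^sup>2) powr a"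
      using y by (intro mult_right_mono) (auto simp: ep_def)
    also have "\<dots> = 1 / real (Suc n)"
    proof -
      have "1 / (A * Y) * Y = 1 / A" if "Y > 0" for A Y :: real using that by simp
      from this[OF y] show ?thesis .
    qed
    finally show "ep n * (1 + 9 * (real (Suc n))\<^sup>2) powr a \<le> 1 / real (Suc n)" .
  qed (simp add: ep_def)
  define R where "R = 6 * D\<^sup>2 * J / (u0\<^sup>2 * r * 1)"
  have "\<exists>f. f \<in> C0inf2 \<and> l2norm f = 1 \<and> sq_int f \<and> sq_int (Lop p l f) \<and>
      (l2dist (Lop p l f) (\<lambda>z. complex_of_real m * f z))\<^sup>2 \<le> R * (rate (real (Suc n)))\<^sup>2 \<and>
      (\<forall>x y. x < real n \<longrightarrow> f (x, y) = 0)" for n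
  proof -
    obtain h where h: "h \<in> C0inf1" and near: "near_ground_state p l u K (ep n) h"
      using approx ep(1) by blast
    have N: "real (Suc n) \<ge> 1" by simp
    have h\<tau>: "u0 \<le> norm (h t)" if "\<bar>t\<bar> \<le> 1" for t
    proof -
      have "norm (h t - complex_of_real (u t)) \<le> ep n / (1 + t\<^sup>2)"
        using near by (simp add: near_ground_state_def)
      also have "\<dots> \<le> ep n / 1"
        using ep(1)[of n] by (intro divide_left_mono) (auto simp: add_pos_nonneg)
      also have "\<dots> \<le> u0" using ep(2) by simp
      finally have "norm (complex_of_real (u t) - h t) \<le> u0" by (simp add: norm_minus_commute)
      moreover have "2 * u0 \<le> u t" using t0(2)[of t] that by (simp add: u0_def abs_le_iff)
      moreover have "u t \<le> norm (complex_of_real (u t))" by simp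
      ultimately show ?thesis
        using norm_triangle_ineq2[of "complex_of_real (u t)" "complex_of_real (u t) - h t"] by simp
    qed
    obtain c where c: "l2norm (\<psi> c (real (Suc n)) h) = 1" "sq_int (\<psi> c (real (Suc n)) h)"
      "sq_int (Lop p l (\<psi> c (real (Suc n)) h))"
      "(l2dist (Lop p l (\<psi> c (real (Suc n)) h)) (\<lambda>z. (complex_of_real k)\<^sup>2 * \<psi> c (real (Suc n)) h z))\<^sup>2
        \<le> R * (rate (real (Suc n)))\<^sup>2"
      unfolding R_def
      using psi_normalised[OF near h N ep(3) less_imp_le[OF ep(1)] r zero_less_one u0 \<theta>r h\<tau>] by blast
    have "\<psi> c (real (Suc n)) h (x, y) = 0" if "x < real n" for x y
      using E_support[of "real (Suc n)" x c] that by (simp add: \<psi>_def)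
    then show ?thesis
      using c psi_C0inf2[OF h N] unfolding km(2) by blast
  qed
  then obtain f where f: "\<And>n. f n \<in> C0inf2" "\<And>n. l2norm (f n) = 1" "\<And>n. sq_int (f n)" "\<And>n. sq_int (Lop p l (f n))"
      "\<And>n. (l2dist (Lop p l (f n)) (\<lambda>z. complex_of_real m * f n z))\<^sup>2 \<le> R * (rate (real (Suc n)))\<^sup>2"
      "\<And>n x y. x < real n \<Longrightarrow> f n (x, y) = 0"
    by metis
  have l0: "l2dist g g = 0" for g :: "real \<times> real \<Rightarrow> complex" by (simp add: l2dist_def l2norm_def)
  \<comment> \<open>A constant approximating sequence suffices, since \<open>f n\<close> is itself a
    test function.\<close>
  have graph: "(f n, Lop p l (f n)) \<in> Lp_graph p (gamma p)" for n
    unfolding Lp_graph_def closure_graph_def gam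
    using f l0 by (auto intro!: exI[of _ "\<lambda>_. f n"])
  have "(\<lambda>n. R * (rate (real (Suc n)))\<^sup>2) \<longlonglongrightarrow> R * 0\<^sup>2"
    by (intro tendsto_intros rate_tendsto_0)
  then have R0: "(\<lambda>n. R * (rate (real (Suc n)))\<^sup>2) \<longlonglongrightarrow> 0" by simp
  have "(\<lambda>n. (l2dist (Lop p l (f n)) (\<lambda>z. complex_of_real m * f n z))\<^sup>2) \<longlonglongrightarrow> 0"
  proof (rule tendsto_sandwich[OF _ _ tendsto_const R0])
    show "\<forall>\<^sub>F n in sequentially. 0 \<le> (l2dist (Lop p l (f n)) (\<lambda>z. complex_of_real m * f n z))\<^sup>2"
      by simp
    show "\<forall>\<^sub>F n in sequentially. (l2dist (Lop p l (f n)) (\<lambda>z. complex_of_real m * f n z))\<^sup>2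
        \<le> R * (rate (real (Suc n)))\<^sup>2"
      using f(5) by (intro always_eventually allI)
  qed
  then have conv: "(\<lambda>n. l2dist (Lop p l (f n)) (\<lambda>z. complex_of_real m * f n z)) \<longlonglongrightarrow> 0"
    unfolding l2dist_def tendsto_zero_l2 .
  have weak: "(\<lambda>n. \<integral>x. f n x * cnj (g x) \<partial>lborel) \<longlonglongrightarrow> 0" if "sq_int g" for g
    by (rule weak_limit_zero[OF f(3,2) _ that]) (rule f(6))
  show "complex_of_real m \<in> ess_spec (Lp_graph p (gamma p))"
    unfolding ess_spec_def
    by (intro CollectI exI[of _ f] exI[of _ "\<lambda>n. Lop p l (f n)"] conjI allI impI graph f(2) weak conv)
qed

end
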